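(* For a sequence $(s_n)_{n\ge 0}$ with $s_n>0$ for all $n$ the following conditions are equivalent: (i) $(s_n^c)_{n\ge0}$ is a normalized Stieltjes moment sequence for each $c>0$, i.e. $(s_n)\in\mathcal I$. (ii) There exist $a\in\mathbb R$, $b\ge 0$ and a positive Radon measure $\sigma$ on $[0,\infty[\setminus\{1\}$ satisfying $$\int_0^\infty(1-x)^2\,d\sigma(x)<\infty,\qquad \int_2^\infty x^n\,d\sigma(x)<\infty,\quad n\ge 3,$$ such that $$\log s_n=an+bn^2+\int_0^\infty\bigl(x^n-1-n(x-1)\bigr)\,d\sigma(x),\qquad n=0,1,\ldots.$$ (iii) There exist $0<\varepsilon\le 1$ and an infinitely divisible probability $\omega$ on $\mathbb R$ such that $$s_n=(1-\varepsilon)\delta_{0n}+\varepsilon\int_{-\infty}^\infty e^{-ny}\,d\omega(y),\qquad n\ge 0.$$ (iv) There exist $0<\varepsilon\le 1$ and a product convolution semigroup $(\rho_c)_{c>0}$ of probabilities on $]0,\infty[$ such that $$s_n^c=(1-\varepsilon^c)\delta_{0n}+\varepsilon^c\int_0^\infty x^n\,d\rho_c(x),\qquad n\ge 0,\ c>0.$$ Moreover, assume $(s_n)\in\mathcal I$ (with $s_n>0$ for all $n$). If $(s_n^c)$ is S-determinate for some $c=c_0>0$, then the quantities $a,b,\sigma,\varepsilon,\omega,(\rho_c)_{c>0}$ from (ii)–(iv) are uniquely determined. Furthermore $a=\log s_1$, $b=0$ and the finite measure $(1-x)^2\,d\sigma(x)$ is S-determinate.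
   Context: A Stieltjes moment sequence is a sequence of the form $s_n=\int_0^\infty x^n\,d\mu(x)$, $n=0,1,\ldots$, where $\mu$ is a non-negative measure on $[0,\infty[$ (with all these moments finite). It is normalized if $s_0=1$. It is S-determinate if there is only one measure $\mu$ on $[0,\infty[$ with these moments. A measure on $[0,\infty[$ with moments of all orders is called S-determinate if its moment sequence is S-determinate; here $(1-x)^2\,d\sigma(x)$ is regarded as a measure on $[0,\infty[$ with no mass at $1$. $\mathcal I$ denotes the set of normalized Stieltjes moment sequences $(s_n)$ such that $(s_n^c)$ is a Stieltjes moment sequence for each $c>0$. $\delta_{0n}$ is the Kronecker delta, i.e. $(\delta_{0n})_{n\ge0}=(1,0,0,\ldots)$; $x^0=1$ for all $x\ge0$. Integrals against $\sigma$ are over the indicated interval with the point $1$ removed. Infinite divisibility of $\omega$ on $\mathbb R$ is with respect to ordinary (additive) convolution. The product convolution $\mu\diamond\nu$ of two measures on $[0,\infty[$ is the image of $\mu\otimes\nu$ under $(s,t)\mapsto st$. A product convolution semigroup is a family $(\rho_c)_{c>0}$ of probabilities on $]0,\infty[$ such that $\rho_c\diamond\rho_d=\rho_{c+d}$ for all $c,d>0$ and $c\mapsto\rho_c$ is weakly continuous. *)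

theory Defs
  imports "HOL-Probability.Probability"
begin

text \<open>
  A measure on a Borel set \<open>S\<close> of real numbers is identified with the Borel measure on the whole
  line that has no mass outside \<open>S\<close>. Integrals over \<open>S\<close> are then plain integrals. In particular,
  for the measure \<open>\<sigma>\<close> on \<open>{0..} - {1}\<close> below, integrals over \<open>{0..}\<close> omit the point \<open>1\<close>.
\<close>

definition borel_measure_on :: "real set \<Rightarrow> real measure \<Rightarrow> bool" where
  "borel_measure_on S \<mu> \<longleftrightarrow> sets \<mu> = sets borel \<and> (AE x in \<mu>. x \<in> S)"

definition radon_measure_on :: "real set \<Rightarrow> real measure \<Rightarrow> bool" where
  "radon_measure_on S \<mu> \<longleftrightarrow>
     borel_measure_on S \<mu> \<and> (\<forall>K. compact K \<and> K \<subseteq> S \<longrightarrow> emeasure \<mu> K < \<infinity>)"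

definition has_stieltjes_moments :: "real measure \<Rightarrow> (nat \<Rightarrow> real) \<Rightarrow> bool" where
  "has_stieltjes_moments \<mu> s \<longleftrightarrow>
     borel_measure_on {0..} \<mu> \<and>
     (\<forall>n. integrable \<mu> (\<lambda>x. x ^ n) \<and> s n = (\<integral>x. x ^ n \<partial>\<mu>))"

definition stieltjes_moment_seq :: "(nat \<Rightarrow> real) \<Rightarrow> bool" where
  "stieltjes_moment_seq s \<longleftrightarrow> (\<exists>\<mu>. has_stieltjes_moments \<mu> s)"

definition normalized_stieltjes_moment_seq :: "(nat \<Rightarrow> real) \<Rightarrow> bool" where
  "normalized_stieltjes_moment_seq s \<longleftrightarrow> stieltjes_moment_seq s \<and> s 0 = 1"

definition S_determinate :: "(nat \<Rightarrow> real) \<Rightarrow> bool" where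
  "S_determinate s \<longleftrightarrow> (\<exists>!\<mu>. has_stieltjes_moments \<mu> s)"

definition S_determinate_measure :: "real measure \<Rightarrow> bool" where
  "S_determinate_measure \<mu> \<longleftrightarrow> (\<exists>s. has_stieltjes_moments \<mu> s \<and> S_determinate s)"

text \<open>The class \<open>\<I>\<close>. Stieltjes moments are nonnegative, so \<open>powr\<close> is the ordinary power here.\<close>

definition inf_div_stieltjes :: "(nat \<Rightarrow> real) set" where
  "inf_div_stieltjes =
     {s. normalized_stieltjes_moment_seq s \<and> (\<forall>c>0. stieltjes_moment_seq (\<lambda>n. s n powr c))}"

definition infinitely_divisible :: "real measure \<Rightarrow> bool" where
  "infinitely_divisible \<omega> \<longleftrightarrow>
     real_distribution \<omega> \<and>
     (\<forall>n\<ge>1. \<exists>\<nu>. real_distribution \<nu> \<and> ((\<lambda>\<kappa>. \<nu> \<star> \<kappa>) ^^ n) (return borel 0) = \<omega>)"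

definition product_convolution :: "real measure \<Rightarrow> real measure \<Rightarrow> real measure"
    (infixl \<open>\<diamondop>\<close> 70) where
  "\<mu> \<diamondop> \<nu> = distr (\<mu> \<Otimes>\<^sub>M \<nu>) borel (\<lambda>(s, t). s * t)"

text \<open>The parameter of the family ranges over \<open>{0<..}\<close>; its values elsewhere are irrelevant.\<close>

definition product_convolution_semigroup :: "(real \<Rightarrow> real measure) \<Rightarrow> bool" where
  "product_convolution_semigroup \<rho> \<longleftrightarrow>
     (\<forall>c>0. prob_space (\<rho> c) \<and> borel_measure_on {0<..} (\<rho> c)) \<and>
     (\<forall>c>0. \<forall>d>0. \<rho> c \<diamondop> \<rho> d = \<rho> (c + d)) \<and>
     (\<forall>f::real \<Rightarrow> real. continuous_on {0<..} f \<and> bounded (f ` {0<..}) \<longrightarrow>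
        continuous_on {0<..} (\<lambda>c. LINT x:{0<..}|\<rho> c. f x))"

text \<open>
  The two integral conditions on \<open>\<sigma>\<close> make the integrand in the formula for \<open>ln (s n)\<close> integrable:
  it is a polynomial multiple of \<open>(1 - x)\<^sup>2\<close>, and for \<open>x \<ge> 2\<close> and \<open>n \<ge> 2\<close> it lies between \<open>0\<close>
  and \<open>x ^ n\<close>. So the Bochner integral never takes its default value.
\<close>

definition levy_representation ::
    "(nat \<Rightarrow> real) \<Rightarrow> real \<Rightarrow> real \<Rightarrow> real measure \<Rightarrow> bool" where
  "levy_representation s a b \<sigma> \<longleftrightarrow>
     b \<ge> 0 \<and> radon_measure_on ({0..} - {1}) \<sigma> \<and>
     (\<integral>\<^sup>+x. ennreal ((1 - x)\<^sup>2) \<partial>\<sigma>) < \<infinity> \<and>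
     (\<forall>n\<ge>3. (\<integral>\<^sup>+x\<in>{2..}. ennreal (x ^ n) \<partial>\<sigma>) < \<infinity>) \<and>
     (\<forall>n. ln (s n) = a * real n + b * (real n)\<^sup>2
            + (\<integral>x. (x ^ n - 1 - real n * (x - 1)) \<partial>\<sigma>))"

definition laplace_representation ::
    "(nat \<Rightarrow> real) \<Rightarrow> real \<Rightarrow> real measure \<Rightarrow> bool" where
  "laplace_representation s \<epsilon> \<omega> \<longleftrightarrow>
     0 < \<epsilon> \<and> \<epsilon> \<le> 1 \<and> infinitely_divisible \<omega> \<and>
     (\<forall>n. integrable \<omega> (\<lambda>y. exp (- real n * y)) \<and>
          s n = (1 - \<epsilon>) * of_bool (n = 0) + \<epsilon> * (\<integral>y. exp (- real n * y) \<partial>\<omega>))"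

definition semigroup_representation ::
    "(nat \<Rightarrow> real) \<Rightarrow> real \<Rightarrow> (real \<Rightarrow> real measure) \<Rightarrow> bool" where
  "semigroup_representation s \<epsilon> \<rho> \<longleftrightarrow>
     0 < \<epsilon> \<and> \<epsilon> \<le> 1 \<and> product_convolution_semigroup \<rho> \<and>
     (\<forall>n. \<forall>c>0. integrable (\<rho> c) (\<lambda>x. x ^ n) \<and>
          s n powr c = (1 - \<epsilon> powr c) * of_bool (n = 0) + \<epsilon> powr c * (\<integral>x. x ^ n \<partial>\<rho> c))"

end

theory Submission
  imports Defs "HOL-Complex_Analysis.Complex_Analysis" "HOL-Real_Asymp.Real_Asymp"
begin

text \<open>
  The equivalences become transparent after taking second differences. Since
  \<open>x ^ (n + 2) - 2 * x ^ (n + 1) + x ^ n = (1 - x)\<^sup>2 * x ^ n\<close>, the second difference of \<open>n \<mapsto> ln (s n)\<close>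
  under a Levy representation is the moment sequence of the finite measure
  \<open>\<tau> = (1 - x)\<^sup>2 \<sigma> + 2 b \<delta>\<^sub>1\<close>. Conversely \<open>b\<close> is half the atom of \<open>\<tau>\<close> at \<open>1\<close>, \<open>\<sigma>\<close> is \<open>(1 - x)\<^sup>-\<^sup>2 \<tau>\<close> off
  that point, and \<open>a = ln (s 1) - b\<close>. So a Levy representation exists if and only if \<open>s 0 = 1\<close> and
  \<open>log_second_diff s\<close> is a Stieltjes moment sequence
  (\<open>levy_representation_if_moments\<close>, \<open>levy_representation_moment_measure\<close>).

  If the roots \<open>s n powr (1 / k)\<close> are moments of probabilities \<open>\<mu>\<^sub>k\<close>, then the moments of
  \<open>k (1 - x)\<^sup>2 d\<mu>\<^sub>k\<close> converge to \<open>log_second_diff s\<close>, because \<open>k (y powr (1 / k) - 1)\<close> tends to \<open>ln y\<close>, and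
  limits of Stieltjes moment sequences are again Stieltjes moment sequences
  (\<open>log_second_diff_stieltjes_if_roots\<close>). Infinite divisibility of \<open>\<omega>\<close> enters here: its
  convolution roots represent exactly these roots of the sequence (\<open>laplace_representation_root\<close>).

  For the way back, integer exponents are replaced by real exponents \<open>u > 0\<close>. The exponent
  \<open>g u = u * ln (s 1) + (\<integral>x. levy_kernel u x \<partial>\<tau>)\<close> interpolates \<open>ln (s n)\<close>, and for each \<open>c > 0\<close> approximation by
  compound Poisson distributions gives a probability \<open>\<mu>\<^sub>c\<close> on \<open>{0..}\<close> with \<open>\<integral>x. x powr u \<partial>\<mu>\<^sub>c = exp (c * g u)\<close>
  (\<open>levy_khintchine_has_mellin\<close>). Integer moments may fail to determine a measure, but its mass together with all
  moments of real order \<open>u > 0\<close> does determine it (\<open>finite_measure_mellin_unique\<close>, from analyticity of Laplace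
  transforms). Hence \<open>\<mu>\<^sub>c \<diamondop> \<mu>\<^sub>d = \<mu>\<^sub>c\<^sub>+\<^sub>d\<close>. Letting \<open>u\<close> tend to \<open>0\<close> shows that \<open>\<mu>\<^sub>c\<close> gives mass \<open>\<epsilon> powr c\<close> to \<open>{0<..}\<close>, and
  conditioning on this set yields the semigroup \<open>\<rho>\<close>; \<open>\<omega>\<close> is the image of \<open>\<rho> 1\<close> under \<open>- ln\<close>.

  For uniqueness, the same rigidity makes product convolution cancellative, so determinacy of \<open>s n powr c\<^sub>0\<close> is
  inherited by all smaller powers (\<open>S_determinate_smaller_power\<close>); this fixes \<open>\<epsilon>\<close>, \<open>\<rho>\<close> and \<open>\<omega>\<close>. Two measures with
  moments \<open>log_second_diff s\<close> produce the same \<open>\<mu>\<close> for the power \<open>c\<^sub>0\<close>, hence the same exponent \<open>g\<close>, whose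
  second difference in \<open>u\<close> gives back their real moments; so they agree (\<open>levy_moment_measure_unique\<close>). An atom of \<open>\<tau>\<close>
  at \<open>1\<close> would split off a factor with moments \<open>exp (\<beta> * n\<^sup>2)\<close>; that sequence is indeterminate
  (\<open>exp_square_indeterminate\<close>), and by cancellation so would be the power \<open>c\<^sub>0\<close>. Hence \<open>b = 0\<close>.
\<close>

section \<open>Weak limits under moment bounds\<close>

text \<open>
  Weak convergence controls bounded truncations of \<open>f\<^sup>2\<close>; Fatou's lemma then removes the truncation.
\<close>

lemma weak_conv_imp_square_integrable:
  fixes f :: "real \<Rightarrow> real"
  assumes M: "\<And>k. real_distribution (M k)" and \<mu>: "real_distribution \<mu>"
    and wc: "weak_conv_m M \<mu>" and cont: "continuous_on UNIV f"
    and sq: "\<And>k. integrable (M k) (\<lambda>x. (f x)\<^sup>2)" and bd: "\<And>k. (\<integral>x. (f x)\<^sup>2 \<partial>M k) \<le> D"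
  shows "integrable \<mu> (\<lambda>x. (f x)\<^sup>2)" "(\<integral>x. (f x)\<^sup>2 \<partial>\<mu>) \<le> D"
proof -
  interpret \<mu>: real_distribution \<mu> by fact
  have [measurable]: "f \<in> borel_measurable borel"
    using cont by (rule borel_measurable_continuous_onI)
  have D: "D \<ge> 0" by (rule order_trans[OF Bochner_Integration.integral_nonneg bd[of 0]]) simp
  have trunc: "(\<integral>\<^sup>+x. ennreal (min (real i) ((f x)\<^sup>2)) \<partial>\<mu>) \<le> ennreal D" for i
  proof -
    have "(\<lambda>k. \<integral>x. min (real i) ((f x)\<^sup>2) \<partial>M k) \<longlonglongrightarrow> (\<integral>x. min (real i) ((f x)\<^sup>2) \<partial>\<mu>)"
    proof (rule weak_conv_imp_integral_bdd_continuous_conv[OF M \<mu> wc, where B="real i"])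
      show "isCont (\<lambda>x. min (real i) ((f x)\<^sup>2)) x" for x
        using cont by (intro continuous_intros) (simp add: continuous_on_eq_continuous_at)
    qed auto
    moreover have "(\<integral>x. min (real i) ((f x)\<^sup>2) \<partial>M k) \<le> D" for k
    proof -
      interpret Mk: real_distribution "M k" by fact
      have "(\<integral>x. min (real i) ((f x)\<^sup>2) \<partial>M k) \<le> (\<integral>x. (f x)\<^sup>2 \<partial>M k)"
      proof (rule integral_mono[OF _ sq])
        show "integrable (M k) (\<lambda>x. min (real i) ((f x)\<^sup>2))"
          by (rule Mk.integrable_const_bound[where B="real i"]) auto
      qed simp
      then show ?thesis using bd[of k] by simp
    qed
    ultimately have "(\<integral>x. min (real i) ((f x)\<^sup>2) \<partial>\<mu>) \<le> D"
      by (intro LIMSEQ_le_const2) auto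
    then show ?thesis
      by (subst nn_integral_eq_integral)
        (auto intro!: \<mu>.integrable_const_bound[where B="real i"] ennreal_leI)
  qed
  have "(\<integral>\<^sup>+x. ennreal ((f x)\<^sup>2) \<partial>\<mu>) = (\<integral>\<^sup>+x. liminf (\<lambda>i. ennreal (min (real i) ((f x)\<^sup>2))) \<partial>\<mu>)"
  proof (rule nn_integral_cong)
    fix x
    have "(\<lambda>i. ennreal (min (real i) ((f x)\<^sup>2))) \<longlonglongrightarrow> ennreal ((f x)\<^sup>2)"
    proof (rule tendsto_eventually)
      show "\<forall>\<^sub>F i in sequentially. ennreal (min (real i) ((f x)\<^sup>2)) = ennreal ((f x)\<^sup>2)"
        using eventually_ge_at_top[of "nat \<lceil>(f x)\<^sup>2\<rceil>"]
        by eventually_elim (simp add: min_absorb2 nat_le_iff of_nat_ceiling ceiling_le_iff)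
    qed
    then show "ennreal ((f x)\<^sup>2) = liminf (\<lambda>i. ennreal (min (real i) ((f x)\<^sup>2)))"
      by (rule lim_imp_Liminf[OF sequentially_bot, symmetric])
  qed
  also have "\<dots> \<le> liminf (\<lambda>i. \<integral>\<^sup>+x. ennreal (min (real i) ((f x)\<^sup>2)) \<partial>\<mu>)"
    by (rule nn_integral_liminf) simp
  also have "\<dots> \<le> liminf (\<lambda>i. ennreal D)"
    by (intro Liminf_mono) (use trunc in auto)
  finally have fin: "(\<integral>\<^sup>+x. ennreal ((f x)\<^sup>2) \<partial>\<mu>) \<le> ennreal D"
    by (simp add: Liminf_const)
  show int: "integrable \<mu> (\<lambda>x. (f x)\<^sup>2)"
    by (rule integrableI_nonneg) (use fin in \<open>auto simp: le_less_trans\<close>)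
  show "(\<integral>x. (f x)\<^sup>2 \<partial>\<mu>) \<le> D"
    using fin D by (subst (asm) nn_integral_eq_integral[OF int]) auto
qed

text \<open>
  A uniform second moment makes \<open>f\<close> uniformly integrable: clipping \<open>f\<close> at \<open>\<plusminus>R\<close> changes every integral by at most
  \<open>D / R\<close>, and the clipped function is bounded and continuous.
\<close>

lemma weak_conv_imp_integral_conv:
  fixes f :: "real \<Rightarrow> real"
  assumes M: "\<And>k. real_distribution (M k)" and \<mu>: "real_distribution \<mu>"
    and wc: "weak_conv_m M \<mu>" and cont: "continuous_on UNIV f"
    and sq: "\<And>k. integrable (M k) (\<lambda>x. (f x)\<^sup>2)" and bd: "\<And>k. (\<integral>x. (f x)\<^sup>2 \<partial>M k) \<le> D"
  shows "integrable \<mu> f" "(\<lambda>k. \<integral>x. f x \<partial>M k) \<longlonglongrightarrow> (\<integral>x. f x \<partial>\<mu>)"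
proof -
  interpret \<mu>: real_distribution \<mu> by fact
  have meas[measurable]: "f \<in> borel_measurable borel"
    using cont by (rule borel_measurable_continuous_onI)
  have D: "D \<ge> 0" by (rule order_trans[OF Bochner_Integration.integral_nonneg bd[of 0]]) simp
  note sq\<mu> = weak_conv_imp_square_integrable[OF M \<mu> wc cont sq bd]
  have int: "integrable N f" if N: "real_distribution N" "integrable N (\<lambda>x. (f x)\<^sup>2)" for N
  proof -
    interpret N: real_distribution N by fact
    show ?thesis by (rule N.square_integrable_imp_integrable) (use N(2) in auto)
  qed
  show int\<mu>: "integrable \<mu> f" by (rule int[OF \<mu> sq\<mu>(1)])
  define tr where "tr R x = max (-R) (min R (f x))" for R x
  have tr_bound: "\<bar>f x - tr R x\<bar> \<le> (f x)\<^sup>2 / R" if "R > 0" for R x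
  proof (cases "\<bar>f x\<bar> \<le> R")
    case True
    then have "f x - tr R x = 0" by (auto simp: tr_def)
    then show ?thesis using that by simp
  next
    case False
    then have "\<bar>f x - tr R x\<bar> \<le> \<bar>f x\<bar>" using that by (auto simp: tr_def)
    also have "\<bar>f x\<bar> * R \<le> \<bar>f x\<bar> * \<bar>f x\<bar>" using False by (intro mult_left_mono) auto
    then have "\<bar>f x\<bar> \<le> (f x)\<^sup>2 / R" using that by (simp add: field_simps power2_eq_square)
    finally show ?thesis .
  qed
  have close: "\<bar>(\<integral>x. f x \<partial>N) - (\<integral>x. tr R x \<partial>N)\<bar> \<le> D / R"
    if N: "real_distribution N" "integrable N (\<lambda>x. (f x)\<^sup>2)" "(\<integral>x. (f x)\<^sup>2 \<partial>N) \<le> D" and R: "R > 0" for N R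
  proof -
    interpret N: real_distribution N by fact
    have i: "integrable N (tr R)"
      by (rule N.integrable_const_bound[where B=R]) (use R in \<open>auto simp: tr_def[abs_def]\<close>)
    have "\<bar>(\<integral>x. f x \<partial>N) - (\<integral>x. tr R x \<partial>N)\<bar> = \<bar>\<integral>x. f x - tr R x \<partial>N\<bar>"
      using int[OF N(1,2)] i by simp
    also have "\<dots> \<le> (\<integral>x. \<bar>f x - tr R x\<bar> \<partial>N)" by (rule integral_abs_bound)
    also have "\<dots> \<le> (\<integral>x. (f x)\<^sup>2 / R \<partial>N)"
      using int[OF N(1,2)] i N(2) tr_bound[OF R] by (intro integral_mono) auto
    also have "\<dots> \<le> D / R" using N(3) R by (simp add: divide_right_mono)
    finally show ?thesis .
  qed
  show "(\<lambda>k. \<integral>x. f x \<partial>M k) \<longlonglongrightarrow> (\<integral>x. f x \<partial>\<mu>)"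
  proof (rule LIMSEQ_I)
    fix e :: real assume e: "e > 0"
    \<comment> \<open>chosen so that each of the two clipping errors stays below \<open>e / 3\<close>\<close>
    define R where "R = 3 * (D + 1) / e"
    have R: "R > 0" "D / R < e / 3" using e D by (auto simp: R_def field_simps)
    have "(\<lambda>k. \<integral>x. tr R x \<partial>M k) \<longlonglongrightarrow> (\<integral>x. tr R x \<partial>\<mu>)"
    proof (rule weak_conv_imp_integral_bdd_continuous_conv[OF M \<mu> wc, where B=R])
      show "isCont (tr R) x" for x unfolding tr_def[abs_def]
        using cont by (intro continuous_intros) (simp add: continuous_on_eq_continuous_at)
    qed (use R in \<open>auto simp: tr_def\<close>)
    from LIMSEQ_D[OF this, of "e/3"] e obtain k0
      where k0: "\<And>k. k \<ge> k0 \<Longrightarrow> norm ((\<integral>x. tr R x \<partial>M k) - (\<integral>x. tr R x \<partial>\<mu>)) < e/3" by auto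
    show "\<exists>no. \<forall>k\<ge>no. norm ((\<integral>x. f x \<partial>M k) - (\<integral>x. f x \<partial>\<mu>)) < e"
    proof (intro exI allI impI)
      fix k assume k: "k \<ge> k0"
      show "norm ((\<integral>x. f x \<partial>M k) - (\<integral>x. f x \<partial>\<mu>)) < e"
        using k0[OF k] close[OF M sq bd R(1), of k] close[OF \<mu> sq\<mu> R(1)] R(2)
          unfolding real_norm_def by linarith
    qed
  qed
qed

lemma tight_if_bounded_mean:
  assumes M: "\<And>k. real_distribution (M k)" and nn: "\<And>k. AE x in M k. 0 \<le> x"
    and int: "\<And>k. integrable (M k) (\<lambda>x. x)" and bd: "\<And>k. (\<integral>x. x \<partial>M k) \<le> B"
  shows "tight M"
  unfolding tight_def
proof (intro conjI allI impI M)
  fix e :: real assume e: "e > 0"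
  define b where "b = (\<bar>B\<bar> + 1) / e"
  have b: "b > 0" using e by (simp add: b_def)
  have "measure (M k) {-1<..b} > 1 - e" for k
  proof -
    interpret real_distribution "M k" by fact
    have "measure (M k) {x\<in>space (M k). b \<le> x} \<le> (\<integral>x. x \<partial>M k) / b"
      by (rule integral_Markov_inequality_measure[where A="space (M k)"]) (use int nn b in auto)
    also have "\<dots> \<le> B / b" using bd[of k] b by (intro divide_right_mono) auto
    also have "\<dots> < e"
    proof -
      have "B * e < (\<bar>B\<bar> + 1) * e" using e by (intro mult_strict_right_mono) auto
      then show ?thesis using e by (simp add: b_def field_simps)
    qed
    finally have "prob {b..} < e" by (simp add: atLeast_def)
    moreover have "prob {-1<..b} \<ge> prob (UNIV - {b..})"
    proof (rule finite_measure_mono_AE)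
      show "AE x in M k. x \<in> UNIV - {b..} \<longrightarrow> x \<in> {-1<..b}" using nn[of k] by eventually_elim auto
    qed simp
    moreover have "prob (UNIV - {b..}) = 1 - prob {b..}"
      using prob_compl[of "{b..}"] by simp
    ultimately show ?thesis by simp
  qed
  then show "\<exists>a b. a < b \<and> (\<forall>k. 1 - e < measure (M k) {a<..b})"
    using b by (intro exI[of _ "-1"] exI[of _ b]) auto
qed

text \<open>
  The bounded continuous test function \<open>min 1 (max 0 (- x))\<close> vanishes exactly on \<open>{0..}\<close>.
\<close>

lemma AE_nonneg_weak_limit:
  assumes M: "\<And>k. real_distribution (M k)" and \<mu>: "real_distribution \<mu>"
    and wc: "weak_conv_m M \<mu>" and nn: "\<And>k. AE x in M k. 0 \<le> x"
  shows "AE x in \<mu>. 0 \<le> x"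
proof -
  interpret \<mu>: real_distribution \<mu> by fact
  define f where "f x = min 1 (max 0 (- x))" for x :: real
  have "(\<lambda>k. \<integral>x. f x \<partial>M k) \<longlonglongrightarrow> (\<integral>x. f x \<partial>\<mu>)"
  proof (rule weak_conv_imp_integral_bdd_continuous_conv[OF M \<mu> wc, where B=1])
    show "isCont f x" for x unfolding f_def[abs_def] by (intro continuous_intros)
  qed (auto simp: f_def)
  moreover have "(\<integral>x. f x \<partial>M k) = 0" for k
    by (rule integral_eq_zero_AE) (use nn[of k] in \<open>eventually_elim, auto simp: f_def\<close>)
  ultimately have "(\<integral>x. f x \<partial>\<mu>) = 0" by (simp add: LIMSEQ_const_iff)
  moreover have "integrable \<mu> f"
    by (rule \<mu>.integrable_const_bound[where B=1]) (auto simp: f_def[abs_def])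
  ultimately have "AE x in \<mu>. f x = 0"
    by (subst (asm) integral_nonneg_eq_0_iff_AE) (auto simp: f_def)
  then show ?thesis by eventually_elim (auto simp: f_def min_def max_def split: if_splits)
qed

section \<open>Uniqueness of two-sided Laplace transforms\<close>

lemma density_const_inverse:
  assumes "c > 0"
  shows "density (density M (\<lambda>_. ennreal c)) (\<lambda>_. ennreal (1/c)) = M"
proof -
  have "density (density M (\<lambda>_. ennreal c)) (\<lambda>_. ennreal (1/c)) = density M (\<lambda>_. ennreal c * ennreal (1/c))"
    by (rule density_density_eq) auto
  also have "ennreal c * ennreal (1/c) = 1" using assms by (simp flip: ennreal_mult)
  finally show ?thesis by (simp add: density_1)
qed

text \<open>
  Reduction to probability measures: the value of the characteristic function at \<open>0\<close> is the total mass.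
\<close>

lemma finite_measure_char_unique:
  fixes M N :: "real measure"
  assumes fin: "finite_measure M" "finite_measure N"
    and sets: "sets M = sets borel" "sets N = sets borel" and eq: "char M = char N"
  shows "M = N"
proof -
  have sp: "space M = UNIV" "space N = UNIV" using sets by (auto dest: sets_eq_imp_space_eq)
  have ch0: "char L 0 = of_real (measure L UNIV)" if "space L = UNIV" for L
    using that by (simp add: char_def scaleR_conv_of_real)
  define m where "m = measure M UNIV"
  have m: "measure N UNIV = m" using ch0[OF sp(1)] ch0[OF sp(2)] eq by (simp add: m_def)
  show ?thesis
  proof (cases "m = 0")
    case True
    have null: "emeasure L A = 0" if "finite_measure L" "sets L = sets borel" "space L = UNIV" "measure L UNIV = 0" for A L
    proof -
      interpret finite_measure L by fact
      have "emeasure L A \<le> emeasure L UNIV"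
        using that(3) by (metis emeasure_space)
      then show ?thesis using that by (simp add: emeasure_eq_measure)
    qed
    show ?thesis
      using null[OF fin(1) sets(1) sp(1)] null[OF fin(2) sets(2) sp(2)] True m sets
      by (intro measure_eqI) (simp_all add: m_def)
  next
    case False
    then have mpos: "m > 0" by (simp add: m_def zero_less_measure_iff)
    let ?D = "\<lambda>L. density L (\<lambda>_. ennreal (1/m))"
    have dist: "real_distribution (?D L)"
      if "finite_measure L" "sets L = sets borel" "space L = UNIV" "measure L UNIV = m" for L
    proof -
      interpret finite_measure L by fact
      have "emeasure (?D L) (space (?D L)) = ennreal (1/m) * ennreal m"
        using that by (subst emeasure_density) (auto simp: nn_integral_cmult_indicator emeasure_eq_measure)
      also have "\<dots> = 1" using mpos by (simp flip: ennreal_mult)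
      finally show ?thesis
        using that by (auto intro!: real_distribution.intro prob_spaceI simp: real_distribution_axioms_def)
    qed
    have ch: "char (?D L) t = char L t / of_real m" if "sets L = sets borel" for L t
    proof -
      note [measurable_cong] = that
      show ?thesis unfolding char_def using mpos
        by (subst integral_density) (auto simp: scaleR_conv_of_real)
    qed
    have "?D M = ?D N"
      using dist[OF fin(1) sets(1) sp(1)] dist[OF fin(2) sets(2) sp(2) m] ch sets eq
      by (intro Levy_uniqueness ext) (auto simp: m_def)
    then have "density (?D M) (\<lambda>_. ennreal (1/(1/m))) = density (?D N) (\<lambda>_. ennreal (1/(1/m)))" by simp
    then show ?thesis using density_const_inverse[of "1/m" M] density_const_inverse[of "1/m" N] mpos by simp
  qed
qed

lemma sum_exp_series_le:
  assumes "x \<ge> (0::real)" shows "(\<Sum>k<n. x ^ k / fact k) \<le> exp x"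
proof -
  have "(\<Sum>k<n. x ^ k /\<^sub>R fact k) \<le> (\<Sum>k. x ^ k /\<^sub>R fact k)"
    using assms by (intro sum_le_suminf summable_exp_generic) auto
  then show ?thesis by (simp add: exp_def divide_inverse mult.commute)
qed

text \<open>
  Around a point \<open>w\<close> of the strip, expanding \<open>exp ((z - w) * y)\<close> and integrating term by term gives a power series.
  The partial sums are dominated by \<open>exp (\<rho> * y) + exp (- \<rho> * y)\<close> with \<open>\<rho> = cmod (z - w) + \<bar>Re w\<bar> < r\<close>.
\<close>

lemma laplace_transform_holomorphic:
  fixes M :: "real measure"
  assumes sets[measurable_cong]: "sets M = sets borel"
    and int: "\<And>u. \<bar>u\<bar> < r \<Longrightarrow> integrable M (\<lambda>y. exp (u * y))"
  shows "(\<lambda>z. \<integral>y. exp (z * complex_of_real y) \<partial>M) holomorphic_on {z. \<bar>Re z\<bar> < r}"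
proof -
  let ?F = "\<lambda>z. \<integral>y. exp (z * complex_of_real y) \<partial>M"
  have "\<exists>d>0. ?F holomorphic_on ball w d" if w: "\<bar>Re w\<bar> < r" for w
  proof (intro exI conjI)
    let ?d = "r - \<bar>Re w\<bar>"
    show "?d > 0" using w by simp
    define a where "a k = (\<integral>y. exp (w * complex_of_real y) * complex_of_real y ^ k / fact k \<partial>M)" for k
    show "?F holomorphic_on ball w ?d"
    proof (rule power_series_holomorphic)
      fix z assume "z \<in> ball w ?d"
      define \<rho> where "\<rho> = cmod (z - w) + \<bar>Re w\<bar>"
      have \<rho>: "\<bar>\<rho>\<bar> < r" "\<rho> \<ge> 0" using \<open>z \<in> ball w ?d\<close> by (auto simp: \<rho>_def dist_norm norm_minus_commute)
      define T where "T k y = exp (w * complex_of_real y) * ((z - w) * complex_of_real y) ^ k / fact k" for k y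
      have T[measurable]: "T k \<in> borel_measurable M" for k unfolding T_def[abs_def] by measurable
      have bound: "(\<Sum>k<n. cmod (T k y)) \<le> exp (\<rho> * y) + exp (- \<rho> * y)" for n y
      proof -
        have "(\<Sum>k<n. cmod (T k y)) = exp (Re w * y) * (\<Sum>k<n. (cmod (z - w) * \<bar>y\<bar>) ^ k / fact k)"
          by (simp add: T_def norm_mult norm_divide norm_power sum_distrib_left power_mult_distrib)
        also have "\<dots> \<le> exp (Re w * y) * exp (cmod (z - w) * \<bar>y\<bar>)"
          by (intro mult_left_mono sum_exp_series_le) auto
        also have "\<dots> = exp (Re w * y + cmod (z - w) * \<bar>y\<bar>)" by (simp add: exp_add)
        also have "\<dots> \<le> exp (\<rho> * \<bar>y\<bar>)"
        proof -
          have "Re w * y \<le> \<bar>Re w\<bar> * \<bar>y\<bar>" by (metis abs_ge_self abs_mult)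
          then show ?thesis by (simp add: \<rho>_def algebra_simps)
        qed
        also have "\<dots> \<le> exp (\<rho> * y) + exp (- \<rho> * y)" by (cases "y \<ge> 0") auto
        finally show ?thesis .
      qed
      have dom: "integrable M (\<lambda>y. exp (\<rho> * y) + exp (- \<rho> * y))"
        using \<rho> by (intro Bochner_Integration.integrable_add int) auto
      have Tint: "integrable M (T k)" for k
      proof (rule Bochner_Integration.integrable_bound[OF dom])
        have "norm (T k y) \<le> (\<Sum>j<Suc k. cmod (T j y))" for y
          by (rule member_le_sum) auto
        then show "AE y in M. norm (T k y) \<le> norm (exp (\<rho> * y) + exp (- \<rho> * y))"
          using bound[of _ "Suc k"] by (intro AE_I2) (smt (verit) real_norm_def)
      qed simp
      have "(\<lambda>n. \<integral>y. (\<Sum>k<n. T k y) \<partial>M) \<longlonglongrightarrow> ?F z"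
      proof (rule integral_dominated_convergence[OF _ _ dom])
        show "AE y in M. (\<lambda>n. \<Sum>k<n. T k y) \<longlonglongrightarrow> exp (z * complex_of_real y)"
        proof (rule AE_I2)
          fix y
          have "(\<lambda>k. ((z - w) * complex_of_real y) ^ k /\<^sub>R fact k) sums exp ((z - w) * complex_of_real y)"
            by (rule exp_converges)
          then have "(\<lambda>k. exp (w * complex_of_real y) * (((z - w) * complex_of_real y) ^ k /\<^sub>R fact k)) sums
              (exp (w * complex_of_real y) * exp ((z - w) * complex_of_real y))"
            by (rule sums_mult)
          moreover have "exp (w * complex_of_real y) * exp ((z - w) * complex_of_real y) = exp (z * complex_of_real y)"
            by (simp add: exp_add[symmetric] algebra_simps)
          moreover have "exp (w * complex_of_real y) * (((z - w) * complex_of_real y) ^ k /\<^sub>R fact k) = T k y" for k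
            by (simp add: T_def scaleR_conv_of_real field_simps)
          ultimately show "(\<lambda>n. \<Sum>k<n. T k y) \<longlonglongrightarrow> exp (z * complex_of_real y)"
            by (simp add: sums_def)
        qed
        show "AE y in M. norm (\<Sum>k<n. T k y) \<le> exp (\<rho> * y) + exp (- \<rho> * y)" for n
          by (intro AE_I2 order_trans[OF norm_sum bound])
      qed auto
      moreover have "(\<integral>y. (\<Sum>k<n. T k y) \<partial>M) = (\<Sum>k<n. a k * (z - w) ^ k)" for n
      proof -
        have "(\<integral>y. T k y \<partial>M) = a k * (z - w) ^ k" for k
        proof -
          have "(\<integral>y. T k y \<partial>M) = (\<integral>y. (exp (w * complex_of_real y) * complex_of_real y ^ k / fact k) * (z - w) ^ k \<partial>M)"
            by (simp add: T_def power_mult_distrib mult_ac)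
          then show ?thesis unfolding a_def by (simp only: integral_mult_left_zero)
        qed
        then show ?thesis using Tint by (simp add: Bochner_Integration.integral_sum)
      qed
      ultimately show "(\<lambda>k. a k * (z - w) ^ k) sums ?F z" by (simp add: sums_def)
    qed
  qed
  then obtain d where d: "\<And>w. \<bar>Re w\<bar> < r \<Longrightarrow> d w > 0" "\<And>w. \<bar>Re w\<bar> < r \<Longrightarrow> ?F holomorphic_on ball w (d w)"
    by metis
  have "?F holomorphic_on (\<Union>w\<in>{w. \<bar>Re w\<bar> < r}. ball w (d w))"
    by (rule holomorphic_on_UN_open) (use d in auto)
  then show ?thesis by (rule holomorphic_on_subset) (use d in auto)
qed

text \<open>
  Both transforms are holomorphic on a strip around the imaginary axis and agree on a real interval, so they agree on the
  imaginary axis, where they are the characteristic functions.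
\<close>

lemma laplace_transform_unique:
  fixes M N :: "real measure"
  assumes fin: "finite_measure M" "finite_measure N"
    and sets: "sets M = sets borel" "sets N = sets borel" and r: "r > 0"
    and int: "\<And>u. \<bar>u\<bar> < r \<Longrightarrow> integrable M (\<lambda>y. exp (u * y))" "\<And>u. \<bar>u\<bar> < r \<Longrightarrow> integrable N (\<lambda>y. exp (u * y))"
    and eq: "\<And>u. \<bar>u\<bar> < r \<Longrightarrow> (\<integral>y. exp (u * y) \<partial>M) = (\<integral>y. exp (u * y) \<partial>N)"
  shows "M = N"
proof (rule finite_measure_char_unique[OF fin sets], rule ext)
  fix t :: real
  let ?S = "{z. \<bar>Re z\<bar> < r}" and ?F = "\<lambda>L z. \<integral>y. exp (z * complex_of_real y) \<partial>L"
  have S: "?S = {z. Re z < r} \<inter> {z. Re z > -r}" by auto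
  have opn: "open ?S" unfolding S by (intro open_Int open_halfspace_Re_lt open_halfspace_Re_gt)
  have conn: "connected ?S" unfolding S
    by (intro convex_connected convex_Int convex_halfspace_Re_lt convex_halfspace_Re_gt)
  have lim: "0 islimpt (complex_of_real ` {-r<..<r})"
    unfolding islimpt_sequential
  proof (intro exI[of _ "\<lambda>n. complex_of_real (r / (real n + 2))"] conjI allI)
    show "complex_of_real (r / (real n + 2)) \<in> complex_of_real ` {- r<..<r} - {0}" for n
    proof -
      have "r < r * (real n + 2)" using r by (simp add: algebra_simps add_pos_nonneg)
      then have "0 < r / (real n + 2)" "r / (real n + 2) < r" using r by (auto simp: divide_less_eq)
      then have "r / (real n + 2) \<in> {- r<..<r}" "r / (real n + 2) \<noteq> 0"
        using r unfolding greaterThanLessThan_iff by linarith+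
      then show ?thesis by (metis (mono_tags) DiffI imageI of_real_eq_0_iff singletonD)
    qed
    have "(\<lambda>n. r / (real n + 2)) \<longlonglongrightarrow> 0" by real_asymp
    from tendsto_of_real[OF this, where 'a=complex]
    show "(\<lambda>n. complex_of_real (r / (real n + 2))) \<longlonglongrightarrow> 0" by (simp only: of_real_0)
  qed
  have zero: "?F M z - ?F N z = 0" if "z \<in> complex_of_real ` {-r<..<r}" for z
  proof -
    from that obtain u where u: "z = of_real u" "\<bar>u\<bar> < r" by auto
    have "?F L z = of_real (\<integral>y. exp (u * y) \<partial>L)" for L
    proof -
      have "exp (complex_of_real u * complex_of_real y) = complex_of_real (exp (u * y))" for y
        by (metis exp_of_real of_real_mult)
      then show ?thesis by (simp only: u(1) integral_complex_of_real)
    qed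
    then show ?thesis using eq[OF u(2)] by simp
  qed
  have hol: "(\<lambda>z. ?F M z - ?F N z) holomorphic_on ?S"
    by (intro holomorphic_on_diff laplace_transform_holomorphic int sets)
  have sub: "complex_of_real ` {-r<..<r} \<subseteq> ?S" and mem: "0 \<in> ?S" "\<i> * complex_of_real t \<in> ?S" using r by auto
  have "?F M (\<i> * of_real t) - ?F N (\<i> * of_real t) = 0"
    by (rule analytic_continuation[OF hol opn conn sub mem(1) lim zero mem(2)])
  then show "char M t = char N t" by (simp add: char_def mult_ac)
qed

section \<open>Real moments of measures on the half-line\<close>

text \<open>
  The Mellin transform on the positive half-axis of a probability carried by \<open>{0..}\<close>. The absolute value does not change
  the integrals; it makes the integrand continuous on the whole line, as weak convergence on the line requires. The
  exponent \<open>u = 0\<close> is excluded: the atom at \<open>0\<close> is seen by the total mass, but by no exponent \<open>u > 0\<close>.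
\<close>

definition has_mellin :: "real measure \<Rightarrow> (real \<Rightarrow> real) \<Rightarrow> bool" where
  "has_mellin \<mu> F \<longleftrightarrow> real_distribution \<mu> \<and> (AE x in \<mu>. 0 \<le> x) \<and>
     (\<forall>u>0. integrable \<mu> (\<lambda>x. \<bar>x\<bar> powr u) \<and> (\<integral>x. \<bar>x\<bar> powr u \<partial>\<mu>) = F u)"

lemma continuous_on_abs_powr: "u > 0 \<Longrightarrow> continuous_on UNIV (\<lambda>x::real. \<bar>x\<bar> powr u)"
  by (intro continuous_on_powr' continuous_intros) auto

lemma
  assumes "has_mellin \<mu> F"
  shows has_mellin_real_distribution: "real_distribution \<mu>"
    and has_mellin_AE: "AE x in \<mu>. 0 \<le> x"
    and has_mellin_integrable: "u > 0 \<Longrightarrow> integrable \<mu> (\<lambda>x. \<bar>x\<bar> powr u)"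
    and has_mellin_integral: "u > 0 \<Longrightarrow> (\<integral>x. \<bar>x\<bar> powr u \<partial>\<mu>) = F u"
    and has_mellin_nonneg: "u > 0 \<Longrightarrow> F u \<ge> 0"
proof -
  show "real_distribution \<mu>" "AE x in \<mu>. 0 \<le> x" using assms by (auto simp: has_mellin_def)
  show "u > 0 \<Longrightarrow> integrable \<mu> (\<lambda>x. \<bar>x\<bar> powr u)" and *: "u > 0 \<Longrightarrow> (\<integral>x. \<bar>x\<bar> powr u \<partial>\<mu>) = F u"
    using assms by (auto simp: has_mellin_def)
  show "u > 0 \<Longrightarrow> F u \<ge> 0" using * by (auto intro!: Bochner_Integration.integral_nonneg simp flip: *)
qed

lemma has_mellinI_nn_integral:
  assumes "real_distribution \<mu>" "AE x in \<mu>. 0 \<le> x"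
    and "\<And>u. u > 0 \<Longrightarrow> F u \<ge> 0" "\<And>u. u > 0 \<Longrightarrow> (\<integral>\<^sup>+x. ennreal (\<bar>x\<bar> powr u) \<partial>\<mu>) = ennreal (F u)"
  shows "has_mellin \<mu> F"
proof -
  interpret real_distribution \<mu> by fact
  show ?thesis unfolding has_mellin_def using assms
    by (auto simp: nn_integral_eq_integrable)
qed

lemma has_mellin_nn_integral:
  assumes "has_mellin \<mu> F" "u > 0"
  shows "(\<integral>\<^sup>+x. ennreal (\<bar>x\<bar> powr u) \<partial>\<mu>) = ennreal (F u)"
  using has_mellin_integrable[OF assms] has_mellin_integral[OF assms]
  by (simp add: nn_integral_eq_integral)

text \<open>
  The substitution \<open>x = exp y\<close> turns real moments into a Laplace transform. Weighting the measure by \<open>x\<close> first removes the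
  atom at \<open>0\<close> and moves the exponents \<open>u > 0\<close> to an interval around \<open>0\<close>, where the uniqueness theorem for Laplace
  transforms applies. The atom is then recovered from the total mass.
\<close>

lemma finite_measure_mellin_unique:
  fixes M N :: "real measure"
  assumes fin: "finite_measure M" "finite_measure N"
    and sets: "sets M = sets borel" "sets N = sets borel"
    and nn: "AE x in M. 0 \<le> x" "AE x in N. 0 \<le> x"
    and int: "\<And>u. u > 0 \<Longrightarrow> integrable M (\<lambda>x. \<bar>x\<bar> powr u)" "\<And>u. u > 0 \<Longrightarrow> integrable N (\<lambda>x. \<bar>x\<bar> powr u)"
    and eq: "\<And>u. u > 0 \<Longrightarrow> (\<integral>x. \<bar>x\<bar> powr u \<partial>M) = (\<integral>x. \<bar>x\<bar> powr u \<partial>N)"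
    and mass: "measure M UNIV = measure N UNIV"
  shows "M = N"
proof -
  \<comment> \<open>the density is \<open>max 0 x\<close>, because \<open>ennreal\<close> truncates negative numbers\<close>
  define T where "T L = distr (density L ennreal) borel ln" for L :: "real measure"
  have T_integral: "integrable (T L) (\<lambda>y. exp (u * y))"
      "(\<integral>y. exp (u * y) \<partial>T L) = (\<integral>x. \<bar>x\<bar> powr (u + 1) \<partial>L)"
    if L: "sets L = sets borel" "AE x in L. 0 \<le> x" "\<And>u. u > 0 \<Longrightarrow> integrable L (\<lambda>x. \<bar>x\<bar> powr u)"
      and u: "\<bar>u\<bar> < 1" for L u
  proof -
    note [measurable_cong] = L(1)
    have ae: "AE x in L. x *\<^sub>R exp (u * ln x) = \<bar>x\<bar> powr (u + 1)"
      using L(2) by eventually_elim (auto simp: powr_def exp_add algebra_simps)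
    have "integrable L (\<lambda>x. \<bar>x\<bar> powr (u + 1))" using L(3) u by simp
    then have "integrable L (\<lambda>x. x *\<^sub>R exp (u * ln x))"
      by (subst integrable_cong_AE[OF _ _ ae]) auto
    then show "integrable (T L) (\<lambda>y. exp (u * y))" unfolding T_def
      using L(2) by (subst integrable_distr_eq) (auto simp: integrable_density)
    show "(\<integral>y. exp (u * y) \<partial>T L) = (\<integral>x. \<bar>x\<bar> powr (u + 1) \<partial>L)" unfolding T_def
      using L(2) ae by (subst integral_distr) (auto simp: integral_density intro!: integral_cong_AE)
  qed
  have T_fin: "finite_measure (T L)"
    if L: "sets L = sets borel" "AE x in L. 0 \<le> x" "\<And>u. u > 0 \<Longrightarrow> integrable L (\<lambda>x. \<bar>x\<bar> powr u)" for L
  proof (rule finite_measureI)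
    note T0 = T_integral(1)[OF L, of 0]
    have "integrable (T L) (\<lambda>_. 1::real)" using T0 by simp
    then show "emeasure (T L) (space (T L)) \<noteq> \<infinity>"
      by (subst (asm) integrable_iff_bounded) simp
  qed
  have TT: "T M = T N"
  proof (rule laplace_transform_unique[where r = 1])
    show "finite_measure (T M)" "finite_measure (T N)"
      using T_fin sets nn int by blast+
    fix u :: real assume u: "\<bar>u\<bar> < 1"
    show "integrable (T M) (\<lambda>y. exp (u * y))" "integrable (T N) (\<lambda>y. exp (u * y))"
      using T_integral(1) u sets nn int by blast+
    show "(\<integral>y. exp (u * y) \<partial>T M) = (\<integral>y. exp (u * y) \<partial>T N)"
      using T_integral(2)[OF sets(1) nn(1) int(1) u] T_integral(2)[OF sets(2) nn(2) int(2) u] eq[of "u + 1"] u by simp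
  qed (auto simp: T_def)
  have pos: "emeasure L (A \<inter> {0<..}) = (\<integral>\<^sup>+y. ennreal (exp (- y)) * indicator A (exp y) \<partial>T L)"
    if [measurable_cong]: "sets L = sets borel" and A[measurable]: "A \<in> sets borel" for L :: "real measure" and A
  proof -
    have "(\<integral>\<^sup>+y. ennreal (exp (- y)) * indicator A (exp y) \<partial>T L)
        = (\<integral>\<^sup>+x. ennreal x * (ennreal (exp (- ln x)) * indicator A (exp (ln x))) \<partial>L)"
      unfolding T_def by (simp add: nn_integral_distr nn_integral_density)
    also have "\<dots> = (\<integral>\<^sup>+x. indicator (A \<inter> {0<..}) x \<partial>L)"
    proof (rule nn_integral_cong)
      fix x :: real
      show "ennreal x * (ennreal (exp (- ln x)) * indicator A (exp (ln x))) = indicator (A \<inter> {0<..}) x"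
      proof (cases "x > 0")
        case True
        then have "ennreal x * ennreal (exp (- ln x)) = 1"
          by (subst ennreal_mult[symmetric]) (auto simp: exp_minus)
        then show ?thesis using True by (simp add: indicator_def)
      qed (auto simp: ennreal_neg)
    qed
    also have "\<dots> = emeasure L (A \<inter> {0<..})" by (rule nn_integral_indicator) simp
    finally show ?thesis by simp
  qed
  have split: "measure L A = measure L (A \<inter> {0<..}) + of_bool (0 \<in> A) * measure L {0}"
    if L: "finite_measure L" "sets L = sets borel" "AE x in L. 0 \<le> x" and A[measurable]: "A \<in> sets borel" for L :: "real measure" and A
  proof -
    interpret finite_measure L by fact
    note [measurable_cong] = L(2)
    have "AE x in L. x \<in> A \<longleftrightarrow> x \<in> (A \<inter> {0<..}) \<union> (A \<inter> {0})"
      using L(3) by eventually_elim auto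
    then have "measure L A = measure L ((A \<inter> {0<..}) \<union> (A \<inter> {0}))"
      by (rule finite_measure_eq_AE) auto
    also have "\<dots> = measure L (A \<inter> {0<..}) + measure L (A \<inter> {0})"
      by (rule finite_measure_Union) auto
    also have "measure L (A \<inter> {0}) = of_bool (0 \<in> A) * measure L {0}" by auto
    finally show ?thesis .
  qed
  have posEq: "measure M (A \<inter> {0<..}) = measure N (A \<inter> {0<..})" if "A \<in> sets borel" for A
    using pos[OF sets(1) that] pos[OF sets(2) that] TT by (simp add: measure_def)
  have "measure M {0} = measure N {0}"
    using split[OF fin(1) sets(1) nn(1), of UNIV] split[OF fin(2) sets(2) nn(2), of UNIV] mass posEq[of UNIV] by simp
  then have "measure M A = measure N A" if "A \<in> sets borel" for A
    using split[OF fin(1) sets(1) nn(1) that] split[OF fin(2) sets(2) nn(2) that] posEq[OF that] by simp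
  then show ?thesis using fin sets
    by (intro measure_eqI) (auto simp: finite_measure.emeasure_eq_measure)
qed

lemma has_mellin_unique:
  assumes "has_mellin \<mu> F" "has_mellin \<nu> G" "\<And>u. u > 0 \<Longrightarrow> F u = G u"
  shows "\<mu> = \<nu>"
proof -
  interpret \<mu>: real_distribution \<mu> using assms(1) by (rule has_mellin_real_distribution)
  interpret \<nu>: real_distribution \<nu> using assms(2) by (rule has_mellin_real_distribution)
  show ?thesis
  proof (rule finite_measure_mellin_unique)
    show "measure \<mu> UNIV = measure \<nu> UNIV" using \<mu>.prob_space \<nu>.prob_space by simp
    show "(\<integral>x. \<bar>x\<bar> powr u \<partial>\<mu>) = (\<integral>x. \<bar>x\<bar> powr u \<partial>\<nu>)" if "u > 0" for u
      using has_mellin_integral[OF assms(1) that] has_mellin_integral[OF assms(2) that] assms(3)[OF that]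
      by simp
  qed (use has_mellin_AE[OF assms(1)] has_mellin_AE[OF assms(2)] has_mellin_integrable[OF assms(1)]
         has_mellin_integrable[OF assms(2)] in \<open>simp_all add: \<mu>.finite_measure_axioms \<nu>.finite_measure_axioms\<close>)
qed

lemma convergent_imp_bounded_above:
  fixes X :: "nat \<Rightarrow> real" assumes "X \<longlonglongrightarrow> L" shows "\<exists>B. \<forall>k. X k \<le> B"
proof -
  have "Bseq X" using assms by (auto intro: convergent_imp_Bseq convergentI)
  then obtain K where "\<And>k. norm (X k) \<le> K" by (auto simp: Bseq_def)
  then have "X k \<le> K" for k using abs_le_D1[of "X k" K] by simp
  then show ?thesis by blast
qed

text \<open>
  The square of \<open>\<bar>x\<bar> powr u\<close> is again a real moment function, with exponent \<open>2 * u\<close>, so its integrals are bounded along the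
  sequence and \<open>weak_conv_imp_integral_conv\<close> applies.
\<close>

lemma has_mellin_weak_limit:
  assumes M: "\<And>k. has_mellin (M k) (F k)" and lim: "\<And>u. u > 0 \<Longrightarrow> (\<lambda>k. F k u) \<longlonglongrightarrow> G u"
    and wc: "weak_conv_m M \<mu>" and \<mu>: "real_distribution \<mu>"
  shows "has_mellin \<mu> G"
  unfolding has_mellin_def
proof (intro conjI allI impI)
  note Md = M[THEN has_mellin_real_distribution]
  show "AE x in \<mu>. 0 \<le> x" by (rule AE_nonneg_weak_limit[OF Md \<mu> wc M[THEN has_mellin_AE]])
  fix u :: real assume u: "u > 0"
  have sq: "(\<bar>x\<bar> powr u)\<^sup>2 = \<bar>x\<bar> powr (2 * u)" for x :: real
    by (simp add: power2_eq_square flip: powr_add mult_2)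
  obtain D where D: "\<And>k. F k (2 * u) \<le> D" using convergent_imp_bounded_above[OF lim[of "2*u"]] u by auto
  have int2: "integrable (M k) (\<lambda>x. (\<bar>x\<bar> powr u)\<^sup>2)" "(\<integral>x. (\<bar>x\<bar> powr u)\<^sup>2 \<partial>M k) \<le> D" for k
    using u D has_mellin_integrable[OF M, of "2*u"] has_mellin_integral[OF M, of "2*u"] by (auto simp: sq)
  note * = weak_conv_imp_integral_conv[OF Md \<mu> wc continuous_on_abs_powr[OF u] int2]
  show "integrable \<mu> (\<lambda>x. \<bar>x\<bar> powr u)" by (rule *)
  have "(\<lambda>k. F k u) \<longlonglongrightarrow> (\<integral>x. \<bar>x\<bar> powr u \<partial>\<mu>)" using *(2) has_mellin_integral[OF M u] by simp
  then show "(\<integral>x. \<bar>x\<bar> powr u \<partial>\<mu>) = G u" using lim[OF u] by (rule LIMSEQ_unique)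
qed fact

lemma has_mellin_tight:
  assumes M: "\<And>k. has_mellin (M k) (F k)" and lim: "(\<lambda>k. F k 1) \<longlonglongrightarrow> L"
  shows "tight M"
proof -
  obtain B where B: "\<And>k. F k 1 \<le> B" using convergent_imp_bounded_above[OF lim] by blast
  have "integrable (M k) (\<lambda>x. x) \<and> (\<integral>x. x \<partial>M k) \<le> B" for k
  proof -
    interpret real_distribution "M k" using M by (rule has_mellin_real_distribution)
    have "integrable (M k) (\<lambda>x. \<bar>x\<bar> powr 1)" "(\<integral>x. \<bar>x\<bar> powr 1 \<partial>M k) \<le> B"
      using has_mellin_integrable[OF M, of 1] has_mellin_integral[OF M, of 1] B by auto
    then have *: "integrable (M k) (\<lambda>x. \<bar>x\<bar>)" "(\<integral>x. \<bar>x\<bar> \<partial>M k) \<le> B" by simp_all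
    have "(\<integral>x. x \<partial>M k) \<le> (\<integral>x. \<bar>x\<bar> \<partial>M k)" using *(1) by (intro integral_mono) (auto simp: integrable_abs_iff)
    then show ?thesis using * by (auto simp: integrable_abs_iff)
  qed
  then show ?thesis
    by (intro tight_if_bounded_mean[of M B] M[THEN has_mellin_real_distribution] M[THEN has_mellin_AE]) auto
qed

lemma has_mellin_limit_exists:
  assumes M: "\<And>k. has_mellin (M k) (F k)" and lim: "\<And>u. u > 0 \<Longrightarrow> (\<lambda>k. F k u) \<longlonglongrightarrow> G u"
  shows "\<exists>\<mu>. has_mellin \<mu> G"
proof -
  have "tight M" using has_mellin_tight[OF M lim[of 1]] by simp
  from tight_imp_convergent_subsubsequence[OF this strict_mono_id] obtain r \<mu>
    where r: "strict_mono r" and \<mu>: "real_distribution \<mu>" "weak_conv_m (\<lambda>k. M (r k)) \<mu>"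
    by (auto simp: o_def id_def)
  have "has_mellin \<mu> G"
  proof (rule has_mellin_weak_limit[OF M _ \<mu>(2,1)])
    show "(\<lambda>k. F (r k) u) \<longlonglongrightarrow> G u" if "u > 0" for u
      using LIMSEQ_subseq_LIMSEQ[OF lim[OF that] r] by (simp add: o_def)
  qed
  then show ?thesis ..
qed

text \<open>
  By tightness it suffices to identify the weak limits of subsequences, and the real moments identify them.
\<close>

lemma has_mellin_weak_conv:
  assumes M: "\<And>k. has_mellin (M k) (F k)" and lim: "\<And>u. u > 0 \<Longrightarrow> (\<lambda>k. F k u) \<longlonglongrightarrow> G u"
    and \<mu>: "has_mellin \<mu> G"
  shows "weak_conv_m M \<mu>"
proof (rule tight_subseq_weak_converge)
  show "tight M" using has_mellin_tight[OF M lim[of 1]] by simp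
  fix r \<nu> assume r: "strict_mono r" and \<nu>: "real_distribution \<nu>" "weak_conv_m (M \<circ> r) \<nu>"
  have "has_mellin \<nu> G"
  proof (rule has_mellin_weak_limit[OF _ _ \<nu>(2,1)])
    show "has_mellin ((M \<circ> r) k) (F (r k))" for k using M by simp
    show "(\<lambda>k. F (r k) u) \<longlonglongrightarrow> G u" if "u > 0" for u
      using LIMSEQ_subseq_LIMSEQ[OF lim[OF that] r] by (simp add: o_def)
  qed
  then have "\<nu> = \<mu>" using \<mu> by (rule has_mellin_unique) simp
  then show "weak_conv_m (M \<circ> r) \<mu>" using \<nu> by simp
qed (use M \<mu> in \<open>auto intro: has_mellin_real_distribution\<close>)

section \<open>Stieltjes moments and product convolution\<close>

lemma has_stieltjes_moments_finite_measure:
  assumes "has_stieltjes_moments \<mu> s" shows "finite_measure \<mu>"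
proof (rule finite_measureI)
  have "integrable \<mu> (\<lambda>x. x ^ 0)" using assms unfolding has_stieltjes_moments_def by blast
  then show "emeasure \<mu> (space \<mu>) \<noteq> \<infinity>"
    by (subst (asm) integrable_iff_bounded) simp
qed

lemma has_stieltjes_moments_real_distribution:
  assumes "has_stieltjes_moments \<mu> s" "s 0 = 1" shows "real_distribution \<mu>"
proof -
  interpret finite_measure \<mu> using assms(1) by (rule has_stieltjes_moments_finite_measure)
  have "measure \<mu> (space \<mu>) = 1"
    using assms unfolding has_stieltjes_moments_def by (auto dest!: spec[of _ 0])
  then have "prob_space \<mu>" by (intro prob_spaceI) (simp add: emeasure_eq_measure)
  then show ?thesis using assms(1)
    by (auto intro!: real_distribution.intro simp: real_distribution_axioms_def has_stieltjes_moments_def borel_measure_on_def)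
qed

text \<open>
  On \<open>{0..}\<close> the bound \<open>(1 + \<bar>x\<bar>) ^ n\<close> is a polynomial in \<open>x\<close>.
\<close>

lemma has_stieltjes_moments_integrable_growth:
  assumes \<tau>: "has_stieltjes_moments \<tau> m" and f: "f \<in> borel_measurable borel"
    and bound: "\<And>x. \<bar>f x\<bar> \<le> C * (1 + \<bar>x\<bar>) ^ n"
  shows "integrable \<tau> f"
proof -
  have [measurable_cong]: "sets \<tau> = sets borel" and nn: "AE x in \<tau>. 0 \<le> x"
    and int: "\<And>n. integrable \<tau> (\<lambda>x. x ^ n)"
    using \<tau> by (auto simp: has_stieltjes_moments_def borel_measure_on_def)
  note [measurable] = f
  have "integrable \<tau> (\<lambda>x. C * (\<Sum>k\<le>n. real (n choose k) * x ^ k))"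
    by (intro Bochner_Integration.integrable_mult_right Bochner_Integration.integrable_sum int)
  also have "(\<lambda>x. C * (\<Sum>k\<le>n. real (n choose k) * x ^ k)) = (\<lambda>x. C * (1 + x) ^ n)"
    by (simp add: binomial_ring[of _ 1] add.commute[of 1])
  finally show ?thesis
  proof (rule Bochner_Integration.integrable_bound)
    show "AE x in \<tau>. norm (f x) \<le> norm (C * (1 + x) ^ n)"
      using nn
    proof eventually_elim
      case (elim x)
      then show ?case using bound[of x] by simp
    qed
  qed simp
qed

lemma abs_powr_le_power:
  assumes "0 \<le> u" "u \<le> real n" shows "\<bar>x::real\<bar> powr u \<le> (1 + \<bar>x\<bar>) ^ n"
proof -
  have "\<bar>x\<bar> powr u \<le> (1 + \<bar>x\<bar>) powr u" using assms by (intro powr_mono2) auto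
  also have "\<dots> \<le> (1 + \<bar>x\<bar>) powr real n" using assms by (intro powr_mono) auto
  finally show ?thesis by (simp add: powr_realpow)
qed

lemma has_stieltjes_moments_integrable_powr:
  assumes \<tau>: "has_stieltjes_moments \<tau> m" and u: "u \<ge> 0"
  shows "integrable \<tau> (\<lambda>x. \<bar>x\<bar> powr u)"
  using abs_powr_le_power[OF u, of "nat \<lceil>u\<rceil>"] u
  by (intro has_stieltjes_moments_integrable_growth[OF \<tau>, where C=1 and n="nat \<lceil>u\<rceil>"]) (auto simp: of_nat_ceiling)

lemma integral_abs_powr_nat:
  assumes sets[measurable_cong]: "sets \<tau> = sets borel" and nn: "AE x in \<tau>. 0 \<le> x" and n: "n \<ge> 1"
  shows "integrable \<tau> (\<lambda>x. \<bar>x\<bar> powr real n) \<longleftrightarrow> integrable \<tau> (\<lambda>x. x ^ n)"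
    and "(\<integral>x. \<bar>x\<bar> powr real n \<partial>\<tau>) = (\<integral>x. x ^ n \<partial>\<tau>)"
proof -
  have *: "AE x in \<tau>. \<bar>x\<bar> powr real n = x ^ n"
    using nn by eventually_elim (use n in \<open>auto simp: powr_realpow'\<close>)
  show "integrable \<tau> (\<lambda>x. \<bar>x\<bar> powr real n) \<longleftrightarrow> integrable \<tau> (\<lambda>x. x ^ n)"
    by (intro integrable_cong_AE *) auto
  show "(\<integral>x. \<bar>x\<bar> powr real n \<partial>\<tau>) = (\<integral>x. x ^ n \<partial>\<tau>)"
    by (intro integral_cong_AE *) auto
qed

text \<open>
  Exponent \<open>0\<close> is treated apart: the moment of order \<open>0\<close> is the mass \<open>1\<close>, even if there is an atom at \<open>0\<close>, where
  \<open>0 powr 0 = 0\<close> while \<open>0 ^ 0 = 1\<close>.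
\<close>

lemma has_mellin_imp_stieltjes_moments:
  assumes \<mu>: "has_mellin \<mu> F" and s: "s 0 = 1" "\<And>n. n \<ge> 1 \<Longrightarrow> s n = F (real n)"
  shows "has_stieltjes_moments \<mu> s"
proof -
  interpret real_distribution \<mu> using \<mu> by (rule has_mellin_real_distribution)
  have "integrable \<mu> (\<lambda>x. x ^ n) \<and> s n = (\<integral>x. x ^ n \<partial>\<mu>)" for n
  proof (cases "n = 0")
    case True
    then show ?thesis using s(1) prob_space by simp
  next
    case False
    then show ?thesis
      using integral_abs_powr_nat[OF events_eq_borel has_mellin_AE[OF \<mu>], of n] s(2)[of n]
        has_mellin_integrable[OF \<mu>, of n] has_mellin_integral[OF \<mu>, of n] by auto
  qed
  then show ?thesis using has_mellin_AE[OF \<mu>]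
    by (auto simp: has_stieltjes_moments_def borel_measure_on_def)
qed

lemma stieltjes_moments_imp_has_mellin:
  assumes \<mu>: "has_stieltjes_moments \<mu> s" and s: "s 0 = 1"
  obtains F where "has_mellin \<mu> F" "\<And>n. n \<ge> 1 \<Longrightarrow> F (real n) = s n"
proof
  have *: "sets \<mu> = sets borel" "AE x in \<mu>. 0 \<le> x" "\<And>n. s n = (\<integral>x. x ^ n \<partial>\<mu>)"
    using \<mu> by (auto simp: has_stieltjes_moments_def borel_measure_on_def)
  show "has_mellin \<mu> (\<lambda>u. \<integral>x. \<bar>x\<bar> powr u \<partial>\<mu>)"
    using has_stieltjes_moments_real_distribution[OF \<mu> s] has_stieltjes_moments_integrable_powr[OF \<mu>] *
    by (auto simp: has_mellin_def)
  show "(\<integral>x. \<bar>x\<bar> powr real n \<partial>\<mu>) = s n" if "n \<ge> 1" for n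
    using integral_abs_powr_nat(2)[OF *(1,2) that] *(3) by simp
qed

text \<open>
  The power functions are multiplicative, so Fubini splits the integral.
\<close>

lemma has_mellin_product_convolution:
  assumes \<mu>: "has_mellin \<mu> F" and \<nu>: "has_mellin \<nu> G"
  shows "has_mellin (\<mu> \<diamondop> \<nu>) (\<lambda>u. F u * G u)"
proof -
  interpret \<mu>: real_distribution \<mu> using \<mu> by (rule has_mellin_real_distribution)
  interpret \<nu>: real_distribution \<nu> using \<nu> by (rule has_mellin_real_distribution)
  interpret P: pair_prob_space \<mu> \<nu> ..
  have m[measurable]: "(\<lambda>(s, t). s * t :: real) \<in> borel_measurable (\<mu> \<Otimes>\<^sub>M \<nu>)" by measurable
  show ?thesis
  proof (rule has_mellinI_nn_integral)
    show "real_distribution (\<mu> \<diamondop> \<nu>)" unfolding product_convolution_def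
      by (auto intro!: real_distribution.intro P.prob_space_distr simp: real_distribution_axioms_def)
    have "AE s in \<mu>. AE t in \<nu>. 0 \<le> s * t"
      using has_mellin_AE[OF \<mu>]
    proof eventually_elim
      case (elim s)
      show ?case using has_mellin_AE[OF \<nu>] by eventually_elim (use elim in simp)
    qed
    then have "AE p in \<mu> \<Otimes>\<^sub>M \<nu>. 0 \<le> (case p of (s, t) \<Rightarrow> s * t)"
    proof (intro P.AE_pair_measure)
      show "{p \<in> space (\<mu> \<Otimes>\<^sub>M \<nu>). 0 \<le> (case p of (s, t) \<Rightarrow> s * t)} \<in> sets (\<mu> \<Otimes>\<^sub>M \<nu>)" by measurable
    qed auto
    then show "AE x in \<mu> \<diamondop> \<nu>. 0 \<le> x" unfolding product_convolution_def
      by (subst AE_distr_iff) auto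
    fix u :: real assume u: "u > 0"
    show "F u * G u \<ge> 0" using has_mellin_nonneg[OF \<mu> u] has_mellin_nonneg[OF \<nu> u] by simp
    have "(\<integral>\<^sup>+x. ennreal (\<bar>x\<bar> powr u) \<partial>(\<mu> \<diamondop> \<nu>)) = (\<integral>\<^sup>+p. ennreal (\<bar>case p of (s, t) \<Rightarrow> s * t\<bar> powr u) \<partial>(\<mu> \<Otimes>\<^sub>M \<nu>))"
      unfolding product_convolution_def by (subst nn_integral_distr) auto
    also have "\<dots> = (\<integral>\<^sup>+s. \<integral>\<^sup>+t. ennreal (\<bar>s\<bar> powr u) * ennreal (\<bar>t\<bar> powr u) \<partial>\<nu> \<partial>\<mu>)"
      by (subst \<nu>.nn_integral_fst[symmetric])
        (auto simp: abs_mult powr_mult ennreal_mult'' split: prod.splits)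
    also have "\<dots> = ennreal (F u) * ennreal (G u)"
      using has_mellin_nn_integral[OF \<mu> u] has_mellin_nn_integral[OF \<nu> u]
      by (simp add: nn_integral_cmult nn_integral_multc)
    finally show "(\<integral>\<^sup>+x. ennreal (\<bar>x\<bar> powr u) \<partial>(\<mu> \<diamondop> \<nu>)) = ennreal (F u * G u)"
      using has_mellin_nonneg[OF \<nu> u] has_mellin_nonneg[OF \<mu> u] by (simp add: ennreal_mult)
  qed
qed

lemma has_mellin_exp_linear: "has_mellin (return borel (exp d)) (\<lambda>u. exp (d * u))"
proof (rule has_mellinI_nn_integral)
  show "real_distribution (return borel (exp d))"
    by (auto intro!: real_distribution.intro prob_space_return simp: real_distribution_axioms_def)
  show "AE x in return borel (exp d). 0 \<le> x" by (subst AE_return) auto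
  show "(\<integral>\<^sup>+x. ennreal (\<bar>x\<bar> powr u) \<partial>return borel (exp d)) = ennreal (exp (d * u))" for u
    by (subst nn_integral_return) (auto simp: powr_def mult.commute)
qed simp

lemma has_mellin_power:
  assumes \<mu>: "has_mellin \<mu> F" shows "\<exists>\<nu>. has_mellin \<nu> (\<lambda>u. F u ^ n)"
proof (induction n)
  case 0
  show ?case using has_mellin_exp_linear[of 0] by auto
next
  case (Suc n)
  then obtain \<nu> where "has_mellin \<nu> (\<lambda>u. F u ^ n)" ..
  from has_mellin_product_convolution[OF \<mu> this] show ?case by auto
qed

section \<open>Sums of measures\<close>

text \<open>
  The sum is meant for measures on the same \<open>\<sigma>\<close>-algebra; space and measurable sets are taken from the first one.
\<close>

definition measure_plus :: "'a measure \<Rightarrow> 'a measure \<Rightarrow> 'a measure" where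
  "measure_plus M N = measure_of (space M) (sets M) (\<lambda>A. emeasure M A + emeasure N A)"

lemma space_measure_plus[simp]: "space (measure_plus M N) = space M"
  and sets_measure_plus[simp, measurable_cong]: "sets (measure_plus M N) = sets M"
  unfolding measure_plus_def by (simp_all add: sets.space_closed sets.sigma_sets_eq)

lemma emeasure_measure_plus:
  assumes sets: "sets N = sets M" and A: "A \<in> sets M"
  shows "emeasure (measure_plus M N) A = emeasure M A + emeasure N A"
  unfolding measure_plus_def
proof (rule emeasure_measure_of_sigma[OF sets.sigma_algebra_axioms _ _ A])
  show "countably_additive (sets M) (\<lambda>A. emeasure M A + emeasure N A)"
  proof (rule countably_additiveI)
    fix F :: "nat \<Rightarrow> 'a set" assume F: "range F \<subseteq> sets M" "disjoint_family F"
    have "(\<Sum>i. emeasure M (F i) + emeasure N (F i)) = (\<Sum>i. emeasure M (F i)) + (\<Sum>i. emeasure N (F i))"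
      by (rule suminf_add[symmetric]) auto
    then show "(\<Sum>i. emeasure M (F i) + emeasure N (F i)) = emeasure M (\<Union> (range F)) + emeasure N (\<Union> (range F))"
      using F by (simp add: suminf_emeasure sets)
  qed
qed (simp add: positive_def)

lemma nn_integral_measure_plus:
  assumes sets: "sets N = sets M" and f: "f \<in> borel_measurable M"
  shows "nn_integral (measure_plus M N) f = nn_integral M f + nn_integral N f"
proof -
  have m: "g \<in> borel_measurable M \<Longrightarrow> g \<in> borel_measurable N" for g :: "'a \<Rightarrow> ennreal"
    using sets by (simp cong: measurable_cong_sets)
  have sp: "space N = space M" using sets by (rule sets_eq_imp_space_eq)
  from f show ?thesis
  proof induction
    case (cong f g)
    then show ?case by (simp add: sp cong: nn_integral_cong_simp)
  next
    case (set A)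
    then show ?case using sets by (simp add: emeasure_measure_plus)
  next
    case (mult f c)
    then show ?case by (simp add: nn_integral_cmult m distrib_left)
  next
    case (add f g)
    then show ?case by (simp add: nn_integral_add m ac_simps)
  next
    case (seq U)
    have Sup: "(SUP i. U i) = (\<lambda>x. SUP i. U i x)" by (rule ext) (simp add: image_comp)
    have sup: "nn_integral L (SUP i. U i) = (SUP i. nn_integral L (U i))"
      if "\<And>i. U i \<in> borel_measurable L" for L
      unfolding Sup by (rule nn_integral_monotone_convergence_SUP[OF \<open>incseq U\<close> that])
    have meas: "U i \<in> borel_measurable M" "U i \<in> borel_measurable N" "U i \<in> borel_measurable (measure_plus M N)" for i
      by (rule seq(1), rule m, rule seq(1), subst measurable_cong_sets[OF sets_measure_plus refl], rule seq(1))
    have "nn_integral (measure_plus M N) (SUP i. U i) = (SUP i. nn_integral M (U i) + nn_integral N (U i))"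
      by (simp only: sup[OF meas(3)] seq.IH)
    also have "\<dots> = (SUP i. nn_integral M (U i)) + (SUP i. nn_integral N (U i))"
      using \<open>incseq U\<close> by (intro ennreal_SUP_add) (auto simp: incseq_def le_fun_def intro!: nn_integral_mono)
    also have "\<dots> = nn_integral M (SUP i. U i) + nn_integral N (SUP i. U i)"
      by (simp only: sup[OF meas(1)] sup[OF meas(2)])
    finally show ?case .
  qed
qed

lemma AE_measure_plus:
  assumes sets: "sets N = sets M" and ae: "AE x in M. P x" "AE x in N. P x"
  shows "AE x in measure_plus M N. P x"
proof -
  obtain A where A: "{x\<in>space M. \<not> P x} \<subseteq> A" "A \<in> null_sets M" using ae(1) by (auto elim: AE_E simp: null_sets_def)
  obtain B where B: "{x\<in>space N. \<not> P x} \<subseteq> B" "B \<in> null_sets N" using ae(2) by (auto elim: AE_E simp: null_sets_def)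
  have sp: "space N = space M" using sets by (rule sets_eq_imp_space_eq)
  have AB: "A \<inter> B \<in> sets M" using A B sets by (metis null_setsD2 sets.Int)
  have "emeasure M (A \<inter> B) \<le> emeasure M A" "emeasure N (A \<inter> B) \<le> emeasure N B"
    using A B by (auto intro!: emeasure_mono)
  then have "emeasure (measure_plus M N) (A \<inter> B) = 0"
    using A B AB by (simp add: emeasure_measure_plus[OF sets] null_sets_def)
  then show ?thesis using A B AB sp by (intro AE_I'[of "A \<inter> B"]) (auto simp: null_sets_def)
qed

lemma
  fixes f :: "'a \<Rightarrow> real"
  assumes sets: "sets N = sets M" and f: "integrable M f" "integrable N f"
  shows integrable_measure_plus: "integrable (measure_plus M N) f"
    and integral_measure_plus: "integral\<^sup>L (measure_plus M N) f = integral\<^sup>L M f + integral\<^sup>L N f"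
proof -
  have [measurable]: "f \<in> borel_measurable M" using f by auto
  show int: "integrable (measure_plus M N) f"
    using f unfolding integrable_iff_bounded
    by (auto simp: nn_integral_measure_plus[OF sets])
  have fin: "(\<integral>\<^sup>+x. ennreal (f x) \<partial>L) < \<infinity>" "(\<integral>\<^sup>+x. ennreal (- f x) \<partial>L) < \<infinity>" if "integrable L f" for L
    using that by (auto simp: real_integrable_def top.not_eq_extremum)
  show "integral\<^sup>L (measure_plus M N) f = integral\<^sup>L M f + integral\<^sup>L N f"
    using f int fin[OF f(1)] fin[OF f(2)]
    by (simp add: real_lebesgue_integral_def nn_integral_measure_plus[OF sets] enn2real_plus)
qed

section \<open>A multiplicative Levy--Khintchine formula\<close>

text \<open>
  The integrand \<open>x powr u - 1 - u * (x - 1)\<close> of the Levy representation, divided by \<open>(x - 1)\<^sup>2\<close> and extended continuously to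
  \<open>x = 1\<close>. Integrated against \<open>\<tau>\<close> it accounts for both \<open>\<sigma>\<close> and the quadratic term: the atom \<open>2 b\<close> at \<open>1\<close>
  contributes \<open>b * u * (u - 1)\<close>.
\<close>

definition levy_kernel :: "real \<Rightarrow> real \<Rightarrow> real" where
  "levy_kernel u x = (if x = 1 then u * (u - 1) / 2 else (\<bar>x\<bar> powr u - 1 - u * (x - 1)) / (x - 1)\<^sup>2)"

lemma continuous_on_levy_kernel:
  assumes u: "u > 0" shows "continuous_on UNIV (levy_kernel u)"
  unfolding continuous_on_eq_continuous_at[OF open_UNIV]
proof
  fix x :: real
  let ?f = "\<lambda>x. (\<bar>x\<bar> powr u - 1 - u * (x - 1)) / (x - 1)\<^sup>2"
  show "isCont (levy_kernel u) x"
  proof (cases "x = 1")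
    case True
    have "((\<lambda>x. (x powr u - 1 - u * (x - 1)) / (x - 1)\<^sup>2) \<longlongrightarrow> u * (u - 1) / 2) (at 1)"
      by real_asymp
    moreover have "\<forall>\<^sub>F x in at 1. (x powr u - 1 - u * (x - 1)) / (x - 1)\<^sup>2 = levy_kernel u x"
    proof -
      have "\<forall>\<^sub>F x in at (1::real). x > 0 \<and> x \<noteq> 1"
        by (auto intro!: eventually_conj order_tendstoD(1)[of "\<lambda>x. x"] simp: eventually_neq_at_within tendsto_ident_at)
      then show ?thesis by eventually_elim (auto simp: levy_kernel_def)
    qed
    ultimately have "(levy_kernel u \<longlongrightarrow> u * (u - 1) / 2) (at 1)"
      by (rule Lim_transform_eventually)
    then show ?thesis using True by (simp add: isCont_def levy_kernel_def)
  next
    case False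
    have "isCont (\<lambda>x. \<bar>x\<bar> powr u) x"
      using continuous_on_abs_powr[OF u] by (simp add: continuous_on_eq_continuous_at)
    moreover have "isCont (\<lambda>x. (g x - 1 - u * (x - 1)) / (x - 1)\<^sup>2) x" if "isCont g x" for g
      using False that by (intro continuous_intros) auto
    ultimately have "isCont ?f x" by blast
    moreover have "\<forall>\<^sub>F y in nhds x. ?f y = levy_kernel u y"
      using t1_space_nhds[OF False] by eventually_elim (simp add: levy_kernel_def)
    ultimately show ?thesis by (subst isCont_cong[symmetric])
  qed
qed

lemma levy_kernel_measurable[measurable]: "levy_kernel u \<in> borel_measurable borel"
  unfolding levy_kernel_def[abs_def] by measurable

lemma levy_kernel_growth:
  assumes u: "u > 0" obtains C n where "\<And>x. \<bar>levy_kernel u x\<bar> \<le> C * (1 + \<bar>x\<bar>) ^ n"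
proof -
  have "compact (levy_kernel u ` cball 1 1)"
    by (intro compact_continuous_image continuous_on_subset[OF continuous_on_levy_kernel[OF u]]) auto
  then have "bounded (levy_kernel u ` cball 1 1)" by (rule compact_imp_bounded)
  then obtain B where B: "\<And>x. x \<in> cball 1 1 \<Longrightarrow> \<bar>levy_kernel u x\<bar> \<le> B"
    by (force simp: bounded_iff)
  define n where "n = Suc (nat \<lceil>u\<rceil>)"
  have n: "u \<le> real n" "n \<ge> 1" using u by (auto simp: n_def) linarith
  have "\<bar>levy_kernel u x\<bar> \<le> (\<bar>B\<bar> + 2 + u) * (1 + \<bar>x\<bar>) ^ n" for x
  proof -
    have one: "1 \<le> (1 + \<bar>x\<bar>) ^ n" by (simp add: one_le_power)
    have lin: "1 + \<bar>x\<bar> \<le> (1 + \<bar>x\<bar>) ^ n" using n(2) power_increasing[of 1 n "1 + \<bar>x\<bar>"] by simp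
    show ?thesis
    proof (cases "x \<in> cball 1 1")
      case True
      have "\<bar>levy_kernel u x\<bar> \<le> (\<bar>B\<bar> + 2 + u) * 1" using B[OF True] u by simp
      also have "\<dots> \<le> (\<bar>B\<bar> + 2 + u) * (1 + \<bar>x\<bar>) ^ n" using one u by (intro mult_left_mono) auto
      finally show ?thesis .
    next
      case False
      then have x: "\<bar>x - 1\<bar> > 1" by (auto simp: dist_real_def abs_minus_commute)
      then have sq: "(x - 1)\<^sup>2 \<ge> 1" by (metis abs_ge_zero less_eq_real_def one_le_power power2_abs)
      have "\<bar>levy_kernel u x\<bar> = \<bar>\<bar>x\<bar> powr u - 1 - u * (x - 1)\<bar> / (x - 1)\<^sup>2"
        using x by (auto simp: levy_kernel_def abs_divide)
      also have "\<dots> \<le> \<bar>\<bar>x\<bar> powr u - 1 - u * (x - 1)\<bar> / 1"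
        using sq by (intro divide_left_mono) auto
      also have "\<dots> \<le> \<bar>x\<bar> powr u + 1 + u * \<bar>x - 1\<bar>"
      proof -
        have "\<bar>u * (x - 1)\<bar> = u * \<bar>x - 1\<bar>" using u by (simp add: abs_mult)
        then show ?thesis using powr_ge_zero[of "\<bar>x\<bar>" u] unfolding div_by_1 by linarith
      qed
      also have "\<dots> \<le> (1 + \<bar>x\<bar>) ^ n + (1 + \<bar>x\<bar>) ^ n + u * (1 + \<bar>x\<bar>) ^ n"
        using abs_powr_le_power[of u n x] n u one lin by (intro add_mono mult_left_mono) auto
      also have "\<dots> = (2 + u) * (1 + \<bar>x\<bar>) ^ n" by (simp add: algebra_simps)
      also have "\<dots> \<le> (\<bar>B\<bar> + 2 + u) * (1 + \<bar>x\<bar>) ^ n" using one by (intro mult_right_mono) auto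
      finally show ?thesis .
    qed
  qed
  then show ?thesis by (rule that)
qed

lemma integrable_levy_kernel:
  assumes "has_stieltjes_moments \<tau> m" "u > 0" shows "integrable \<tau> (levy_kernel u)"
  by (metis levy_kernel_growth[OF assms(2)] has_stieltjes_moments_integrable_growth[OF assms(1) levy_kernel_measurable])

text \<open>
  The linear terms have no second difference, and that of \<open>x powr u\<close> is \<open>x powr u * (x - 1)\<^sup>2\<close>. This is how the
  measure is recovered from its exponent.
\<close>

lemma levy_kernel_second_difference:
  assumes "u > 0" "x \<ge> 0"
  shows "levy_kernel (u + 2) x - 2 * levy_kernel (u + 1) x + levy_kernel u x = \<bar>x\<bar> powr u"
proof (cases "x = 1")
  case True
  then show ?thesis by (simp add: levy_kernel_def field_simps)
next
  case False
  have p: "x powr (u + 2) = x powr u * x\<^sup>2" "x powr (u + 1) = x powr u * x"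
    using assms by (auto simp: powr_add powr_numeral)
  have k: "levy_kernel v x * (x - 1)\<^sup>2 = x powr v - 1 - v * (x - 1)" for v
    using False assms by (simp add: levy_kernel_def)
  have "(levy_kernel (u + 2) x - 2 * levy_kernel (u + 1) x + levy_kernel u x) * (x - 1)\<^sup>2
    = (x powr u * x\<^sup>2 - 1 - (u + 2) * (x - 1)) - 2 * (x powr u * x - 1 - (u + 1) * (x - 1)) + (x powr u - 1 - u * (x - 1))"
    unfolding left_diff_distrib distrib_right mult.assoc k p by simp
  also have "\<dots> = x powr u * (x - 1)\<^sup>2" by (simp add: power2_eq_square algebra_simps)
  finally show ?thesis using False assms by simp
qed

text \<open>
  With \<open>l\<close> the mass of \<open>\<sigma>\<close>, the probability \<open>(1 - l / N) \<delta>\<^sub>1 + \<sigma> / N\<close> has real moments \<open>1 + A u / N\<close>, where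
  \<open>A u\<close> is the integral in the exponent. Its \<open>N\<close>-fold product convolution has \<open>(1 + A u / N) ^ N\<close>, which tends to
  \<open>exp (A u)\<close>.
\<close>

lemma compound_poisson_has_mellin:
  fixes \<sigma> :: "real measure"
  assumes fin: "finite_measure \<sigma>" and sets: "sets \<sigma> = sets borel" and nn: "AE x in \<sigma>. 0 \<le> x"
    and int: "\<And>u. u > 0 \<Longrightarrow> integrable \<sigma> (\<lambda>x. \<bar>x\<bar> powr u)"
  shows "\<exists>\<mu>. has_mellin \<mu> (\<lambda>u. exp (\<integral>x. (\<bar>x\<bar> powr u - 1) \<partial>\<sigma>))"
proof -
  interpret finite_measure \<sigma> by fact
  note [measurable_cong] = sets
  have sp: "space \<sigma> = UNIV" using sets by (auto dest: sets_eq_imp_space_eq)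
  define l where "l = measure \<sigma> UNIV"
  define A where "A u = (\<integral>x. (\<bar>x\<bar> powr u - 1) \<partial>\<sigma>)" for u
  have A: "A u = (\<integral>x. \<bar>x\<bar> powr u \<partial>\<sigma>) - l" if "u > 0" for u
    using int[OF that] by (simp add: A_def l_def sp)
  \<comment> \<open>the shift by \<open>l\<close> keeps the weight \<open>1 - l / N\<close> nonnegative\<close>
  define N where "N k = Suc k + nat \<lceil>l\<rceil>" for k
  have N: "real (N k) > 0" "l \<le> real (N k)" for k
    unfolding N_def by (auto, linarith)
  have l0: "l \<ge> 0" by (simp add: l_def)
  define K where "K k = measure_plus (density (return borel 1) (\<lambda>_. ennreal (1 - l / N k))) (density \<sigma> (\<lambda>_. ennreal (1 / N k)))" for k
  have S: "sets (density \<sigma> (\<lambda>_. ennreal (1 / N k))) = sets (density (return borel 1) (\<lambda>_. ennreal (1 - l / N k)))" for k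
    by (simp add: sets)
  have nnK: "nn_integral (K k) f = ennreal (1 - l / N k) * f 1 + ennreal (1 / N k) * nn_integral \<sigma> f"
    if [measurable]: "f \<in> borel_measurable borel" for f k
    unfolding K_def using sets
    by (subst nn_integral_measure_plus[OF S]) (auto simp: nn_integral_density nn_integral_return nn_integral_cmult)
  have frac: "l / N k \<le> 1" for k using N[of k] l0 by simp
  have "has_mellin (K k) (\<lambda>u. 1 + A u / N k)" for k
  proof (rule has_mellinI_nn_integral)
    have "emeasure (K k) UNIV = nn_integral (K k) (\<lambda>_. 1)" by (simp add: K_def)
    also have "\<dots> = ennreal (1 - l / N k) + ennreal (1 / N k) * ennreal l"
      by (subst nnK) (auto simp: sp emeasure_eq_measure l_def)
    also have "\<dots> = 1" using l0 frac[of k] N[of k] by (simp flip: ennreal_mult ennreal_plus)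
    finally show "real_distribution (K k)"
      by (intro real_distribution.intro prob_spaceI) (auto simp: real_distribution_axioms_def K_def)
    show "AE x in K k. 0 \<le> x" unfolding K_def
      using nn by (intro AE_measure_plus[OF S]) (auto simp: AE_density AE_return)
    fix u :: real assume u: "u > 0"
    have F: "(\<integral>x. \<bar>x\<bar> powr u \<partial>\<sigma>) \<ge> 0" by simp
    have eq: "1 + A u / N k = (1 - l / N k) + 1 / N k * (\<integral>x. \<bar>x\<bar> powr u \<partial>\<sigma>)"
      by (simp add: A[OF u] diff_divide_distrib)
    show "1 + A u / N k \<ge> 0" unfolding eq using frac[of k] F by (intro add_nonneg_nonneg mult_nonneg_nonneg) auto
    have "(\<integral>\<^sup>+x. ennreal (\<bar>x\<bar> powr u) \<partial>K k) = ennreal (1 - l / N k) + ennreal (1 / N k) * ennreal (\<integral>x. \<bar>x\<bar> powr u \<partial>\<sigma>)"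
      by (subst nnK) (auto simp: nn_integral_eq_integral[OF int[OF u]])
    also have "\<dots> = ennreal (1 - l / N k) + ennreal (1 / N k * (\<integral>x. \<bar>x\<bar> powr u \<partial>\<sigma>))"
      using F by (subst ennreal_mult[symmetric]) auto
    also have "\<dots> = ennreal (1 + A u / N k)"
      unfolding eq using frac[of k] F by (intro ennreal_plus[symmetric]) auto
    finally show "(\<integral>\<^sup>+x. ennreal (\<bar>x\<bar> powr u) \<partial>K k) = ennreal (1 + A u / N k)" .
  qed
  then have "\<exists>M. has_mellin M (\<lambda>u. (1 + A u / N k) ^ N k)" for k
    by (rule has_mellin_power)
  then obtain M where M: "\<And>k. has_mellin (M k) (\<lambda>u. (1 + A u / N k) ^ N k)" by metis
  have "(\<lambda>k. (1 + A u / N k) ^ N k) \<longlonglongrightarrow> exp (A u)" for u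
    using LIMSEQ_ignore_initial_segment[OF tendsto_exp_limit_sequentially[of "A u"], of "Suc (nat \<lceil>l\<rceil>)"]
    by (simp add: N_def)
  then show ?thesis
    unfolding A_def by (intro has_mellin_limit_exists[OF M[unfolded A_def]])
qed

text \<open>
  The Levy measure \<open>\<tau> / (x - 1)\<^sup>2\<close> may be infinite near \<open>1\<close>. The maps \<open>T k\<close> push the mass of \<open>\<tau>\<close> within \<open>1 / Suc k\<close> of
  the point \<open>1\<close> to \<open>1 - 1 / Suc k\<close>, after which the Levy measure is finite and its exponent is that of a compound Poisson
  distribution plus a drift. Since \<open>T k x\<close> tends to \<open>x\<close> and the kernel is continuous, also at \<open>1\<close>, the exponents converge.
\<close>

lemma levy_khintchine_has_mellin:
  assumes \<tau>: "has_stieltjes_moments \<tau> m"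
  shows "\<exists>\<mu>. has_mellin \<mu> (\<lambda>u. exp (d * u + (\<integral>x. levy_kernel u x \<partial>\<tau>)))"
proof -
  have sets[measurable_cong]: "sets \<tau> = sets borel" and nn: "AE x in \<tau>. 0 \<le> x"
    using \<tau> by (auto simp: has_stieltjes_moments_def borel_measure_on_def)
  \<comment> \<open>moving the mass to the left of \<open>1\<close> keeps \<open>\<bar>T k x\<bar> \<le> \<bar>x\<bar>\<close>, so one function dominates all \<open>k\<close>\<close>
  define T where "T k x = (if \<bar>x - 1\<bar> < 1 / Suc k then 1 - 1 / Suc k else x)" for k and x :: real
  have T_meas[measurable]: "T k \<in> borel_measurable borel" for k unfolding T_def[abs_def] by measurable
  have T_abs: "\<bar>T k x\<bar> \<le> \<bar>x\<bar>" and T_nn: "x \<ge> 0 \<Longrightarrow> T k x \<ge> 0" for k x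
  proof -
    have "1 / real (Suc k) \<le> 1" by simp
    then show "\<bar>T k x\<bar> \<le> \<bar>x\<bar>" "x \<ge> 0 \<Longrightarrow> T k x \<ge> 0"
      unfolding T_def by (auto simp del: of_nat_Suc simp: abs_if split: if_splits)
  qed
  have T_dist: "\<bar>T k x - 1\<bar> \<ge> 1 / Suc k" for k x by (auto simp: T_def)
  have T_ne: "T k x \<noteq> 1" for k x using T_dist[of k x] by (auto simp del: of_nat_Suc)
  define w where "w k x = 1 / (T k x - 1)\<^sup>2" for k x
  have w_meas[measurable]: "w k \<in> borel_measurable borel" for k unfolding w_def[abs_def] by measurable
  have w_nn: "w k x \<ge> 0" for k x by (simp add: w_def)
  have w_bd: "w k x \<le> (real (Suc k))\<^sup>2" for k x
  proof -
    have "(1 / real (Suc k))\<^sup>2 \<le> \<bar>T k x - 1\<bar>\<^sup>2" using T_dist[of k x] by (intro power_mono) auto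
    then show ?thesis by (simp add: w_def T_ne field_simps power_divide del: of_nat_Suc)
  qed
  define \<sigma> where "\<sigma> k = distr (density \<tau> (\<lambda>x. ennreal (w k x))) borel (T k)" for k
  have \<sigma>_integral: "integrable (\<sigma> k) f \<longleftrightarrow> integrable \<tau> (\<lambda>x. w k x * f (T k x))"
     "(\<integral>x. f x \<partial>\<sigma> k) = (\<integral>x. w k x * f (T k x) \<partial>\<tau>)" if [measurable]: "f \<in> borel_measurable borel" for f :: "real \<Rightarrow> real" and k
    unfolding \<sigma>_def using w_nn
    by (simp_all add: integrable_distr_eq integral_distr integrable_density integral_density)
  have growth: "integrable \<tau> (\<lambda>x. w k x * f (T k x))"
    if [measurable]: "f \<in> borel_measurable borel" and b: "\<And>x. \<bar>f x\<bar> \<le> C * (1 + \<bar>x\<bar>) ^ n" and C: "C \<ge> 0" for f C n k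
  proof (rule has_stieltjes_moments_integrable_growth[OF \<tau>])
    fix x
    have "\<bar>w k x * f (T k x)\<bar> \<le> (real (Suc k))\<^sup>2 * (C * (1 + \<bar>T k x\<bar>) ^ n)"
      using w_bd[of k x] w_nn[of k x] b[of "T k x"] by (simp add: abs_mult mult_mono del: of_nat_Suc)
    also have "\<dots> \<le> (real (Suc k))\<^sup>2 * (C * (1 + \<bar>x\<bar>) ^ n)"
      using T_abs[of k x] C by (intro mult_left_mono power_mono) auto
    finally show "\<bar>w k x * f (T k x)\<bar> \<le> ((real (Suc k))\<^sup>2 * C) * (1 + \<bar>x\<bar>) ^ n" by (simp add: mult_ac)
  qed simp
  have int_1: "integrable \<tau> (\<lambda>x. w k x * 1)" for k by (rule growth[where C=1 and n=0]) auto
  have int_x: "integrable \<tau> (\<lambda>x. w k x * (T k x - 1))" for k by (rule growth[where C=1 and n=1]) auto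
  have int_u: "integrable \<tau> (\<lambda>x. w k x * \<bar>T k x\<bar> powr u)" if "u > 0" for k u
    using that abs_powr_le_power[of u "nat \<lceil>u\<rceil>"]
    by (intro growth[where C=1 and n="nat \<lceil>u\<rceil>"]) (auto simp: of_nat_ceiling)
  have "\<exists>\<mu>. has_mellin \<mu> (\<lambda>u. exp (\<integral>x. (\<bar>x\<bar> powr u - 1) \<partial>\<sigma> k))" for k
  proof (rule compound_poisson_has_mellin)
    have "integrable (\<sigma> k) (\<lambda>_. 1::real)" using int_1[of k] by (subst \<sigma>_integral) auto
    then show "finite_measure (\<sigma> k)"
      by (intro finite_measureI) (simp add: integrable_iff_bounded)
    show "AE x in \<sigma> k. 0 \<le> x" unfolding \<sigma>_def using nn T_nn
      by (subst AE_distr_iff) (auto simp: AE_density elim: eventually_mono)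
    show "integrable (\<sigma> k) (\<lambda>x. \<bar>x\<bar> powr u)" if "u > 0" for u
      using int_u[OF that] by (subst \<sigma>_integral) auto
  qed (simp add: \<sigma>_def)
  then obtain M where M: "\<And>k. has_mellin (M k) (\<lambda>u. exp (\<integral>x. (\<bar>x\<bar> powr u - 1) \<partial>\<sigma> k))" by metis
  define D where "D k = - (\<integral>x. w k x * (T k x - 1) \<partial>\<tau>)" for k
  have kernel: "(\<integral>x. (\<bar>x\<bar> powr u - 1) \<partial>\<sigma> k) + D k * u = (\<integral>x. levy_kernel u (T k x) \<partial>\<tau>)" if u: "u > 0" for k u
  proof -
    have "(\<integral>x. (\<bar>x\<bar> powr u - 1) \<partial>\<sigma> k) = (\<integral>x. w k x * \<bar>T k x\<bar> powr u - w k x * 1 \<partial>\<tau>)"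
      by (subst \<sigma>_integral) (auto simp: algebra_simps)
    moreover have "D k * u = - (\<integral>x. u * (w k x * (T k x - 1)) \<partial>\<tau>)" by (simp add: D_def)
    moreover have "levy_kernel u (T k x) = (w k x * \<bar>T k x\<bar> powr u - w k x * 1) - u * (w k x * (T k x - 1))" for x
      using T_ne[of k x] by (simp add: levy_kernel_def w_def divide_inverse algebra_simps)
    ultimately show ?thesis using int_1[of k] int_x[of k] int_u[OF u, of k] by simp
  qed
  have lim: "(\<lambda>k. \<integral>x. levy_kernel u (T k x) \<partial>\<tau>) \<longlonglongrightarrow> (\<integral>x. levy_kernel u x \<partial>\<tau>)" if u: "u > 0" for u
  proof -
    obtain C n where C: "\<And>x. \<bar>levy_kernel u x\<bar> \<le> C * (1 + \<bar>x\<bar>) ^ n" using levy_kernel_growth[OF u] by metis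
    have C0: "C \<ge> 0" using order_trans[OF abs_ge_zero C[of 0]] by simp
    show ?thesis
    proof (rule integral_dominated_convergence[where w="\<lambda>x. C * (1 + \<bar>x\<bar>) ^ n"])
      show "integrable \<tau> (\<lambda>x. C * (1 + \<bar>x\<bar>) ^ n)"
        by (rule has_stieltjes_moments_integrable_growth[OF \<tau>, where C=C and n=n]) (use C0 in auto)
      show "AE x in \<tau>. norm (levy_kernel u (T k x)) \<le> C * (1 + \<bar>x\<bar>) ^ n" for k
      proof (rule AE_I2)
        fix x
        have "\<bar>levy_kernel u (T k x)\<bar> \<le> C * (1 + \<bar>T k x\<bar>) ^ n" by (rule C)
        also have "\<dots> \<le> C * (1 + \<bar>x\<bar>) ^ n" using T_abs[of k x] C0 by (intro mult_left_mono power_mono) auto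
        finally show "norm (levy_kernel u (T k x)) \<le> C * (1 + \<bar>x\<bar>) ^ n" by simp
      qed
      show "AE x in \<tau>. (\<lambda>k. levy_kernel u (T k x)) \<longlonglongrightarrow> levy_kernel u x"
      proof (rule AE_I2)
        fix x :: real
        have "(\<lambda>k. T k x) \<longlonglongrightarrow> x"
        proof (cases "x = 1")
          case True
          then have "T k x = 1 - 1 / Suc k" for k by (simp add: T_def)
          moreover have "(\<lambda>k. 1 - 1 / real (Suc k)) \<longlonglongrightarrow> 1" by real_asymp
          ultimately show ?thesis using True by simp
        next
          case False
          have "(\<lambda>k. 1 / real (Suc k)) \<longlonglongrightarrow> 0" by real_asymp
          then have "\<forall>\<^sub>F k in sequentially. 1 / real (Suc k) < \<bar>x - 1\<bar>"
            using False by (intro order_tendstoD(2)) auto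
          then have "\<forall>\<^sub>F k in sequentially. T k x = x" by eventually_elim (auto simp: T_def)
          then show ?thesis by (rule tendsto_eventually)
        qed
        then show "(\<lambda>k. levy_kernel u (T k x)) \<longlonglongrightarrow> levy_kernel u x"
          using continuous_on_levy_kernel[OF u]
          by (intro isCont_tendsto_compose[of x "levy_kernel u"]) (auto simp: continuous_on_eq_continuous_at)
      qed
    qed auto
  qed
  have P: "has_mellin (M k \<diamondop> return borel (exp (d + D k)))
      (\<lambda>u. exp (\<integral>x. (\<bar>x\<bar> powr u - 1) \<partial>\<sigma> k) * exp ((d + D k) * u))" for k
    by (intro has_mellin_product_convolution M has_mellin_exp_linear)
  show ?thesis
  proof (rule has_mellin_limit_exists[OF P])
    fix u :: real assume u: "u > 0"
    have "exp (\<integral>x. (\<bar>x\<bar> powr u - 1) \<partial>\<sigma> k) * exp ((d + D k) * u) = exp (d * u + (\<integral>x. levy_kernel u (T k x) \<partial>\<tau>))" for k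
      unfolding kernel[OF u, symmetric] by (simp add: exp_add algebra_simps)
    then show "(\<lambda>k. exp (\<integral>x. (\<bar>x\<bar> powr u - 1) \<partial>\<sigma> k) * exp ((d + D k) * u))
        \<longlonglongrightarrow> exp (d * u + (\<integral>x. levy_kernel u x \<partial>\<tau>))"
      using lim[OF u] by (simp add: tendsto_intros)
  qed
qed

section \<open>Levy representations as moment sequences\<close>

definition log_second_diff :: "(nat \<Rightarrow> real) \<Rightarrow> nat \<Rightarrow> real" where
  "log_second_diff s n = ln (s (n + 2)) - 2 * ln (s (n + 1)) + ln (s n)"

text \<open>
  The measure called \<open>\<tau>\<close> in the introduction.
\<close>

definition levy_moment_measure :: "real \<Rightarrow> real measure \<Rightarrow> real measure" where
  "levy_moment_measure b \<sigma> =
     measure_plus (density \<sigma> (\<lambda>x. ennreal ((1 - x)\<^sup>2))) (density (return borel 1) (\<lambda>_. ennreal (2 * b)))"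

text \<open>
  Since \<open>1 / 0 = 0\<close>, the density vanishes at \<open>1\<close>, so the atom there is dropped.
\<close>

definition levy_measure_of :: "real measure \<Rightarrow> real measure" where
  "levy_measure_of \<tau> = density \<tau> (\<lambda>x. ennreal (1 / (1 - x)\<^sup>2))"

lemma levy_kernel_nat:
  assumes "n \<ge> 1" "x \<ge> 0" "x \<noteq> 1"
  shows "levy_kernel (real n) x = (x ^ n - 1 - real n * (x - 1)) / (1 - x)\<^sup>2"
  using assms by (simp add: levy_kernel_def powr_realpow' power2_commute)

lemma levy_kernel_one_two:
  assumes "x \<ge> 0" shows "levy_kernel 1 x = 0" "levy_kernel 2 x = 1"
proof -
  show "levy_kernel 1 x = 0" using assms by (simp add: levy_kernel_def)
  have "x\<^sup>2 - 1 - 2 * (x - 1) = (x - 1)\<^sup>2" by (simp add: power2_eq_square algebra_simps)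
  then show "levy_kernel 2 x = 1" using assms by (simp add: levy_kernel_def powr_numeral)
qed

text \<open>
  Both sides have the same second difference. The case \<open>n = 2\<close> cannot be reached from \<open>n = 0\<close> by
  \<open>levy_kernel_second_difference\<close>, since \<open>0 powr 0 = 0\<close> while \<open>0 ^ 0 = 1\<close>; instead, \<open>levy_kernel 2\<close> is constant on \<open>{0..}\<close>.
\<close>

lemma log_eq_integral_levy_kernel:
  assumes \<tau>: "has_stieltjes_moments \<tau> (log_second_diff s)" and s0: "ln (s 0) = 0" and n: "n \<ge> 1"
  shows "ln (s n) = ln (s 1) * real n + (\<integral>x. levy_kernel (real n) x \<partial>\<tau>)"
proof -
  have sets[measurable_cong]: "sets \<tau> = sets borel" and nn: "AE x in \<tau>. 0 \<le> x"
    and mom: "\<And>n. integrable \<tau> (\<lambda>x. x ^ n)" "\<And>n. log_second_diff s n = (\<integral>x. x ^ n \<partial>\<tau>)"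
    using \<tau> by (auto simp: has_stieltjes_moments_def borel_measure_on_def)
  have one: "(\<integral>x. levy_kernel 1 x \<partial>\<tau>) = 0"
    by (rule integral_eq_zero_AE) (use nn in \<open>eventually_elim, simp add: levy_kernel_one_two\<close>)
  have two: "(\<integral>x. levy_kernel 2 x \<partial>\<tau>) = (\<integral>x. x ^ 0 \<partial>\<tau>)"
    by (rule integral_cong_AE) (use nn in \<open>auto simp: levy_kernel_one_two elim: eventually_mono\<close>)
  show ?thesis using n
  proof (induction n rule: less_induct)
    case (less n)
    consider "n = 1" | "n = 2" | k where "n = k + 2" "k \<ge> 1"
    proof -
      have "n = 1 \<or> n = 2 \<or> (n = (n - 2) + 2 \<and> n - 2 \<ge> 1)" using less.prems by arith
      then show ?thesis using that by blast
    qed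
    then show ?case
    proof cases
      case 1
      then show ?thesis using one by simp
    next
      case 2
      then show ?thesis using two mom(2)[of 0] s0 by (simp add: log_second_diff_def numeral_2_eq_2)
    next
      case 3
      have ae: "AE x in \<tau>. levy_kernel (real k + 2) x - 2 * levy_kernel (real k + 1) x + levy_kernel (real k) x = x ^ k"
        using nn by eventually_elim (use \<open>k \<ge> 1\<close> in \<open>simp add: levy_kernel_second_difference powr_realpow'\<close>)
      have "log_second_diff s k = (\<integral>x. levy_kernel (real k + 2) x - 2 * levy_kernel (real k + 1) x + levy_kernel (real k) x \<partial>\<tau>)"
        unfolding mom(2) by (rule integral_cong_AE) (use ae in \<open>auto elim: eventually_mono\<close>)
      also have "\<dots> = (\<integral>x. levy_kernel (real k + 2) x \<partial>\<tau>) - 2 * (\<integral>x. levy_kernel (real k + 1) x \<partial>\<tau>) + (\<integral>x. levy_kernel (real k) x \<partial>\<tau>)"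
        using \<open>k \<ge> 1\<close> integrable_levy_kernel[OF \<tau>] by simp
      finally have "ln (s n) = (\<integral>x. levy_kernel (real n) x \<partial>\<tau>)
          + 2 * (ln (s (k + 1)) - (\<integral>x. levy_kernel (real (k + 1)) x \<partial>\<tau>)) - (ln (s k) - (\<integral>x. levy_kernel (real k) x \<partial>\<tau>))"
        by (simp add: log_second_diff_def 3 add.commute)
      moreover have "ln (s (k + 1)) - (\<integral>x. levy_kernel (real (k + 1)) x \<partial>\<tau>) = ln (s 1) * real (k + 1)"
        using less.IH[of "k + 1"] 3 by simp
      moreover have "ln (s k) - (\<integral>x. levy_kernel (real k) x \<partial>\<tau>) = ln (s 1) * real k"
        using less.IH[of k] 3 by simp
      ultimately show ?thesis using 3 by (simp add: algebra_simps)
    qed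
  qed
qed

text \<open>
  Removing the atom at \<open>1\<close> from \<open>\<tau>\<close> takes \<open>n * (n - 1) / 2\<close> times its mass from the kernel integral; this is the
  quadratic term of the representation together with the correction of the drift.
\<close>

lemma levy_representation_if_moments:
  assumes \<tau>: "has_stieltjes_moments \<tau> (log_second_diff s)" and s0: "ln (s 0) = 0"
  shows "levy_representation s (ln (s 1) - measure \<tau> {1} / 2) (measure \<tau> {1} / 2) (levy_measure_of \<tau>)"
proof -
  interpret finite_measure \<tau> using \<tau> by (rule has_stieltjes_moments_finite_measure)
  have sets[measurable_cong]: "sets \<tau> = sets borel" and nn: "AE x in \<tau>. 0 \<le> x"
    and mom: "\<And>n. integrable \<tau> (\<lambda>x. x ^ n)"
    using \<tau> by (auto simp: has_stieltjes_moments_def borel_measure_on_def)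
  have sp[simp]: "space \<tau> = UNIV" using sets by (auto dest: sets_eq_imp_space_eq)
  let ?\<sigma> = "levy_measure_of \<tau>" and ?m = "measure \<tau> {1}"
  have nn\<sigma>: "(\<integral>\<^sup>+x. f x \<partial>?\<sigma>) = (\<integral>\<^sup>+x. ennreal (1 / (1 - x)\<^sup>2) * f x \<partial>\<tau>)"
    if [measurable]: "f \<in> borel_measurable borel" for f
    unfolding levy_measure_of_def by (subst nn_integral_density) auto
  show ?thesis unfolding levy_representation_def
  proof (intro conjI allI impI)
    show "radon_measure_on ({0..} - {1}) ?\<sigma>" unfolding radon_measure_on_def borel_measure_on_def
    proof (intro conjI allI impI)
      show "AE x in ?\<sigma>. x \<in> {0..} - {1}" unfolding levy_measure_of_def
        using nn by (subst AE_density) (auto elim!: eventually_mono)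
      fix K :: "real set" assume K: "compact K \<and> K \<subseteq> {0..} - {1}"
      then have [measurable]: "K \<in> sets borel" by (auto intro: borel_compact)
      have "open (- K)" "1 \<in> - K" using K by (auto intro: compact_imp_closed)
      then obtain d where d: "d > 0" "ball 1 d \<subseteq> - K" by (meson open_contains_ball)
      have "emeasure ?\<sigma> K = (\<integral>\<^sup>+x. ennreal (1 / (1 - x)\<^sup>2) * indicator K x \<partial>\<tau>)"
        unfolding levy_measure_of_def by (rule emeasure_density) auto
      also have "\<dots> \<le> (\<integral>\<^sup>+x. ennreal (1 / d\<^sup>2) \<partial>\<tau>)"
      proof (rule nn_integral_mono)
        fix x :: real
        show "ennreal (1 / (1 - x)\<^sup>2) * indicator K x \<le> ennreal (1 / d\<^sup>2)"
        proof (cases "x \<in> K")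
          case True
          then have "d \<le> \<bar>1 - x\<bar>" using d by (auto simp: dist_real_def subset_iff not_less[symmetric])
          then have "d\<^sup>2 \<le> \<bar>1 - x\<bar>\<^sup>2" using d by (intro power_mono) auto
          then show ?thesis using d True by (auto intro!: ennreal_leI divide_left_mono simp: mult_pos_pos zero_less_mult_iff)
        qed simp
      qed
      also have "\<dots> < \<infinity>" by (simp add: emeasure_eq_measure ennreal_mult_less_top)
      finally show "emeasure ?\<sigma> K < \<infinity>" .
    qed (simp add: levy_measure_of_def sets)
    have "(\<integral>\<^sup>+x. ennreal ((1 - x)\<^sup>2) \<partial>?\<sigma>) \<le> (\<integral>\<^sup>+x. 1 \<partial>\<tau>)"
    proof (subst nn\<sigma>)
      show "(\<integral>\<^sup>+x. ennreal (1 / (1 - x)\<^sup>2) * ennreal ((1 - x)\<^sup>2) \<partial>\<tau>) \<le> (\<integral>\<^sup>+x. 1 \<partial>\<tau>)"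
        by (rule nn_integral_mono) (simp add: ennreal_mult[symmetric])
    qed simp
    also have "\<dots> < \<infinity>" by (simp add: emeasure_eq_measure)
    finally show "(\<integral>\<^sup>+x. ennreal ((1 - x)\<^sup>2) \<partial>?\<sigma>) < \<infinity>" .
    show "(\<integral>\<^sup>+x\<in>{2..}. ennreal (x ^ n) \<partial>?\<sigma>) < \<infinity>" for n
    proof -
      have "(\<integral>\<^sup>+x\<in>{2..}. ennreal (x ^ n) \<partial>?\<sigma>) = (\<integral>\<^sup>+x. ennreal (1 / (1 - x)\<^sup>2) * (ennreal (x ^ n) * indicator {2..} x) \<partial>\<tau>)"
        by (subst nn\<sigma>) auto
      also have "\<dots> \<le> (\<integral>\<^sup>+x. ennreal (norm (x ^ n)) \<partial>\<tau>)"
      proof (rule nn_integral_mono)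
        fix x :: real
        show "ennreal (1 / (1 - x)\<^sup>2) * (ennreal (x ^ n) * indicator {2..} x) \<le> ennreal (norm (x ^ n))"
        proof (cases "x \<ge> 2")
          case True
          then have "1 \<le> (x - 1)\<^sup>2" by (intro one_le_power) auto
          then have "1 / (1 - x)\<^sup>2 \<le> 1" by (subst power2_commute) (simp add: divide_le_eq_1)
          then have "1 / (1 - x)\<^sup>2 * x ^ n \<le> 1 * x ^ n" using True by (intro mult_right_mono) auto
          then show ?thesis using True by (auto simp: ennreal_mult[symmetric] intro!: ennreal_leI)
        qed simp
      qed
      also have "\<dots> < \<infinity>" using mom[of n] by (simp add: integrable_iff_bounded)
      finally show ?thesis .
    qed
    fix n
    show "ln (s n) = (ln (s 1) - ?m / 2) * real n + ?m / 2 * (real n)\<^sup>2 + (\<integral>x. x ^ n - 1 - real n * (x - 1) \<partial>?\<sigma>)"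
    proof (cases "n = 0")
      case True
      then show ?thesis using s0 by simp
    next
      case False
      then have n: "n \<ge> 1" by simp
      have "(\<integral>x. x ^ n - 1 - real n * (x - 1) \<partial>?\<sigma>) = (\<integral>x. 1 / (1 - x)\<^sup>2 * (x ^ n - 1 - real n * (x - 1)) \<partial>\<tau>)"
        unfolding levy_measure_of_def by (subst integral_density) auto
      also have "\<dots> = (\<integral>x. levy_kernel (real n) x - indicator {1} x * levy_kernel (real n) 1 \<partial>\<tau>)"
        by (rule integral_cong_AE) (use nn n in \<open>auto elim!: eventually_mono simp: levy_kernel_nat split: split_indicator\<close>)
      also have "\<dots> = (\<integral>x. levy_kernel (real n) x \<partial>\<tau>) - ?m * (real n * (real n - 1) / 2)"
        using integrable_levy_kernel[OF \<tau>, of n] n by (simp add: levy_kernel_def[of _ 1] emeasure_eq_measure)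
      finally show ?thesis using log_eq_integral_levy_kernel[OF \<tau> s0 n]
        by (simp add: field_simps power2_eq_square)
    qed
  qed simp
qed

text \<open>
  The three parameters of a Levy representation are functions of \<open>levy_moment_measure b \<sigma>\<close> (and of \<open>s 1\<close>), whose moments
  depend on \<open>s\<close> alone. So uniqueness of the representation reduces to determinacy of \<open>log_second_diff s\<close>.
\<close>

lemma levy_representation_moment_measure:
  assumes rep: "levy_representation s a b \<sigma>"
  shows "has_stieltjes_moments (levy_moment_measure b \<sigma>) (log_second_diff s)"
    and "ln (s 0) = 0" and "a = ln (s 1) - b" and "measure (levy_moment_measure b \<sigma>) {1} = 2 * b"
    and "levy_measure_of (levy_moment_measure b \<sigma>) = \<sigma>"
proof -
  have b: "b \<ge> 0" and sets[measurable_cong]: "sets \<sigma> = sets borel" and nn: "AE x in \<sigma>. 0 \<le> x \<and> x \<noteq> 1"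
    and fin2: "(\<integral>\<^sup>+x. ennreal ((1 - x)\<^sup>2) \<partial>\<sigma>) < \<infinity>"
    and finn: "\<And>n. n \<ge> 3 \<Longrightarrow> (\<integral>\<^sup>+x\<in>{2..}. ennreal (x ^ n) \<partial>\<sigma>) < \<infinity>"
    and eq: "\<And>n. ln (s n) = a * real n + b * (real n)\<^sup>2 + (\<integral>x. (x ^ n - 1 - real n * (x - 1)) \<partial>\<sigma>)"
    using rep by (auto simp: levy_representation_def radon_measure_on_def borel_measure_on_def)
  have sp[simp]: "space \<sigma> = UNIV" using sets by (auto dest: sets_eq_imp_space_eq)
  \<comment> \<open>below \<open>2\<close> the factor \<open>(1 - x)\<^sup>2\<close> dominates, above \<open>2\<close> the power \<open>x ^ (n + 3)\<close>\<close>
  have int: "integrable \<sigma> (\<lambda>x. (1 - x)\<^sup>2 * x ^ n)" for n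
  proof -
    have "(\<integral>\<^sup>+x. ennreal (norm ((1 - x)\<^sup>2 * x ^ n)) \<partial>\<sigma>)
        \<le> (\<integral>\<^sup>+x. ennreal (2 ^ n) * ennreal ((1 - x)\<^sup>2) + ennreal (x ^ (n + 3)) * indicator {2..} x \<partial>\<sigma>)"
    proof (rule nn_integral_mono_AE)
      show "AE x in \<sigma>. ennreal (norm ((1 - x)\<^sup>2 * x ^ n)) \<le> ennreal (2 ^ n) * ennreal ((1 - x)\<^sup>2) + ennreal (x ^ (n + 3)) * indicator {2..} x"
        using nn
      proof eventually_elim
        case (elim x)
        then have norm: "norm ((1 - x)\<^sup>2 * x ^ n) = (1 - x)\<^sup>2 * x ^ n" by simp
        show ?case
        proof (cases "x \<ge> 2")
          case True
          have "(1 - x)\<^sup>2 * x ^ n \<le> x ^ 3 * x ^ n"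
          proof (rule mult_right_mono)
            have "(1 - x)\<^sup>2 \<le> x\<^sup>2" using True by (subst power2_commute) (auto intro!: power_mono)
            also have "\<dots> \<le> x ^ 3" using True by (intro power_increasing) auto
            finally show "(1 - x)\<^sup>2 \<le> x ^ 3" .
          qed (use elim in auto)
          also have "\<dots> = x ^ (n + 3)" by (simp add: power_add mult.commute)
          finally have "ennreal ((1 - x)\<^sup>2 * x ^ n) \<le> ennreal (x ^ (n + 3))" by (rule ennreal_leI)
          then show ?thesis unfolding norm using True by (simp add: add_increasing)
        next
          case False
          then have "(1 - x)\<^sup>2 * x ^ n \<le> (1 - x)\<^sup>2 * 2 ^ n" using elim by (intro mult_left_mono power_mono) auto
          then show ?thesis unfolding norm using False by (simp add: ennreal_mult[symmetric] mult.commute)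
        qed
      qed
    qed
    also have "\<dots> = ennreal (2 ^ n) * (\<integral>\<^sup>+x. ennreal ((1 - x)\<^sup>2) \<partial>\<sigma>) + (\<integral>\<^sup>+x\<in>{2..}. ennreal (x ^ (n + 3)) \<partial>\<sigma>)"
      by (simp add: nn_integral_add nn_integral_cmult)
    also have "\<dots> < \<infinity>" using fin2 finn[of "n + 3"] by (simp add: ennreal_mult_less_top)
    finally show ?thesis by (intro integrableI_bounded) auto
  qed
  define f where "f n x = x ^ n - 1 - real n * (x - 1)" for n and x :: real
  have diff: "f (n + 2) x = 2 * f (n + 1) x - f n x + (1 - x)\<^sup>2 * x ^ n" for n x
    by (simp add: f_def power2_eq_square algebra_simps)
  have f_int: "integrable \<sigma> (f n) \<and> integrable \<sigma> (f (n + 1))" for n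
  proof (induction n)
    case 0
    have "f 0 = (\<lambda>_. 0)" "f 1 = (\<lambda>_. 0)" by (auto simp: f_def)
    then show ?case by simp
  next
    case (Suc n)
    then have "integrable \<sigma> (\<lambda>x. 2 * f (n + 1) x - f n x + (1 - x)\<^sup>2 * x ^ n)"
      using int[of n] by simp
    then have "integrable \<sigma> (f (n + 2))" unfolding diff[symmetric] .
    then show ?case using Suc by simp
  qed
  have sd: "log_second_diff s n = 2 * b + (\<integral>x. (1 - x)\<^sup>2 * x ^ n \<partial>\<sigma>)" for n
  proof -
    have "(\<integral>x. f (n + 2) x \<partial>\<sigma>) = 2 * (\<integral>x. f (n + 1) x \<partial>\<sigma>) - (\<integral>x. f n x \<partial>\<sigma>) + (\<integral>x. (1 - x)\<^sup>2 * x ^ n \<partial>\<sigma>)"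
      unfolding diff using f_int[of n] int[of n] by simp
    then show ?thesis unfolding log_second_diff_def eq[of "n + 2"] eq[of "n + 1"] eq[of n] f_def
      by (simp add: power2_eq_square algebra_simps)
  qed
  let ?\<rho> = "density \<sigma> (\<lambda>x. ennreal ((1 - x)\<^sup>2))" and ?\<delta> = "density (return borel 1) (\<lambda>_. ennreal (2 * b)) :: real measure"
  have S: "sets ?\<delta> = sets ?\<rho>" by (simp add: sets)
  show "has_stieltjes_moments (levy_moment_measure b \<sigma>) (log_second_diff s)"
    unfolding has_stieltjes_moments_def borel_measure_on_def levy_moment_measure_def
  proof (intro conjI allI)
    show "AE x in measure_plus ?\<rho> ?\<delta>. x \<in> {0..}"
    proof (rule AE_measure_plus[OF S])
      show "AE x in ?\<rho>. x \<in> {0..}" using nn by (subst AE_density) (auto elim!: eventually_mono)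
      show "AE x in ?\<delta>. x \<in> {0..}" by (subst AE_density) (auto simp: AE_return)
    qed
    fix n
    have i1: "integrable ?\<rho> (\<lambda>x. x ^ n)" using int[of n] by (subst integrable_density) auto
    have "integrable (return borel 1) (\<lambda>x::real. 2 * b * x ^ n)"
      by (rule integrableI_bounded) (auto simp: nn_integral_return)
    then have i2: "integrable ?\<delta> (\<lambda>x. x ^ n)" using b by (subst integrable_density) auto
    show "integrable (measure_plus ?\<rho> ?\<delta>) (\<lambda>x. x ^ n)" by (rule integrable_measure_plus[OF S i1 i2])
    have "(\<integral>x. x ^ n \<partial>?\<rho>) = (\<integral>x. (1 - x)\<^sup>2 * x ^ n \<partial>\<sigma>)" by (subst integral_density) auto
    moreover have "(\<integral>x. x ^ n \<partial>?\<delta>) = 2 * b" using b by (subst integral_density) (auto simp: integral_return)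
    ultimately show "log_second_diff s n = (\<integral>x. x ^ n \<partial>measure_plus ?\<rho> ?\<delta>)"
      unfolding integral_measure_plus[OF S i1 i2] sd by simp
  qed (simp add: sets)
  show "ln (s 0) = 0" using eq[of 0] by simp
  show "a = ln (s 1) - b" using eq[of 1] by simp
  have "emeasure ?\<rho> {1} = (\<integral>\<^sup>+x. 0 \<partial>\<sigma>)"
    by (subst emeasure_density) (auto intro!: nn_integral_cong split: split_indicator)
  moreover have "emeasure ?\<delta> {1} = ennreal (2 * b)"
    by (subst emeasure_density) (auto simp: nn_integral_return)
  ultimately show "measure (levy_moment_measure b \<sigma>) {1} = 2 * b"
    using b unfolding measure_def levy_moment_measure_def by (subst emeasure_measure_plus[OF S]) (auto simp: sets)
  show "levy_measure_of (levy_moment_measure b \<sigma>) = \<sigma>"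
  proof (rule measure_eqI)
    fix A assume "A \<in> sets (levy_measure_of (levy_moment_measure b \<sigma>))"
    then have A[measurable]: "A \<in> sets borel" by (simp add: levy_measure_of_def levy_moment_measure_def sets)
    have "emeasure (levy_measure_of (levy_moment_measure b \<sigma>)) A
        = (\<integral>\<^sup>+x. ennreal (1 / (1 - x)\<^sup>2) * indicator A x \<partial>measure_plus ?\<rho> ?\<delta>)"
      unfolding levy_measure_of_def levy_moment_measure_def by (rule emeasure_density) (auto simp: sets)
    also have "\<dots> = (\<integral>\<^sup>+x. ennreal (1 / (1 - x)\<^sup>2) * indicator A x \<partial>?\<rho>) + (\<integral>\<^sup>+x. ennreal (1 / (1 - x)\<^sup>2) * indicator A x \<partial>?\<delta>)"
      by (rule nn_integral_measure_plus[OF S]) (simp cong: measurable_cong_sets add: sets)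
    also have "(\<integral>\<^sup>+x. ennreal (1 / (1 - x)\<^sup>2) * indicator A x \<partial>?\<delta>) = 0"
      by (subst nn_integral_density) (auto simp: nn_integral_return)
    also have "(\<integral>\<^sup>+x. ennreal (1 / (1 - x)\<^sup>2) * indicator A x \<partial>?\<rho>) = (\<integral>\<^sup>+x. ennreal ((1 - x)\<^sup>2) * (ennreal (1 / (1 - x)\<^sup>2) * indicator A x) \<partial>\<sigma>)"
      by (rule nn_integral_density) auto
    also have "\<dots> = (\<integral>\<^sup>+x. indicator A x \<partial>\<sigma>)"
    proof (rule nn_integral_cong_AE)
      show "AE x in \<sigma>. ennreal ((1 - x)\<^sup>2) * (ennreal (1 / (1 - x)\<^sup>2) * indicator A x) = indicator A x"
        using nn
      proof eventually_elim
        case (elim x)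
        then have "ennreal ((1 - x)\<^sup>2) * ennreal (1 / (1 - x)\<^sup>2) = 1" by (simp flip: ennreal_mult)
        then show ?case by (simp flip: mult.assoc)
      qed
    qed
    also have "\<dots> = emeasure \<sigma> A" by (simp add: sets)
    finally show "emeasure (levy_measure_of (levy_moment_measure b \<sigma>)) A = emeasure \<sigma> A" by simp
  qed (simp add: levy_measure_of_def levy_moment_measure_def)
qed

section \<open>Limits of Stieltjes moment sequences\<close>

lemma has_stieltjes_moments_scale:
  assumes \<mu>: "has_stieltjes_moments \<mu> m" and c: "c \<ge> 0"
  shows "has_stieltjes_moments (density \<mu> (\<lambda>_. ennreal c)) (\<lambda>n. c * m n)"
proof -
  have [measurable_cong]: "sets \<mu> = sets borel" and nn: "AE x in \<mu>. 0 \<le> x"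
    and m: "\<And>n. integrable \<mu> (\<lambda>x. x ^ n)" "\<And>n. m n = (\<integral>x. x ^ n \<partial>\<mu>)"
    using \<mu> by (auto simp: has_stieltjes_moments_def borel_measure_on_def)
  have "AE x in density \<mu> (\<lambda>_. ennreal c). 0 \<le> x" using nn by (subst AE_density) auto
  then show ?thesis unfolding has_stieltjes_moments_def borel_measure_on_def using m c
    by (auto simp: integrable_density integral_density \<open>sets \<mu> = sets borel\<close>)
qed

lemma normalized_stieltjes_moments_limit:
  assumes N: "\<And>k. has_stieltjes_moments (N k) (m k)" and m0: "\<And>k. m k 0 = 1"
    and lim: "\<And>n. (\<lambda>k. m k n) \<longlonglongrightarrow> t n"
  shows "\<exists>\<tau>. has_stieltjes_moments \<tau> t"
proof -
  have D: "real_distribution (N k)" for k by (rule has_stieltjes_moments_real_distribution[OF N m0])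
  have N': "AE x in N k. 0 \<le> x" "integrable (N k) (\<lambda>x. x ^ n)" "(\<integral>x. x ^ n \<partial>N k) = m k n" for k n
    using N[of k] by (auto simp: has_stieltjes_moments_def borel_measure_on_def)
  obtain B where B: "\<And>k. m k 1 \<le> B" using convergent_imp_bounded_above[OF lim[of 1]] by blast
  have "tight N" by (rule tight_if_bounded_mean[of N B, OF D N'(1)]) (use N'(2,3)[of _ 1] B in auto)
  from tight_imp_convergent_subsubsequence[OF this strict_mono_id] obtain r \<tau>
    where r: "strict_mono r" and \<tau>: "real_distribution \<tau>" "weak_conv_m (\<lambda>k. N (r k)) \<tau>"
    by (auto simp: o_def id_def)
  interpret \<tau>: real_distribution \<tau> by fact
  have "integrable \<tau> (\<lambda>x. x ^ n) \<and> t n = (\<integral>x. x ^ n \<partial>\<tau>)" for n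
  proof -
    obtain B where B: "\<And>k. m k (2 * n) \<le> B" using convergent_imp_bounded_above[OF lim[of "2 * n"]] by blast
    have sq: "integrable (N (r k)) (\<lambda>x. (x ^ n)\<^sup>2)" "(\<integral>x. (x ^ n)\<^sup>2 \<partial>N (r k)) \<le> B" for k
      using N'(2,3)[of "r k" "2 * n"] B[of "r k"] by (simp_all add: power_mult[symmetric] mult.commute)
    have cont: "continuous_on UNIV (\<lambda>x::real. x ^ n)" by (intro continuous_intros)
    note * = weak_conv_imp_integral_conv[OF D \<tau>(1,2) cont sq]
    have "(\<lambda>k. m (r k) n) \<longlonglongrightarrow> (\<integral>x. x ^ n \<partial>\<tau>)" using *(2) N'(3) by simp
    moreover have "(\<lambda>k. m (r k) n) \<longlonglongrightarrow> t n" using LIMSEQ_subseq_LIMSEQ[OF lim r] by (simp add: o_def)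
    ultimately have "t n = (\<integral>x. x ^ n \<partial>\<tau>)" by (intro LIMSEQ_unique)
    then show ?thesis using *(1) by simp
  qed
  moreover have "AE x in \<tau>. 0 \<le> x" by (rule AE_nonneg_weak_limit[OF D \<tau>(1,2) N'(1)])
  ultimately have "has_stieltjes_moments \<tau> t"
    unfolding has_stieltjes_moments_def borel_measure_on_def by auto
  then show ?thesis ..
qed

text \<open>
  If the masses have a positive limit, normalize them. If they tend to \<open>0\<close>, there is nothing to normalize, but
  \<open>x ^ n \<le> \<eta> * x ^ (2 * n) + 1 / (4 * \<eta>)\<close> for every \<open>\<eta> > 0\<close> forces all limits to vanish, and the null measure
  represents them.
\<close>

lemma has_stieltjes_moments_limit:
  assumes N: "\<And>k. has_stieltjes_moments (N k) (m k)" and lim: "\<And>n. (\<lambda>k. m k n) \<longlonglongrightarrow> t n"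
  shows "\<exists>\<tau>. has_stieltjes_moments \<tau> t"
proof -
  have sets: "sets (N k) = sets borel" and nn: "AE x in N k. 0 \<le> x"
    and m: "integrable (N k) (\<lambda>x. x ^ n)" "m k n = (\<integral>x. x ^ n \<partial>N k)" for k n
    using N[of k] by (auto simp: has_stieltjes_moments_def borel_measure_on_def)
  have m_nn: "m k n \<ge> 0" for k n unfolding m
    by (rule integral_nonneg_AE) (use nn[of k] in \<open>eventually_elim, simp\<close>)
  have t_nn: "t n \<ge> 0" for n by (rule LIMSEQ_le_const[OF lim]) (use m_nn in auto)
  show ?thesis
  proof (cases "t 0 > 0")
    case True
    then have "\<forall>\<^sub>F k in sequentially. m k 0 > 0" using lim[of 0] by (rule order_tendstoD(1)[rotated])
    then obtain k0 where k0: "\<And>k. k \<ge> k0 \<Longrightarrow> m k 0 > 0" by (auto simp: eventually_sequentially)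
    have "\<exists>\<tau>. has_stieltjes_moments \<tau> (\<lambda>n. 1 / t 0 * t n)"
    proof (rule normalized_stieltjes_moments_limit)
      show "has_stieltjes_moments (density (N (k + k0)) (\<lambda>_. ennreal (1 / m (k + k0) 0))) (\<lambda>n. 1 / m (k + k0) 0 * m (k + k0) n)" for k
        by (intro has_stieltjes_moments_scale N) (use m_nn in auto)
      show "1 / m (k + k0) 0 * m (k + k0) 0 = 1" for k using k0[of "k + k0"] by simp
      have "(\<lambda>k. 1 / m k 0 * m k n) \<longlonglongrightarrow> 1 / t 0 * t n" for n
        using True by (intro tendsto_intros lim) auto
      then show "(\<lambda>k. 1 / m (k + k0) 0 * m (k + k0) n) \<longlonglongrightarrow> 1 / t 0 * t n" for n
        by (rule LIMSEQ_ignore_initial_segment)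
    qed
    then obtain \<tau> where "has_stieltjes_moments \<tau> (\<lambda>n. 1 / t 0 * t n)" ..
    from has_stieltjes_moments_scale[OF this, of "t 0"] True show ?thesis by auto
  next
    case False
    then have t0: "t 0 = 0" using t_nn[of 0] by simp
    have bound: "t n \<le> \<eta> * t (2 * n)" if \<eta>: "\<eta> > 0" for n \<eta>
    proof (rule LIMSEQ_le[OF lim])
      have "(\<lambda>k. \<eta> * m k (2 * n) + 1 / (4 * \<eta>) * m k 0) \<longlonglongrightarrow> \<eta> * t (2 * n) + 1 / (4 * \<eta>) * t 0"
        by (intro tendsto_intros lim)
      then show "(\<lambda>k. \<eta> * m k (2 * n) + 1 / (4 * \<eta>) * m k 0) \<longlonglongrightarrow> \<eta> * t (2 * n)" by (simp add: t0)
      have pt: "x ^ n \<le> \<eta> * x ^ (2 * n) + 1 / (4 * \<eta>) * x ^ 0" for x :: real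
      proof -
        have "0 \<le> (2 * \<eta> * x ^ n - 1)\<^sup>2" by simp
        then have "4 * \<eta> * x ^ n \<le> 4 * \<eta> * (\<eta> * (x ^ n)\<^sup>2) + 1"
          by (simp add: power2_eq_square algebra_simps)
        then have "x ^ n \<le> (4 * \<eta> * (\<eta> * (x ^ n)\<^sup>2) + 1) / (4 * \<eta>)"
          using \<eta> by (simp add: pos_le_divide_eq mult.commute)
        also have "\<dots> = \<eta> * (x ^ n)\<^sup>2 + 1 / (4 * \<eta>)" using \<eta> by (simp add: add_divide_distrib)
        finally show ?thesis by (simp add: power_mult[symmetric] mult.commute)
      qed
      have "m k n \<le> \<eta> * m k (2 * n) + 1 / (4 * \<eta>) * m k 0" for k
      proof -
        have "m k n \<le> (\<integral>x. \<eta> * x ^ (2 * n) + 1 / (4 * \<eta>) * x ^ 0 \<partial>N k)"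
          unfolding m(2) by (intro integral_mono m Bochner_Integration.integrable_add Bochner_Integration.integrable_mult_right pt)
        also have "\<dots> = (\<integral>x. \<eta> * x ^ (2 * n) \<partial>N k) + (\<integral>x. 1 / (4 * \<eta>) * x ^ 0 \<partial>N k)"
          by (intro Bochner_Integration.integral_add Bochner_Integration.integrable_mult_right m)
        finally show ?thesis unfolding m(2) integral_mult_right_zero .
      qed
      then show "\<exists>K. \<forall>k\<ge>K. m k n \<le> \<eta> * m k (2 * n) + 1 / (4 * \<eta>) * m k 0" by blast
    qed
    have "t n \<le> 0" for n
    proof (rule ccontr)
      assume "\<not> t n \<le> 0"
      then have pos: "t n > 0" by simp
      have "t n \<le> t n / (2 * (t (2 * n) + 1)) * t (2 * n)"
        using pos t_nn[of "2 * n"] by (intro bound) auto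
      also have "\<dots> < t n" using pos t_nn[of "2 * n"] by (simp add: field_simps add_pos_nonneg)
      finally show False by simp
    qed
    then have "t n = 0" for n using t_nn[of n] by (simp add: order_antisym)
    then have "has_stieltjes_moments (null_measure borel) t"
      unfolding has_stieltjes_moments_def borel_measure_on_def
      by (auto intro!: integrableI_bounded AE_I'[of UNIV] simp: null_sets_def integral_null_measure)
    then show ?thesis by blast
  qed
qed

section \<open>Mixtures with an atom at zero\<close>

text \<open>
  The atom at \<open>0\<close> produces the Kronecker delta in the representations, as \<open>0 ^ n\<close> is
  nonzero only for \<open>n = 0\<close>.
\<close>

definition zero_mixture :: "real \<Rightarrow> real measure \<Rightarrow> real measure" where
  "zero_mixture e \<kappa> = measure_plus (density (return borel 0) (\<lambda>_. ennreal (1 - e))) (density \<kappa> (\<lambda>_. ennreal e))"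

lemma has_stieltjes_moments_zero_mixture:
  assumes sets[measurable_cong]: "sets \<kappa> = sets borel" and pos: "AE x in \<kappa>. 0 < x"
    and e: "0 < e" "e \<le> 1" and int: "\<And>n. integrable \<kappa> (\<lambda>x. x ^ n)"
  shows "has_stieltjes_moments (zero_mixture e \<kappa>) (\<lambda>n. (1 - e) * of_bool (n = 0) + e * (\<integral>x. x ^ n \<partial>\<kappa>))"
  unfolding has_stieltjes_moments_def borel_measure_on_def zero_mixture_def
proof (intro conjI allI)
  let ?\<delta> = "density (return borel 0) (\<lambda>_. ennreal (1 - e)) :: real measure" and ?\<kappa> = "density \<kappa> (\<lambda>_. ennreal e)"
  have S: "sets ?\<kappa> = sets ?\<delta>" by (simp add: sets)
  show "AE x in measure_plus ?\<delta> ?\<kappa>. x \<in> {0..}"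
  proof (rule AE_measure_plus[OF S])
    show "AE x in ?\<delta>. x \<in> {0..}" by (subst AE_density) (auto simp: AE_return)
    show "AE x in ?\<kappa>. x \<in> {0..}" using pos by (subst AE_density) (auto elim!: eventually_mono)
  qed
  fix n
  have i: "integrable (return borel 0) (\<lambda>x::real. (1 - e) * x ^ n)"
    by (rule integrableI_bounded) (auto simp: nn_integral_return)
  have i1: "integrable ?\<delta> (\<lambda>x. x ^ n)" using i e by (subst integrable_density) auto
  have i2: "integrable ?\<kappa> (\<lambda>x. x ^ n)" using int e by (subst integrable_density) auto
  show "integrable (measure_plus ?\<delta> ?\<kappa>) (\<lambda>x. x ^ n)" by (rule integrable_measure_plus[OF S i1 i2])
  have "(\<integral>x. x ^ n \<partial>?\<delta>) = (1 - e) * of_bool (n = 0)" using e by (subst integral_density) (auto simp: integral_return)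
  moreover have "(\<integral>x. x ^ n \<partial>?\<kappa>) = e * (\<integral>x. x ^ n \<partial>\<kappa>)" using e by (subst integral_density) auto
  ultimately show "(1 - e) * of_bool (n = 0) + e * (\<integral>x. x ^ n \<partial>\<kappa>) = (\<integral>x. x ^ n \<partial>measure_plus ?\<delta> ?\<kappa>)"
    unfolding integral_measure_plus[OF S i1 i2] by simp
qed simp

lemma zero_mixture_eq_imp:
  assumes sets: "sets \<kappa> = sets borel" "sets \<kappa>' = sets borel" and prob: "prob_space \<kappa>" "prob_space \<kappa>'"
    and pos: "AE x in \<kappa>. 0 < x" "AE x in \<kappa>'. 0 < x" and e: "0 < e" "e \<le> 1" "0 < e'" "e' \<le> 1"
    and eq: "zero_mixture e \<kappa> = zero_mixture e' \<kappa>'"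
  shows "e = e'" "\<kappa> = \<kappa>'"
proof -
  have em: "emeasure (zero_mixture e \<kappa>) (A \<inter> {0<..}) = ennreal e * emeasure \<kappa> A"
    if s[measurable_cong]: "sets \<kappa> = sets borel" and p: "AE x in \<kappa>. 0 < x" and A[measurable]: "A \<in> sets borel" for e \<kappa> A
  proof -
    have S: "sets (density \<kappa> (\<lambda>_. ennreal e)) = sets (density (return borel 0) (\<lambda>_. ennreal (1 - e)))" by (simp add: s)
    have "emeasure (density (return borel 0) (\<lambda>_. ennreal (1 - e))) (A \<inter> {0<..}) = 0"
      by (subst emeasure_density) (auto simp: nn_integral_return)
    moreover have "emeasure (density \<kappa> (\<lambda>_. ennreal e)) (A \<inter> {0<..}) = ennreal e * emeasure \<kappa> (A \<inter> {0<..})"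
      by (subst emeasure_density) (auto simp: nn_integral_cmult_indicator)
    moreover have "emeasure \<kappa> (A \<inter> {0<..}) = emeasure \<kappa> A"
      by (rule emeasure_eq_AE) (use p in \<open>auto elim!: eventually_mono\<close>)
    ultimately show ?thesis unfolding zero_mixture_def by (subst emeasure_measure_plus[OF S]) auto
  qed
  have "ennreal e * emeasure \<kappa> UNIV = ennreal e' * emeasure \<kappa>' UNIV"
    using em[OF sets(1) pos(1), of UNIV e] em[OF sets(2) pos(2), of UNIV e'] eq by simp
  moreover have "emeasure \<kappa> UNIV = 1" "emeasure \<kappa>' UNIV = 1"
    using prob_space.emeasure_space_1[OF prob(1)] prob_space.emeasure_space_1[OF prob(2)]
      sets[THEN sets_eq_imp_space_eq] by simp_all
  ultimately show ee: "e = e'" using e by simp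
  show "\<kappa> = \<kappa>'"
  proof (rule measure_eqI)
    fix A assume "A \<in> sets \<kappa>"
    then have A: "A \<in> sets borel" using sets by simp
    have "ennreal e * emeasure \<kappa> A = ennreal e * emeasure \<kappa>' A"
      using em[OF sets(1) pos(1) A, of e] em[OF sets(2) pos(2) A, of e'] eq ee by simp
    then show "emeasure \<kappa> A = emeasure \<kappa>' A" using e by (simp add: ennreal_mult_cancel_left)
  qed (simp add: sets)
qed

section \<open>From powers of a moment sequence to a semigroup\<close>

text \<open>
  If \<open>M k\<close> represents the root of order \<open>Suc k\<close>, then \<open>Suc k * (1 - x)\<^sup>2\<close> times \<open>M k\<close> has as moments the second differences
  of \<open>Suc k * (s n powr (1 / Suc k) - 1)\<close>, which tends to \<open>ln (s n)\<close>.
\<close>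

lemma log_second_diff_stieltjes_if_roots:
  assumes pos: "\<And>n. s n > 0" and s0: "s 0 = 1"
    and roots: "\<And>k. k \<ge> 1 \<Longrightarrow> stieltjes_moment_seq (\<lambda>n. s n powr (1 / real k))"
  shows "\<exists>\<tau>. has_stieltjes_moments \<tau> (log_second_diff s)"
proof -
  have "\<exists>M. has_stieltjes_moments M (\<lambda>n. s n powr (1 / Suc k))" for k
    using roots[of "Suc k"] by (simp add: stieltjes_moment_seq_def)
  then obtain M where M: "\<And>k. has_stieltjes_moments (M k) (\<lambda>n. s n powr (1 / Suc k))" by metis
  let ?r = "\<lambda>k n. s n powr (1 / Suc k)"
  show ?thesis
  proof (rule has_stieltjes_moments_limit)
    fix k
    have [measurable_cong]: "sets (M k) = sets borel" and nn: "AE x in M k. 0 \<le> x"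
      and m: "\<And>n. integrable (M k) (\<lambda>x. x ^ n)" "\<And>n. ?r k n = (\<integral>x. x ^ n \<partial>M k)"
      using M[of k] by (auto simp: has_stieltjes_moments_def borel_measure_on_def)
    let ?D = "density (M k) (\<lambda>x. ennreal (real (Suc k) * (1 - x)\<^sup>2))"
    have eq: "real (Suc k) * (1 - x)\<^sup>2 * x ^ n = real (Suc k) * (x ^ (n + 2) - 2 * x ^ (n + 1) + x ^ n)" for x n
      by (simp add: power2_eq_square algebra_simps)
    have int: "integrable (M k) (\<lambda>x. real (Suc k) * (x ^ (n + 2) - 2 * x ^ (n + 1) + x ^ n))" for n
      by (intro Bochner_Integration.integrable_add Bochner_Integration.integrable_diff
          Bochner_Integration.integrable_mult_right m)
    have lin: "(\<integral>x. x ^ p - 2 * x ^ q + x ^ r \<partial>M k) = ?r k p - 2 * ?r k q + ?r k r" for p q r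
      using m by simp
    have val: "(\<integral>x. real (Suc k) * (x ^ (n + 2) - 2 * x ^ (n + 1) + x ^ n) \<partial>M k)
        = real (Suc k) * (?r k (n + 2) - 2 * ?r k (n + 1) + ?r k n)" for n
      by (simp only: integral_mult_right_zero lin)
    show "has_stieltjes_moments ?D (\<lambda>n. real (Suc k) * (?r k (n + 2) - 2 * ?r k (n + 1) + ?r k n))"
      unfolding has_stieltjes_moments_def borel_measure_on_def
    proof (intro conjI allI)
      show "AE x in ?D. x \<in> {0..}" using nn by (subst AE_density) (auto elim!: eventually_mono)
      fix n
      show "integrable ?D (\<lambda>x. x ^ n)"
        using int[of n] by (subst integrable_density) (auto simp: eq simp del: of_nat_Suc)
      show "real (Suc k) * (?r k (n + 2) - 2 * ?r k (n + 1) + ?r k n) = (\<integral>x. x ^ n \<partial>?D)"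
      proof -
        have "(\<integral>x. x ^ n \<partial>?D) = (\<integral>x. real (Suc k) * (1 - x)\<^sup>2 * x ^ n \<partial>M k)"
          by (subst integral_density) auto
        then show ?thesis by (simp only: eq val)
      qed
    qed (use M[of k] in \<open>simp add: has_stieltjes_moments_def borel_measure_on_def\<close>)
  next
    fix n
    have ln: "(\<lambda>k. real (Suc k) * (a powr (1 / real (Suc k)) - 1)) \<longlonglongrightarrow> ln a" if "a > 0" for a :: real
      using that by real_asymp
    have "(\<lambda>k. real (Suc k) * (?r k (n + 2) - 1) - 2 * (real (Suc k) * (?r k (n + 1) - 1)) + real (Suc k) * (?r k n - 1))
        \<longlonglongrightarrow> log_second_diff s n"
      unfolding log_second_diff_def by (intro tendsto_intros ln pos)
    then show "(\<lambda>k. real (Suc k) * (?r k (n + 2) - 2 * ?r k (n + 1) + ?r k n)) \<longlonglongrightarrow> log_second_diff s n"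
      by (simp add: algebra_simps)
  qed
qed

definition levy_exponent :: "(nat \<Rightarrow> real) \<Rightarrow> real measure \<Rightarrow> real \<Rightarrow> real" where
  "levy_exponent s \<tau> u = ln (s 1) * u + (\<integral>x. levy_kernel u x \<partial>\<tau>)"

lemma levy_exponent_nat:
  assumes "has_stieltjes_moments \<tau> (log_second_diff s)" "s 0 = 1" "n \<ge> 1"
  shows "levy_exponent s \<tau> (real n) = ln (s n)"
  using log_eq_integral_levy_kernel[OF assms(1) _ assms(3)] assms(2) by (simp add: levy_exponent_def)

lemma levy_exponent_has_mellin:
  assumes \<tau>: "has_stieltjes_moments \<tau> t" and c: "c > 0"
  shows "\<exists>\<mu>. has_mellin \<mu> (\<lambda>u. exp (c * levy_exponent s \<tau> u))"
proof -
  have [measurable_cong]: "sets \<tau> = sets borel" using \<tau> by (simp add: has_stieltjes_moments_def borel_measure_on_def)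
  have "(\<integral>x. levy_kernel u x \<partial>density \<tau> (\<lambda>_. ennreal c)) = c * (\<integral>x. levy_kernel u x \<partial>\<tau>)" for u
    using c by (subst integral_density) auto
  then show ?thesis
    using levy_khintchine_has_mellin[OF has_stieltjes_moments_scale[OF \<tau>, of c], of "c * ln (s 1)"] c
    by (simp add: levy_exponent_def distrib_left mult_ac)
qed

lemma levy_exponent_moments:
  assumes pos: "\<And>n. s n > 0" and s0: "s 0 = 1" and \<tau>: "has_stieltjes_moments \<tau> (log_second_diff s)"
    and \<mu>: "has_mellin \<mu> (\<lambda>u. exp (c * levy_exponent s \<tau> u))"
  shows "has_stieltjes_moments \<mu> (\<lambda>n. s n powr c)"
proof (rule has_mellin_imp_stieltjes_moments[OF \<mu>])
  show "s n powr c = exp (c * levy_exponent s \<tau> (real n))" if "n \<ge> 1" for n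
    using pos[of n] levy_exponent_nat[OF \<tau> s0 that] by (simp add: powr_def)
qed (simp add: s0)

text \<open>
  As \<open>u\<close> decreases to \<open>0\<close>, \<open>x powr u\<close> tends to the indicator of \<open>{0<..}\<close>. Hence the mass off zero is the limit of
  \<open>exp (c * g u) = exp (g u) powr c\<close>.
\<close>

lemma mellin_power_family_mass:
  assumes \<mu>: "\<And>c. c > 0 \<Longrightarrow> has_mellin (\<mu> c) (\<lambda>u. exp (c * g u))" and c: "c > 0"
  shows "measure (\<mu> c) {0<..} = measure (\<mu> 1) {0<..} powr c" and "measure (\<mu> 1) {0<..} > 0"
proof -
  have mass: "(\<lambda>n. exp (c * g (1 / Suc n))) \<longlonglongrightarrow> measure (\<mu> c) {0<..}" if c: "c > 0" for c
  proof -
    interpret real_distribution "\<mu> c" using \<mu>[OF c] by (rule has_mellin_real_distribution)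
    have "(\<lambda>n. \<integral>x. \<bar>x\<bar> powr (1 / Suc n) \<partial>\<mu> c) \<longlonglongrightarrow> (\<integral>x. indicator {0<..} x \<partial>\<mu> c)"
    proof (rule integral_dominated_convergence[where w="\<lambda>x. 1 + \<bar>x\<bar> powr 1"])
      show "integrable (\<mu> c) (\<lambda>x. 1 + \<bar>x\<bar> powr 1)" using has_mellin_integrable[OF \<mu>[OF c], of 1] by simp
      show "AE x in \<mu> c. norm (\<bar>x\<bar> powr (1 / Suc n)) \<le> 1 + \<bar>x\<bar> powr 1" for n
        using abs_powr_le_power[of "1 / Suc n" 1] by (intro AE_I2) auto
      show "AE x in \<mu> c. (\<lambda>n. \<bar>x\<bar> powr (1 / Suc n)) \<longlonglongrightarrow> indicator {0<..} x"
        using has_mellin_AE[OF \<mu>[OF c]]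
      proof eventually_elim
        case (elim x)
        show ?case
        proof (cases "x = 0")
          case False
          then have "\<bar>x\<bar> > 0" by simp
          then have "(\<lambda>n. \<bar>x\<bar> powr (1 / Suc n)) \<longlonglongrightarrow> 1" by real_asymp
          then show ?thesis using elim False by simp
        qed simp
      qed
    qed auto
    moreover have "(\<integral>x. \<bar>x\<bar> powr (1 / Suc n) \<partial>\<mu> c) = exp (c * g (1 / Suc n))" for n
      by (rule has_mellin_integral[OF \<mu>[OF c]]) simp
    ultimately show ?thesis by simp
  qed
  have "(\<lambda>n. exp (1 * g (1 / Suc n)) powr c) \<longlonglongrightarrow> measure (\<mu> 1) {0<..} powr c"
    by (rule tendsto_powr'[OF mass tendsto_const]) (use c in auto)
  moreover have "exp (1 * g u) powr c = exp (c * g u)" for u by (simp add: powr_def)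
  ultimately have "(\<lambda>n. exp (c * g (1 / Suc n))) \<longlonglongrightarrow> measure (\<mu> 1) {0<..} powr c" by simp
  with mass[OF c] show "measure (\<mu> c) {0<..} = measure (\<mu> 1) {0<..} powr c" by (rule LIMSEQ_unique)
  interpret real_distribution "\<mu> 1" using \<mu>[of 1] by (intro has_mellin_real_distribution) auto
  show "measure (\<mu> 1) {0<..} > 0"
  proof (rule ccontr)
    assume "\<not> 0 < measure (\<mu> 1) {0<..}"
    then have "measure (\<mu> 1) {0<..} = 0" by (simp add: zero_less_measure_iff)
    then have "AE x in \<mu> 1. x \<notin> {0<..}" by (intro AE_not_in) (simp add: null_sets_def emeasure_eq_measure)
    moreover have "AE x in \<mu> 1. 0 \<le> x" using \<mu>[of 1] by (intro has_mellin_AE) auto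
    ultimately have "AE x in \<mu> 1. \<bar>x\<bar> powr 1 = 0" by eventually_elim auto
    then have "(\<integral>x. \<bar>x\<bar> powr 1 \<partial>\<mu> 1) = 0" by (rule integral_eq_zero_AE)
    then show False using has_mellin_integral[OF \<mu>[of 1], of 1] by simp
  qed
qed

text \<open>
  Conditioning on \<open>{0<..}\<close> divides the real moments by \<open>\<epsilon> powr c\<close>, so they stay multiplicative in \<open>c\<close>, which is the
  semigroup law by uniqueness. They are also continuous in \<open>c\<close>, which gives weak continuity on the closed half-line. No mass
  escapes to \<open>0\<close>, as the limit measure has no atom there; so test functions may be discontinuous at \<open>0\<close>.
\<close>

lemma mellin_power_family_semigroup:
  assumes \<mu>: "\<And>c. c > 0 \<Longrightarrow> has_mellin (\<mu> c) (\<lambda>u. exp (c * g u))"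
  obtains \<epsilon> \<rho> where "0 < \<epsilon>" "\<epsilon> \<le> 1" "product_convolution_semigroup \<rho>"
    "\<And>c. c > 0 \<Longrightarrow> has_mellin (\<rho> c) (\<lambda>u. exp (c * g u) / \<epsilon> powr c)"
proof -
  define \<epsilon> where "\<epsilon> = measure (\<mu> 1) {0<..}"
  define \<rho> where "\<rho> c = density (\<mu> c) (\<lambda>x. ennreal (indicator {0<..} x / \<epsilon> powr c))" for c
  have d1: "real_distribution (\<mu> c)" if "c > 0" for c using \<mu>[OF that] by (rule has_mellin_real_distribution)
  have \<epsilon>: "0 < \<epsilon>" "\<epsilon> \<le> 1" using mellin_power_family_mass(2)[of \<mu> g 1, OF \<mu>] real_distribution.axioms(1)[OF d1[of 1]]
    by (auto simp: \<epsilon>_def prob_space.prob_le_1)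
  have mass: "measure (\<mu> c) {0<..} = \<epsilon> powr c" if "c > 0" for c
    unfolding \<epsilon>_def by (rule mellin_power_family_mass(1)[OF \<mu> that])
  have sets[measurable_cong, simp]: "sets (\<rho> c) = sets borel" if "c > 0" for c
    using real_distribution.events_eq_borel[OF d1[OF that]] by (simp add: \<rho>_def)
  have nn\<rho>: "nn_integral (\<rho> c) f = ennreal (1 / \<epsilon> powr c) * (\<integral>\<^sup>+x. f x * indicator {0<..} x \<partial>\<mu> c)"
    if c: "c > 0" and [measurable]: "f \<in> borel_measurable borel" for c f
  proof -
    interpret real_distribution "\<mu> c" by (rule d1[OF c])
    have "nn_integral (\<rho> c) f = (\<integral>\<^sup>+x. ennreal (1 / \<epsilon> powr c) * (f x * indicator {0<..} x) \<partial>\<mu> c)"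
      unfolding \<rho>_def by (subst nn_integral_density) (auto intro!: nn_integral_cong split: split_indicator)
    then show ?thesis by (simp add: nn_integral_cmult)
  qed
  have pos: "AE x in \<rho> c. 0 < x" if c: "c > 0" for c
  proof -
    interpret real_distribution "\<mu> c" by (rule d1[OF c])
    show ?thesis unfolding \<rho>_def by (subst AE_density) (auto split: split_indicator)
  qed
  have M: "has_mellin (\<rho> c) (\<lambda>u. exp (c * g u) / \<epsilon> powr c)" if c: "c > 0" for c
  proof (rule has_mellinI_nn_integral)
    interpret real_distribution "\<mu> c" by (rule d1[OF c])
    have "emeasure (\<rho> c) UNIV = nn_integral (\<rho> c) (\<lambda>_. 1)" by (simp add: \<rho>_def)
    also have "\<dots> = ennreal (1 / \<epsilon> powr c) * ennreal (\<epsilon> powr c)"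
      using mass[OF c] by (subst nn\<rho>[OF c]) (auto simp: emeasure_eq_measure)
    also have "\<dots> = 1" using \<epsilon> by (simp flip: ennreal_mult)
    finally show "real_distribution (\<rho> c)"
      using sets[OF c] by (auto intro!: real_distribution.intro prob_spaceI simp: real_distribution_axioms_def \<rho>_def)
    show "AE x in \<rho> c. 0 \<le> x" using pos[OF c] by eventually_elim simp
    fix u :: real assume u: "u > 0"
    have "(\<integral>\<^sup>+x. ennreal (\<bar>x\<bar> powr u) * indicator {0<..} x \<partial>\<mu> c) = (\<integral>\<^sup>+x. ennreal (\<bar>x\<bar> powr u) \<partial>\<mu> c)"
    proof (rule nn_integral_cong_AE)
      show "AE x in \<mu> c. ennreal (\<bar>x\<bar> powr u) * indicator {0<..} x = ennreal (\<bar>x\<bar> powr u)"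
        using has_mellin_AE[OF \<mu>[OF c]] by eventually_elim (auto split: split_indicator)
    qed
    then show "(\<integral>\<^sup>+x. ennreal (\<bar>x\<bar> powr u) \<partial>\<rho> c) = ennreal (exp (c * g u) / \<epsilon> powr c)"
      by (simp add: nn\<rho>[OF c] has_mellin_nn_integral[OF \<mu>[OF c] u] ennreal_mult[symmetric])
  qed simp
  have "product_convolution_semigroup \<rho>" unfolding product_convolution_semigroup_def
  proof (intro conjI allI impI)
    fix c :: real assume c: "c > 0"
    show "prob_space (\<rho> c)" using has_mellin_real_distribution[OF M[OF c]] by (simp add: real_distribution_def)
    show "borel_measure_on {0<..} (\<rho> c)" using sets[OF c] pos[OF c] by (auto simp: borel_measure_on_def)
    fix d :: real assume d: "d > 0"
    show "\<rho> c \<diamondop> \<rho> d = \<rho> (c + d)"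
      by (rule has_mellin_unique[OF has_mellin_product_convolution[OF M[OF c] M[OF d]] M])
         (use c d in \<open>auto simp: powr_add exp_add distrib_right\<close>)
  next
    fix f :: "real \<Rightarrow> real" assume f: "continuous_on {0<..} f \<and> bounded (f ` {0<..})"
    then obtain B where B: "\<And>x. x > 0 \<Longrightarrow> \<bar>f x\<bar> \<le> B" by (auto simp: bounded_iff)
    define h where "h x = indicator {0<..} x *\<^sub>R f x" for x
    have h_meas[measurable]: "h \<in> borel_measurable borel"
      unfolding h_def[abs_def] using f by (intro borel_measurable_continuous_on_indicator) auto
    have h_cont: "isCont h x" if "x \<noteq> 0" for x
    proof (cases "x > 0")
      case True
      have "\<forall>\<^sub>F y in nhds x. f y = h y"
        using eventually_nhds_in_open[of "{0<..}" x] True by (auto simp: h_def elim!: eventually_mono)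
      moreover have "isCont f x" using f True by (auto simp: continuous_on_eq_continuous_at)
      ultimately show ?thesis by (subst isCont_cong[symmetric])
    next
      case False
      have "\<forall>\<^sub>F y in nhds x. 0 = h y"
        using eventually_nhds_in_open[of "{..<0}" x] False that by (auto simp: h_def elim!: eventually_mono)
      from isCont_cong[OF this] show ?thesis by simp
    qed
    have "continuous_on {0<..} (\<lambda>c. \<integral>x. h x \<partial>\<rho> c)"
      unfolding continuous_on_sequentially
    proof (intro ballI allI impI, elim conjE)
      fix X and c :: real assume c: "c \<in> {0<..}" and X: "\<forall>n. X n \<in> {0<..}" "X \<longlonglongrightarrow> c"
      have MX: "has_mellin (\<rho> (X n)) (\<lambda>u. exp (X n * g u) / \<epsilon> powr X n)" for n using M X by auto
      have Mc: "has_mellin (\<rho> c) (\<lambda>u. exp (c * g u) / \<epsilon> powr c)" using M c by auto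
      have wc: "weak_conv_m (\<lambda>n. \<rho> (X n)) (\<rho> c)"
      proof (rule has_mellin_weak_conv[OF MX _ Mc])
        show "(\<lambda>n. exp (X n * g u) / \<epsilon> powr X n) \<longlonglongrightarrow> exp (c * g u) / \<epsilon> powr c" for u
          using \<epsilon> X(2) by (intro tendsto_intros) auto
      qed
      have disc: "emeasure (\<rho> c) {x. \<not> isCont h x} = 0"
      proof -
        have "AE x in \<rho> c. x \<notin> {0}" using pos[of c] c by (auto elim!: eventually_mono)
        then have zero: "emeasure (\<rho> c) {0} = 0" using c
          by (subst (asm) AE_iff_measurable[of "{0}"])
            (auto simp: \<rho>_def real_distribution.space_eq_univ[OF d1] real_distribution.events_eq_borel[OF d1])
        have "{x. \<not> isCont h x} \<subseteq> {0}" using h_cont by blast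
        then have "emeasure (\<rho> c) {x. \<not> isCont h x} \<le> emeasure (\<rho> c) {0}"
          by (rule emeasure_mono) (use c in simp)
        then show ?thesis using zero by simp
      qed
      have h_bd: "norm (h x) \<le> \<bar>B\<bar>" for x
        using order_trans[OF B abs_ge_self[of B], of x] by (auto simp: h_def split: split_indicator)
      have "(\<lambda>n. \<integral>x. h x \<partial>\<rho> (X n)) \<longlonglongrightarrow> (\<integral>x. h x \<partial>\<rho> c)"
        by (rule weak_conv_imp_bdd_ae_continuous_conv[OF MX[THEN has_mellin_real_distribution]
              has_mellin_real_distribution[OF Mc] wc disc h_bd h_meas])
      then show "((\<lambda>c. \<integral>x. h x \<partial>\<rho> c) \<circ> X) \<longlonglongrightarrow> (\<integral>x. h x \<partial>\<rho> c)" by (simp add: o_def)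
    qed
    then show "continuous_on {0<..} (\<lambda>c. LINT x:{0<..}|\<rho> c. f x)"
      by (simp add: h_def set_lebesgue_integral_def)
  qed
  then show ?thesis using that \<epsilon> M by blast
qed

section \<open>Semigroups and infinitely divisible distributions\<close>

lemma semigroup_representation_if_mellin:
  assumes pos: "\<And>n. s n > 0" and s0: "s 0 = 1" and \<epsilon>: "0 < \<epsilon>" "\<epsilon> \<le> 1" and sg: "product_convolution_semigroup \<rho>"
    and \<rho>: "\<And>c. c > 0 \<Longrightarrow> has_mellin (\<rho> c) (\<lambda>u. exp (c * g u) / \<epsilon> powr c)"
    and g: "\<And>n. n \<ge> 1 \<Longrightarrow> g (real n) = ln (s n)"
  shows "semigroup_representation s \<epsilon> \<rho>"
  unfolding semigroup_representation_def
proof (intro conjI allI impI \<epsilon> sg)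
  fix n and c :: real assume c: "c > 0"
  define t where "t n = (if n = 0 then 1 else exp (c * g (real n)) / \<epsilon> powr c)" for n :: nat
  have M: "has_stieltjes_moments (\<rho> c) t"
    by (rule has_mellin_imp_stieltjes_moments[OF \<rho>[OF c]]) (auto simp: t_def)
  then have M: "integrable (\<rho> c) (\<lambda>x. x ^ n)" "t n = (\<integral>x. x ^ n \<partial>\<rho> c)" for n
    by (auto simp: has_stieltjes_moments_def)
  show "integrable (\<rho> c) (\<lambda>x. x ^ n)" by (rule M)
  show "s n powr c = (1 - \<epsilon> powr c) * of_bool (n = 0) + \<epsilon> powr c * (\<integral>x. x ^ n \<partial>\<rho> c)"
  proof (cases "n = 0")
    case False
    then have "t n = exp (c * ln (s n)) / \<epsilon> powr c" using g[of n] by (simp add: t_def)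
    then show ?thesis unfolding M(2)[symmetric] using pos[of n] False \<epsilon> by (simp add: powr_def)
  next
    case True
    then show ?thesis using M(2)[of 0] s0 by (simp add: t_def)
  qed
qed

lemma semigroup_representation_moments:
  assumes rep: "semigroup_representation s \<epsilon> \<rho>" and c: "c > 0"
  shows "has_stieltjes_moments (zero_mixture (\<epsilon> powr c) (\<rho> c)) (\<lambda>n. s n powr c)"
    and "prob_space (\<rho> c)" and "sets (\<rho> c) = sets borel" and "AE x in \<rho> c. 0 < x"
proof -
  have \<epsilon>: "0 < \<epsilon>" "\<epsilon> \<le> 1" and eq: "\<And>n. s n powr c = (1 - \<epsilon> powr c) * of_bool (n = 0) + \<epsilon> powr c * (\<integral>x. x ^ n \<partial>\<rho> c)"
    and int: "\<And>n. integrable (\<rho> c) (\<lambda>x. x ^ n)"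
    using rep c by (auto simp: semigroup_representation_def)
  show 1: "prob_space (\<rho> c)" and 2: "sets (\<rho> c) = sets borel" and 3: "AE x in \<rho> c. 0 < x"
    using rep c by (auto simp: semigroup_representation_def product_convolution_semigroup_def borel_measure_on_def)
  have "\<epsilon> powr c \<le> 1" using powr_mono2[of c \<epsilon> 1] \<epsilon> c by simp
  then show "has_stieltjes_moments (zero_mixture (\<epsilon> powr c) (\<rho> c)) (\<lambda>n. s n powr c)"
    unfolding eq using \<epsilon> by (intro has_stieltjes_moments_zero_mixture 2 3 int) auto
qed

text \<open>
  The logarithm turns products into sums.
\<close>

lemma convolution_distr_neg_ln:
  assumes sets: "sets \<alpha> = sets borel" "sets \<beta> = sets borel" and prob: "prob_space \<alpha>" "prob_space \<beta>"
    and pos: "AE x in \<alpha>. 0 < x" "AE x in \<beta>. 0 < x"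
  shows "distr \<alpha> borel (\<lambda>x. - ln x) \<star> distr \<beta> borel (\<lambda>x. - ln x) = distr (\<alpha> \<diamondop> \<beta>) borel (\<lambda>x::real. - ln x)"
proof (rule measure_eqI)
  interpret \<alpha>: prob_space \<alpha> by fact
  interpret \<beta>: prob_space \<beta> by fact
  note [measurable_cong] = sets
  let ?l = "\<lambda>x::real. - ln x"
  fix A assume "A \<in> sets (distr \<alpha> borel ?l \<star> distr \<beta> borel ?l)"
  then have A[measurable]: "A \<in> sets borel" by simp
  have fin: "finite_measure (distr \<alpha> borel ?l)" "finite_measure (distr \<beta> borel ?l)"
    by (auto intro!: \<alpha>.finite_measure_distr \<beta>.finite_measure_distr)
  interpret \<beta>': finite_measure "distr \<beta> borel ?l" by (rule fin)
  have m: "(\<lambda>x. \<integral>\<^sup>+y. indicator A (x + y) \<partial>distr \<beta> borel ?l) \<in> borel_measurable borel" by measurable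
  have "emeasure (distr \<alpha> borel ?l \<star> distr \<beta> borel ?l) A
      = (\<integral>\<^sup>+x. \<integral>\<^sup>+y. indicator A (x + y) \<partial>distr \<beta> borel ?l \<partial>distr \<alpha> borel ?l)"
    by (rule convolution_emeasure'[OF A fin]) auto
  also have "\<dots> = (\<integral>\<^sup>+s. \<integral>\<^sup>+t. indicator A (?l s + ?l t) \<partial>\<beta> \<partial>\<alpha>)"
    using m by (simp add: nn_integral_distr)
  also have "\<dots> = (\<integral>\<^sup>+s. \<integral>\<^sup>+t. indicator A (?l (s * t)) \<partial>\<beta> \<partial>\<alpha>)"
  proof (rule nn_integral_cong_AE)
    show "AE s in \<alpha>. (\<integral>\<^sup>+t. indicator A (?l s + ?l t) \<partial>\<beta>) = (\<integral>\<^sup>+t. indicator A (?l (s * t)) \<partial>\<beta> :: ennreal)"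
      using pos(1)
    proof eventually_elim
      case (elim s)
      show ?case
      proof (rule nn_integral_cong_AE)
        show "AE t in \<beta>. indicator A (?l s + ?l t) = (indicator A (?l (s * t)) :: ennreal)"
          using pos(2)
        proof eventually_elim
          case (elim t)
          with \<open>0 < s\<close> have "?l s + ?l t = ?l (s * t)" by (simp add: ln_mult)
          then show ?case by simp
        qed
      qed
    qed
  qed
  also have "\<dots> = (\<integral>\<^sup>+p. indicator A (?l (case p of (s, t) \<Rightarrow> s * t)) \<partial>(\<alpha> \<Otimes>\<^sub>M \<beta>))"
    by (subst \<beta>.nn_integral_fst[symmetric]) auto
  also have "\<dots> = emeasure (distr (\<alpha> \<diamondop> \<beta>) borel ?l) A"
    unfolding product_convolution_def
    by (subst nn_integral_indicator[symmetric], simp)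
       (simp add: nn_integral_distr del: nn_integral_indicator nn_integral_indicator')
  finally show "emeasure (distr \<alpha> borel ?l \<star> distr \<beta> borel ?l) A = emeasure (distr (\<alpha> \<diamondop> \<beta>) borel ?l) A" .
qed simp

lemma convolution_return_zero:
  assumes sets: "sets \<nu> = sets borel" and fin: "finite_measure \<nu>"
  shows "\<nu> \<star> return borel (0::real) = \<nu>"
proof (rule measure_eqI)
  fix A assume "A \<in> sets (\<nu> \<star> return borel 0)"
  then have A[measurable]: "A \<in> sets borel" by simp
  have "finite_measure (return borel (0::real))"
    by (intro prob_space.finite_measure prob_space_return) simp
  then have "emeasure (\<nu> \<star> return borel 0) A = (\<integral>\<^sup>+x. \<integral>\<^sup>+y. indicator A (x + y) \<partial>return borel 0 \<partial>\<nu>)"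
    using sets fin by (intro convolution_emeasure') auto
  also have "\<dots> = (\<integral>\<^sup>+x. indicator A x \<partial>\<nu>)" by (simp add: nn_integral_return)
  also have "\<dots> = emeasure \<nu> A" by (simp add: sets)
  finally show "emeasure (\<nu> \<star> return borel 0) A = emeasure \<nu> A" .
qed (simp add: sets)

lemma convolution_power_distr_neg_ln:
  assumes sg: "product_convolution_semigroup \<rho>" and d: "d > 0"
  shows "((\<lambda>\<kappa>. distr (\<rho> d) borel (\<lambda>x. - ln x) \<star> \<kappa>) ^^ Suc n) (return borel 0) = distr (\<rho> (real (Suc n) * d)) borel (\<lambda>x. - ln x)"
proof (induction n)
  case 0
  have "prob_space (\<rho> d)" "sets (\<rho> d) = sets borel"
    using sg d by (auto simp: product_convolution_semigroup_def borel_measure_on_def)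
  then have "finite_measure (distr (\<rho> d) borel (\<lambda>x. - ln x))"
    by (intro finite_measure.finite_measure_distr prob_space.finite_measure) (auto cong: measurable_cong_sets)
  then show ?case by (simp add: convolution_return_zero)
next
  case (Suc n)
  have \<rho>: "prob_space (\<rho> c)" "sets (\<rho> c) = sets borel" "AE x in \<rho> c. 0 < x" if "c > 0" for c
    using sg that by (auto simp: product_convolution_semigroup_def borel_measure_on_def)
  have e: "real (Suc n) * d > 0" using d by simp
  have "distr (\<rho> d) borel (\<lambda>x. - ln x) \<star> distr (\<rho> (real (Suc n) * d)) borel (\<lambda>x. - ln x)
      = distr (\<rho> d \<diamondop> \<rho> (real (Suc n) * d)) borel (\<lambda>x. - ln x)"
    by (intro convolution_distr_neg_ln \<rho> d e)
  also have "\<rho> d \<diamondop> \<rho> (real (Suc n) * d) = \<rho> (d + real (Suc n) * d)"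
    using sg d e by (auto simp: product_convolution_semigroup_def)
  also have "d + real (Suc n) * d = real (Suc (Suc n)) * d" by (simp add: algebra_simps)
  finally show ?case using Suc.IH by simp
qed

text \<open>
  The \<open>n\<close>-th convolution root of the image of \<open>\<rho> 1\<close> is the image of \<open>\<rho> (1 / n)\<close>.
\<close>

lemma laplace_representation_if_semigroup:
  assumes rep: "semigroup_representation s \<epsilon> \<rho>" and pos: "\<And>n. s n > 0"
  shows "laplace_representation s \<epsilon> (distr (\<rho> 1) borel (\<lambda>x. - ln x))"
proof -
  let ?\<nu> = "\<lambda>c. distr (\<rho> c) borel (\<lambda>x. - ln x)"
  have \<epsilon>: "0 < \<epsilon>" "\<epsilon> \<le> 1" and sg: "product_convolution_semigroup \<rho>"
    and m: "\<And>n. integrable (\<rho> 1) (\<lambda>x. x ^ n)" "\<And>n. s n powr 1 = (1 - \<epsilon> powr 1) * of_bool (n = 0) + \<epsilon> powr 1 * (\<integral>x. x ^ n \<partial>\<rho> 1)"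
    using rep unfolding semigroup_representation_def by (blast intro: zero_less_one)+
  note R = semigroup_representation_moments(2-4)[OF rep]
  have [measurable_cong]: "sets (\<rho> 1) = sets borel" by (rule R) simp
  have dist: "real_distribution (?\<nu> c)" if "c > 0" for c
  proof -
    have [measurable_cong]: "sets (\<rho> c) = sets borel" by (rule R[OF that])
    show ?thesis by (intro real_distribution.intro prob_space.prob_space_distr R(1)[OF that])
      (auto simp: real_distribution_axioms_def)
  qed
  have "infinitely_divisible (?\<nu> 1)" unfolding infinitely_divisible_def
  proof (intro conjI allI impI dist)
    fix n :: nat assume n: "n \<ge> 1"
    then obtain k where k: "n = Suc k" by (cases n) auto
    have "((\<lambda>\<kappa>. ?\<nu> (1 / n) \<star> \<kappa>) ^^ n) (return borel 0) = ?\<nu> 1"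
      using convolution_power_distr_neg_ln[OF sg, of "1 / n" k] n by (simp add: k)
    then show "\<exists>\<nu>. real_distribution \<nu> \<and> ((\<lambda>\<kappa>. \<nu> \<star> \<kappa>) ^^ n) (return borel 0) = ?\<nu> 1"
      using dist[of "1 / n"] n by auto
  qed simp
  moreover have "integrable (?\<nu> 1) (\<lambda>y. exp (- real n * y)) \<and>
      s n = (1 - \<epsilon>) * of_bool (n = 0) + \<epsilon> * (\<integral>y. exp (- real n * y) \<partial>?\<nu> 1)" for n
  proof -
    have ae: "AE x in \<rho> 1. exp (- real n * - ln x) = x ^ n"
      using R(3)[of 1] by (auto elim!: eventually_mono simp: exp_of_nat_mult)
    have "integrable (\<rho> 1) (\<lambda>x. exp (- real n * - ln x))"
      using m(1)[of n] by (subst integrable_cong_AE[OF _ _ ae]) auto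
    moreover have "(\<integral>y. exp (- real n * y) \<partial>?\<nu> 1) = (\<integral>x. x ^ n \<partial>\<rho> 1)"
      using ae by (subst integral_distr) (auto intro!: integral_cong_AE)
    ultimately show ?thesis using m(2)[of n] pos[of n] \<epsilon> by (simp add: integrable_distr_eq)
  qed
  ultimately show ?thesis using \<epsilon> by (simp add: laplace_representation_def)
qed

lemma real_distribution_convolution:
  assumes "real_distribution \<nu>" "real_distribution \<kappa>" shows "real_distribution (\<nu> \<star> \<kappa>)"
proof -
  interpret \<nu>: real_distribution \<nu> by fact
  interpret \<kappa>: real_distribution \<kappa> by fact
  interpret P: pair_prob_space \<nu> \<kappa> ..
  have "prob_space (\<nu> \<star> \<kappa>)" unfolding convolution_def by (rule P.prob_space_distr) simp
  then show ?thesis by (auto intro!: real_distribution.intro simp: real_distribution_axioms_def)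
qed

lemma convolution_power_laplace:
  assumes \<nu>: "real_distribution \<nu>"
  shows "real_distribution (((\<lambda>\<kappa>. \<nu> \<star> \<kappa>) ^^ k) (return borel 0))"
    and "(\<integral>\<^sup>+y. ennreal (exp (u * y)) \<partial>((\<lambda>\<kappa>. \<nu> \<star> \<kappa>) ^^ k) (return borel 0)) = (\<integral>\<^sup>+y. ennreal (exp (u * y)) \<partial>\<nu>) ^ k"
proof -
  interpret \<nu>: real_distribution \<nu> by fact
  have "real_distribution (((\<lambda>\<kappa>. \<nu> \<star> \<kappa>) ^^ k) (return borel 0)) \<and>
     (\<integral>\<^sup>+y. ennreal (exp (u * y)) \<partial>((\<lambda>\<kappa>. \<nu> \<star> \<kappa>) ^^ k) (return borel 0)) = (\<integral>\<^sup>+y. ennreal (exp (u * y)) \<partial>\<nu>) ^ k"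
  proof (induction k)
    case 0
    show ?case by (auto intro!: real_distribution.intro prob_space_return simp: real_distribution_axioms_def nn_integral_return)
  next
    case (Suc k)
    let ?K = "((\<lambda>\<kappa>. \<nu> \<star> \<kappa>) ^^ k) (return borel 0)"
    interpret K: real_distribution ?K using Suc by simp
    have d: "real_distribution (\<nu> \<star> ?K)" using \<nu> Suc by (simp add: real_distribution_convolution)
    have "(\<integral>\<^sup>+y. ennreal (exp (u * y)) \<partial>(\<nu> \<star> ?K)) = (\<integral>\<^sup>+x. \<integral>\<^sup>+y. ennreal (exp (u * (x + y))) \<partial>?K \<partial>\<nu>)"
      by (rule nn_integral_convolution) (auto simp: \<nu>.finite_measure_axioms K.finite_measure_axioms)
    also have "\<dots> = (\<integral>\<^sup>+x. \<integral>\<^sup>+y. ennreal (exp (u * x)) * ennreal (exp (u * y)) \<partial>?K \<partial>\<nu>)"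
      by (simp add: distrib_left exp_add ennreal_mult)
    also have "\<dots> = (\<integral>\<^sup>+x. ennreal (exp (u * x)) \<partial>\<nu>) * (\<integral>\<^sup>+y. ennreal (exp (u * y)) \<partial>?K)"
      by (simp add: nn_integral_cmult nn_integral_multc)
    finally show ?case using Suc d by simp
  qed
  then show "real_distribution (((\<lambda>\<kappa>. \<nu> \<star> \<kappa>) ^^ k) (return borel 0))"
    and "(\<integral>\<^sup>+y. ennreal (exp (u * y)) \<partial>((\<lambda>\<kappa>. \<nu> \<star> \<kappa>) ^^ k) (return borel 0)) = (\<integral>\<^sup>+y. ennreal (exp (u * y)) \<partial>\<nu>) ^ k" by auto
qed

text \<open>
  The image \<open>\<kappa>\<close> of a \<open>k\<close>-th convolution root of \<open>\<omega>\<close> under \<open>exp (- y)\<close>, mixed with an atom at \<open>0\<close>, represents the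
  \<open>k\<close>-th root of the sequence. The last conclusion lets \<open>\<omega>\<close> be recovered from \<open>\<kappa>\<close>.
\<close>

lemma laplace_representation_root:
  fixes k :: nat
  assumes rep: "laplace_representation s \<epsilon> \<omega>" and pos: "\<And>n. s n > 0" and k: "k \<ge> 1"
  obtains \<kappa> where "prob_space \<kappa>" "sets \<kappa> = sets borel" "AE x in \<kappa>. 0 < x"
    "has_stieltjes_moments (zero_mixture (\<epsilon> powr (1 / k)) \<kappa>) (\<lambda>n. s n powr (1 / k))"
    "\<omega> = ((\<lambda>\<eta>. distr \<kappa> borel (\<lambda>x. - ln x) \<star> \<eta>) ^^ k) (return borel 0)"
proof -
  have \<epsilon>: "0 < \<epsilon>" "\<epsilon> \<le> 1" and id: "infinitely_divisible \<omega>"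
    and int: "\<And>n. integrable \<omega> (\<lambda>y. exp (- real n * y))"
    and eq: "\<And>n. s n = (1 - \<epsilon>) * of_bool (n = 0) + \<epsilon> * (\<integral>y. exp (- real n * y) \<partial>\<omega>)"
    using rep by (auto simp: laplace_representation_def)
  from id k obtain \<nu> where \<nu>: "real_distribution \<nu>" and pow: "((\<lambda>\<kappa>. \<nu> \<star> \<kappa>) ^^ k) (return borel 0) = \<omega>"
    by (auto simp: infinitely_divisible_def)
  interpret \<nu>: real_distribution \<nu> by fact
  have root: "integrable \<nu> (\<lambda>y. exp (- real n * y)) \<and> (\<integral>y. exp (- real n * y) \<partial>\<nu>) ^ k = (\<integral>y. exp (- real n * y) \<partial>\<omega>)" for n
  proof -
    have "(\<integral>\<^sup>+y. ennreal (exp (- real n * y)) \<partial>\<nu>) ^ k = (\<integral>\<^sup>+y. ennreal (exp (- real n * y)) \<partial>\<omega>)"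
      using convolution_power_laplace(2)[OF \<nu>, where u = "- real n" and k = k] pow by simp
    also have "\<dots> = ennreal (\<integral>y. exp (- real n * y) \<partial>\<omega>)" by (rule nn_integral_eq_integral[OF int]) simp
    finally have p: "(\<integral>\<^sup>+y. ennreal (exp (- real n * y)) \<partial>\<nu>) ^ k = ennreal (\<integral>y. exp (- real n * y) \<partial>\<omega>)" .
    then have "(\<integral>\<^sup>+y. ennreal (exp (- real n * y)) \<partial>\<nu>) ^ k \<noteq> top" by simp
    then have "(\<integral>\<^sup>+y. ennreal (exp (- real n * y)) \<partial>\<nu>) < \<infinity>"
      using k by (simp add: power_eq_top_ennreal top.not_eq_extremum del: minus_mult_left)
    then have i: "integrable \<nu> (\<lambda>y. exp (- real n * y))" by (intro integrableI_nonneg) auto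
    have "ennreal ((\<integral>y. exp (- real n * y) \<partial>\<nu>) ^ k) = ennreal (\<integral>y. exp (- real n * y) \<partial>\<omega>)"
      using p nn_integral_eq_integral[OF i] by (simp add: ennreal_power)
    then show ?thesis using i by simp
  qed
  define \<kappa> where "\<kappa> = distr \<nu> borel (\<lambda>y. exp (- y))"
  have 1: "prob_space \<kappa>" unfolding \<kappa>_def by (rule \<nu>.prob_space_distr) simp
  have 2: "sets \<kappa> = sets borel" by (simp add: \<kappa>_def)
  have 3: "AE x in \<kappa>. 0 < x" unfolding \<kappa>_def by (subst AE_distr_iff) auto
  have pw: "exp (- y) ^ n = exp (- real n * y)" for n and y :: real by (simp flip: exp_of_nat_mult)
  have 4: "integrable \<kappa> (\<lambda>x. x ^ n)" "(\<integral>x. x ^ n \<partial>\<kappa>) = (\<integral>y. exp (- real n * y) \<partial>\<nu>)" for n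
    unfolding \<kappa>_def using root[of n] by (auto simp: integrable_distr_eq integral_distr pw simp del: exp_minus)
  have \<epsilon>1: "\<epsilon> powr (1 / k) \<le> 1" using powr_mono2[of "1 / k" \<epsilon> 1] \<epsilon> by simp
  have 5: "s n powr (1 / k) = (1 - \<epsilon> powr (1 / k)) * of_bool (n = 0) + \<epsilon> powr (1 / k) * (\<integral>x. x ^ n \<partial>\<kappa>)" for n
  proof (cases "n = 0")
    case True
    interpret \<omega>: real_distribution \<omega> using id by (simp add: infinitely_divisible_def)
    have "s 0 = 1" using eq[of 0] \<omega>.prob_space by simp
    then show ?thesis using True prob_space.prob_space[OF 1] by simp
  next
    case False
    let ?I = "\<integral>y. exp (- real n * y) \<partial>\<nu>"
    have "?I \<ge> 0" by simp
    moreover have "s n = \<epsilon> * ?I ^ k" using eq[of n] root[of n] False by simp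
    ultimately have "s n powr (1 / k) = \<epsilon> powr (1 / k) * ?I"
      using k \<epsilon> by (simp add: powr_mult powr_powr flip: powr_realpow')
    then show ?thesis using False 4(2)[of n] by simp
  qed
  have "distr \<kappa> borel (\<lambda>x. - ln x) = distr \<nu> borel (\<lambda>y. y)"
    unfolding \<kappa>_def by (subst distr_distr) (auto simp: o_def)
  also have "\<dots> = \<nu>" by (rule distr_id2) simp
  finally have 6: "\<omega> = ((\<lambda>\<eta>. distr \<kappa> borel (\<lambda>x. - ln x) \<star> \<eta>) ^^ k) (return borel 0)" using pow by simp
  have "has_stieltjes_moments (zero_mixture (\<epsilon> powr (1 / k)) \<kappa>) (\<lambda>n. s n powr (1 / k))"
    unfolding 5 using \<epsilon> by (intro has_stieltjes_moments_zero_mixture 2 3 4 \<epsilon>1) simp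
  with 1 2 3 6 show ?thesis using that by blast
qed

section \<open>Determinacy\<close>

text \<open>
  One positive real moment excludes the unit mass at \<open>0\<close>, and then all real moments are positive. This is what allows
  cancellation.
\<close>

lemma has_mellin_pos:
  assumes \<nu>: "has_mellin \<nu> G" and G1: "G v > 0" and v: "v > 0" and u: "u > 0"
  shows "G u > 0"
proof (rule ccontr)
  assume "\<not> G u > 0"
  then have "(\<integral>x. \<bar>x\<bar> powr u \<partial>\<nu>) = 0" using has_mellin_nonneg[OF \<nu> u] has_mellin_integral[OF \<nu> u] by simp
  then have "AE x in \<nu>. \<bar>x\<bar> powr u = 0"
    using has_mellin_integrable[OF \<nu> u] by (subst (asm) integral_nonneg_eq_0_iff_AE) auto
  then have "AE x in \<nu>. \<bar>x\<bar> powr v = 0" by eventually_elim auto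
  then have "(\<integral>x. \<bar>x\<bar> powr v \<partial>\<nu>) = 0" by (rule integral_eq_zero_AE)
  then show False using has_mellin_integral[OF \<nu> v] G1 by simp
qed

lemma product_convolution_cancel:
  assumes \<mu>: "has_mellin \<mu> F" and \<mu>': "has_mellin \<mu>' F'" and \<nu>: "has_mellin \<nu> G"
    and G1: "G 1 > 0" and eq: "\<mu> \<diamondop> \<nu> = \<mu>' \<diamondop> \<nu>"
  shows "\<mu> = \<mu>'"
proof (rule has_mellin_unique[OF \<mu> \<mu>'])
  fix u :: real assume u: "u > 0"
  have "F u * G u = F' u * G u"
    using has_mellin_integral[OF has_mellin_product_convolution[OF \<mu> \<nu>] u]
      has_mellin_integral[OF has_mellin_product_convolution[OF \<mu>' \<nu>] u] eq by metis
  then show "F u = F' u" using less_imp_neq[OF has_mellin_pos[OF \<nu> G1 zero_less_one u]] by simp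
qed

lemma stieltjes_moments_product_convolution:
  assumes \<mu>: "has_mellin \<mu> F" and \<nu>: "has_mellin \<nu> G" and s: "s 0 = 1" "\<And>n. n \<ge> 1 \<Longrightarrow> s n = F (real n) * G (real n)"
  shows "has_stieltjes_moments (\<mu> \<diamondop> \<nu>) s"
  by (rule has_mellin_imp_stieltjes_moments[OF has_mellin_product_convolution[OF \<mu> \<nu>]]) (use s in auto)

lemma S_determinate_unique:
  "S_determinate s \<Longrightarrow> has_stieltjes_moments \<mu> s \<Longrightarrow> has_stieltjes_moments \<mu>' s \<Longrightarrow> \<mu> = \<mu>'"
  unfolding S_determinate_def by blast

lemma nn_integral_geometric_int_finite:
  assumes q: "0 \<le> q" "q < (1::real)"
  shows "(\<integral>\<^sup>+k. ennreal (q ^ nat \<bar>k\<bar>) \<partial>count_space (UNIV :: int set)) < \<infinity>"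
proof -
  have geo: "(\<Sum>n. ennreal (q ^ n)) < \<infinity>"
    using q by (subst suminf_ennreal2) (auto intro: summable_geometric)
  let ?f = "\<lambda>k::int. ennreal (q ^ nat \<bar>k\<bar>)"
  have "(\<integral>\<^sup>+k. ?f k \<partial>count_space UNIV)
      \<le> (\<integral>\<^sup>+k. ?f k * indicator {0..} k + ?f k * indicator {..0} k \<partial>count_space UNIV)"
    by (rule nn_integral_mono) (auto split: split_indicator)
  also have "\<dots> = (\<integral>\<^sup>+k. ?f k \<partial>count_space {0..}) + (\<integral>\<^sup>+k. ?f k \<partial>count_space {..0})"
    by (simp add: nn_integral_add nn_integral_count_space_indicator)
  also have "(\<integral>\<^sup>+k. ?f k \<partial>count_space {0..}) = (\<integral>\<^sup>+n. ?f (int n) \<partial>count_space UNIV)"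
    by (rule nn_integral_bij_count_space[symmetric], rule bij_betw_byWitness[where f'=nat]) auto
  also have "(\<integral>\<^sup>+k. ?f k \<partial>count_space {..0}) = (\<integral>\<^sup>+n. ?f (- int n) \<partial>count_space UNIV)"
    by (rule nn_integral_bij_count_space[symmetric], rule bij_betw_byWitness[where f'="\<lambda>k. nat (- k)"]) auto
  finally have "(\<integral>\<^sup>+k. ?f k \<partial>count_space UNIV) \<le> (\<Sum>n. ennreal (q ^ n)) + (\<Sum>n. ennreal (q ^ n))"
    by (simp only: nn_integral_count_space_nat abs_minus_cancel abs_of_nat nat_int)
  also have "\<dots> < \<infinity>" using geo by simp
  finally show ?thesis .
qed

text \<open>
  With \<open>q = exp \<beta>\<close> the measure below puts mass \<open>q powr (- k\<^sup>2 - a k)\<close> at \<open>q powr (2 k + a)\<close> for each integer \<open>k\<close>; its total mass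
  is a theta series. It is a discrete relative of the lognormal distribution, and the shift \<open>a\<close> moves the support without
  changing the normalized moments.
\<close>

definition theta_weight :: "real \<Rightarrow> int \<Rightarrow> int \<Rightarrow> real" where
  "theta_weight \<beta> a k = exp (- \<beta> * real_of_int (k * k + a * k))"

definition theta_measure :: "real \<Rightarrow> int \<Rightarrow> real measure" where
  "theta_measure \<beta> a = distr (density (count_space UNIV) (\<lambda>k. ennreal (theta_weight \<beta> a k))) borel
     (\<lambda>k. exp (\<beta> * real_of_int (2 * k + a)))"

lemma nn_integral_theta_measure:
  assumes [measurable]: "f \<in> borel_measurable borel"
  shows "nn_integral (theta_measure \<beta> a) f
    = (\<integral>\<^sup>+k. ennreal (theta_weight \<beta> a k) * f (exp (\<beta> * real_of_int (2 * k + a))) \<partial>count_space UNIV)"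
  unfolding theta_measure_def by (subst nn_integral_distr) (auto simp: nn_integral_density)

text \<open>
  Completing the square: \<open>- k\<^sup>2 - a k + n (2 k + a) = n\<^sup>2 - (k - n)\<^sup>2 - a (k - n)\<close>, and the sum over all integers does not
  see the shift by \<open>n\<close>.
\<close>

lemma theta_measure_moment:
  "(\<integral>\<^sup>+x. ennreal (x ^ n) \<partial>theta_measure \<beta> a) = ennreal (exp (\<beta> * (real n)\<^sup>2)) * (\<integral>\<^sup>+x. 1 \<partial>theta_measure \<beta> a)"
proof -
  have shift: "theta_weight \<beta> a k * exp (\<beta> * real_of_int (2 * k + a)) ^ n
      = exp (\<beta> * (real n)\<^sup>2) * theta_weight \<beta> a (k - int n)" for k
  proof -
    have "- \<beta> * real_of_int (k * k + a * k) + real n * (\<beta> * real_of_int (2 * k + a))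
        = \<beta> * (real n)\<^sup>2 + - \<beta> * real_of_int ((k - int n) * (k - int n) + a * (k - int n))"
      by (simp add: power2_eq_square algebra_simps)
    then show ?thesis unfolding theta_weight_def by (simp only: exp_of_nat_mult[symmetric] exp_add[symmetric])
  qed
  have nn: "theta_weight \<beta> a k \<ge> 0" for k by (simp add: theta_weight_def)
  have pt: "ennreal (theta_weight \<beta> a k) * ennreal (exp (\<beta> * real_of_int (2 * k + a)) ^ n)
      = ennreal (exp (\<beta> * (real n)\<^sup>2)) * ennreal (theta_weight \<beta> a (k - int n))" for k
    by (simp only: ennreal_mult[symmetric] nn zero_le_power exp_ge_zero shift)
  have "(\<integral>\<^sup>+x. ennreal (x ^ n) \<partial>theta_measure \<beta> a)
      = (\<integral>\<^sup>+k. ennreal (theta_weight \<beta> a k) * ennreal (exp (\<beta> * real_of_int (2 * k + a)) ^ n) \<partial>count_space UNIV)"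
    by (rule nn_integral_theta_measure) simp
  also have "\<dots> = (\<integral>\<^sup>+k. ennreal (exp (\<beta> * (real n)\<^sup>2)) * ennreal (theta_weight \<beta> a (k - int n)) \<partial>count_space UNIV)"
    by (simp only: pt)
  also have "\<dots> = ennreal (exp (\<beta> * (real n)\<^sup>2)) * (\<integral>\<^sup>+k. ennreal (theta_weight \<beta> a (k - int n)) \<partial>count_space UNIV)"
    by (rule nn_integral_cmult) simp
  also have "(\<integral>\<^sup>+k. ennreal (theta_weight \<beta> a (k - int n)) \<partial>count_space UNIV) = (\<integral>\<^sup>+k. ennreal (theta_weight \<beta> a k) \<partial>count_space UNIV)"
    by (rule nn_integral_bij_count_space, rule bij_betw_byWitness[where f'="\<lambda>k. k + int n"]) auto
  finally show ?thesis by (subst (2) nn_integral_theta_measure) auto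
qed

lemma theta_measure_mass:
  assumes \<beta>: "\<beta> > 0" and a: "a = 0 \<or> a = 1"
  shows "(\<integral>\<^sup>+x. 1 \<partial>theta_measure \<beta> a) < \<infinity>" and "(\<integral>\<^sup>+x. 1 \<partial>theta_measure \<beta> a) \<noteq> 0"
proof -
  have "theta_weight \<beta> a k \<le> exp \<beta> * exp (- \<beta>) ^ nat \<bar>k\<bar>" for k
  proof -
    have "\<bar>k\<bar> - 1 \<le> k * k + a * k"
    proof (cases "k \<ge> 0")
      case True
      have "0 \<le> (k - 1) * (k - 1)" by simp
      then have "k \<le> k * k + 1" using True by (simp add: algebra_simps)
      then show ?thesis using True a by auto
    next
      case False
      have "0 \<le> (k + 1) * (k + 1)" by simp
      then show ?thesis using False a mult_nonpos_nonpos[of k "k + 1"] by (auto simp: algebra_simps)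
    qed
    then have "real_of_int (\<bar>k\<bar> - 1) \<le> real_of_int (k * k + a * k)" by (simp only: of_int_le_iff)
    then have "\<beta> * real_of_int (\<bar>k\<bar> - 1) \<le> \<beta> * real_of_int (k * k + a * k)" using \<beta> by (intro mult_left_mono) auto
    then have "theta_weight \<beta> a k \<le> exp (\<beta> + real (nat \<bar>k\<bar>) * (- \<beta>))"
      by (simp add: theta_weight_def algebra_simps)
    then show ?thesis by (simp only: exp_add exp_of_nat_mult)
  qed
  then have "(\<integral>\<^sup>+k. ennreal (theta_weight \<beta> a k) \<partial>count_space UNIV)
      \<le> (\<integral>\<^sup>+k. ennreal (exp \<beta>) * ennreal (exp (- \<beta>) ^ nat \<bar>k\<bar>) \<partial>count_space UNIV)"
    by (intro nn_integral_mono) (simp add: ennreal_mult[symmetric] ennreal_leI)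
  also have "\<dots> = ennreal (exp \<beta>) * (\<integral>\<^sup>+k. ennreal (exp (- \<beta>) ^ nat \<bar>k\<bar>) \<partial>count_space (UNIV :: int set))"
    by (rule nn_integral_cmult) simp
  also have "\<dots> < \<infinity>" using nn_integral_geometric_int_finite[of "exp (- \<beta>)"] \<beta> by (simp add: ennreal_mult_less_top)
  finally show "(\<integral>\<^sup>+x. 1 \<partial>theta_measure \<beta> a) < \<infinity>" by (subst nn_integral_theta_measure) auto
  show "(\<integral>\<^sup>+x. 1 \<partial>theta_measure \<beta> a) \<noteq> 0"
    by (subst nn_integral_theta_measure)
      (auto simp: nn_integral_0_iff_AE AE_count_space theta_weight_def)
qed

text \<open>
  The supports for \<open>a = 0\<close> (even powers) and \<open>a = 1\<close> (odd powers) are disjoint; the point \<open>1\<close> belongs to the first only.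
\<close>

lemma exp_square_indeterminate:
  assumes \<beta>: "\<beta> > 0"
  obtains \<mu> \<mu>' where "\<mu> \<noteq> \<mu>'" "has_stieltjes_moments \<mu> (\<lambda>n. exp (\<beta> * (real n)\<^sup>2))"
    "has_stieltjes_moments \<mu>' (\<lambda>n. exp (\<beta> * (real n)\<^sup>2))"
proof -
  define W where "W a = enn2real (\<integral>\<^sup>+x. 1 \<partial>theta_measure \<beta> a)" for a
  have W: "(\<integral>\<^sup>+x. 1 \<partial>theta_measure \<beta> a) = ennreal (W a)" "W a > 0" if "a = 0 \<or> a = 1" for a
    using theta_measure_mass[OF \<beta> that] by (auto simp: W_def enn2real_positive_iff zero_less_iff_neq_zero)
  let ?M = "\<lambda>a. density (theta_measure \<beta> a) (\<lambda>_. ennreal (1 / W a))"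
  have mom: "has_stieltjes_moments (?M a) (\<lambda>n. exp (\<beta> * (real n)\<^sup>2))" if a: "a = 0 \<or> a = 1" for a
  proof -
    have "has_stieltjes_moments (theta_measure \<beta> a) (\<lambda>n. W a * exp (\<beta> * (real n)\<^sup>2))"
      unfolding has_stieltjes_moments_def borel_measure_on_def
    proof (intro conjI allI)
      show ae: "AE x in theta_measure \<beta> a. x \<in> {0..}" unfolding theta_measure_def by (subst AE_distr_iff) auto
      fix n
      have "(\<integral>\<^sup>+x. ennreal (x ^ n) \<partial>theta_measure \<beta> a) = ennreal (W a * exp (\<beta> * (real n)\<^sup>2))"
        using W[OF a] by (simp add: theta_measure_moment mult.commute ennreal_mult)
      then have "integrable (theta_measure \<beta> a) (\<lambda>x. x ^ n) \<and> (\<integral>x. x ^ n \<partial>theta_measure \<beta> a) = W a * exp (\<beta> * (real n)\<^sup>2)"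
        using W(2)[OF a] ae by (subst (asm) nn_integral_eq_integrable) (auto simp: theta_measure_def elim!: eventually_mono)
      then show "integrable (theta_measure \<beta> a) (\<lambda>x. x ^ n)" "W a * exp (\<beta> * (real n)\<^sup>2) = (\<integral>x. x ^ n \<partial>theta_measure \<beta> a)" by auto
    qed (simp add: theta_measure_def)
    from has_stieltjes_moments_scale[OF this, of "1 / W a"] show ?thesis using W(2)[OF a] by simp
  qed
  have at1: "emeasure (?M a) {1} = ennreal (1 / W a) *
      (\<integral>\<^sup>+k. ennreal (theta_weight \<beta> a k) * indicator {1} (exp (\<beta> * real_of_int (2 * k + a))) \<partial>count_space UNIV)" for a
  proof -
    have [measurable_cong]: "sets (theta_measure \<beta> a) = sets borel" by (simp add: theta_measure_def)
    have "emeasure (?M a) {1} = (\<integral>\<^sup>+x. ennreal (1 / W a) * indicator {1} x \<partial>theta_measure \<beta> a)"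
      by (rule emeasure_density) (auto simp: theta_measure_def)
    also have "\<dots> = ennreal (1 / W a) * (\<integral>\<^sup>+x. indicator {1} x \<partial>theta_measure \<beta> a)"
      by (rule nn_integral_cmult) measurable
    also have "(\<integral>\<^sup>+x. indicator {1} x \<partial>theta_measure \<beta> a)
        = (\<integral>\<^sup>+k. ennreal (theta_weight \<beta> a k) * indicator {1} (exp (\<beta> * real_of_int (2 * k + a))) \<partial>count_space UNIV)"
      by (rule nn_integral_theta_measure) simp
    finally show ?thesis .
  qed
  have "emeasure (?M 1) {1} = 0"
  proof -
    have "2 * k + 1 \<noteq> (0::int)" for k by presburger
    then have "real_of_int (2 * k + 1) \<noteq> 0" for k by (simp only: of_int_eq_0_iff) blast
    then have "exp (\<beta> * real_of_int (2 * k + 1)) \<noteq> 1" for k using \<beta> by simp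
    then have "indicator {1} (exp (\<beta> * real_of_int (2 * k + 1))) = (0 :: ennreal)" for k
      by (metis indicator_simps(2) singletonD)
    then show ?thesis unfolding at1 by (simp only: mult_zero_right nn_integral_const) simp
  qed
  moreover have "emeasure (?M 0) {1} \<noteq> 0"
  proof
    assume "emeasure (?M 0) {1} = 0"
    then have "(\<integral>\<^sup>+k. ennreal (theta_weight \<beta> 0 k) * indicator {1} (exp (\<beta> * real_of_int (2 * k + 0))) \<partial>count_space UNIV) = 0"
      unfolding at1 using W(2)[of 0] by simp
    then have "ennreal (theta_weight \<beta> 0 0) * indicator {1} (exp (\<beta> * real_of_int (2 * 0 + 0))) = 0"
      by (subst (asm) nn_integral_0_iff_AE) (auto simp: AE_count_space)
    then show False by (simp add: theta_weight_def)
  qed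
  ultimately have "?M 0 \<noteq> ?M 1" by metis
  then show ?thesis using that mom[of 0] mom[of 1] by blast
qed

text \<open>
  Two measures for the power \<open>c\<close> give, after product convolution with a measure for the power \<open>c\<^sub>0 - c\<close>, two measures for the
  power \<open>c\<^sub>0\<close>. These coincide, and the common factor cancels.
\<close>

lemma S_determinate_smaller_power:
  assumes pos: "\<And>n. s n > 0" and s0: "s 0 = 1"
    and powers: "\<And>c. c > 0 \<Longrightarrow> stieltjes_moment_seq (\<lambda>n. s n powr c)"
    and det: "S_determinate (\<lambda>n. s n powr c\<^sub>0)" and c: "0 < c" "c \<le> c\<^sub>0"
    and \<mu>: "has_stieltjes_moments \<mu> (\<lambda>n. s n powr c)" and \<mu>': "has_stieltjes_moments \<mu>' (\<lambda>n. s n powr c)"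
  shows "\<mu> = \<mu>'"
proof (cases "c = c\<^sub>0")
  case True
  then show ?thesis using S_determinate_unique[OF det] \<mu> \<mu>' by simp
next
  case False
  then obtain \<nu> where \<nu>: "has_stieltjes_moments \<nu> (\<lambda>n. s n powr (c\<^sub>0 - c))"
    using powers[of "c\<^sub>0 - c"] c by (auto simp: stieltjes_moment_seq_def)
  obtain F where F: "has_mellin \<mu> F" "\<And>n. n \<ge> 1 \<Longrightarrow> F (real n) = s n powr c"
    using stieltjes_moments_imp_has_mellin[OF \<mu>] s0 by auto
  obtain F' where F': "has_mellin \<mu>' F'" "\<And>n. n \<ge> 1 \<Longrightarrow> F' (real n) = s n powr c"
    using stieltjes_moments_imp_has_mellin[OF \<mu>'] s0 by auto
  obtain G where G: "has_mellin \<nu> G" "\<And>n. n \<ge> 1 \<Longrightarrow> G (real n) = s n powr (c\<^sub>0 - c)"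
    using stieltjes_moments_imp_has_mellin[OF \<nu>] s0 by auto
  have p: "s n powr c\<^sub>0 = s n powr c * s n powr (c\<^sub>0 - c)" for n by (simp flip: powr_add)
  have "\<mu> \<diamondop> \<nu> = \<mu>' \<diamondop> \<nu>"
    by (rule S_determinate_unique[OF det]; rule stieltjes_moments_product_convolution[OF _ G(1)])
       (rule F F' | simp add: s0 | simp only: F F' G p)+
  then show ?thesis
    by (rule product_convolution_cancel[OF F(1) F'(1) G(1), rotated]) (use G(2)[of 1] pos[of 1] in simp)
qed

text \<open>
  Both measures lead to a probability with the moments \<open>s n powr c\<^sub>0\<close>. By determinacy it is the same one, so the
  exponents agree for every real \<open>u > 0\<close>, and their second differences are the real moments of the two measures.
\<close>

lemma levy_moment_measure_unique:
  assumes pos: "\<And>n. s n > 0" and s0: "s 0 = 1" and c0: "c\<^sub>0 > 0" and det: "S_determinate (\<lambda>n. s n powr c\<^sub>0)"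
    and \<tau>: "has_stieltjes_moments \<tau> (log_second_diff s)" and \<tau>': "has_stieltjes_moments \<tau>' (log_second_diff s)"
  shows "\<tau> = \<tau>'"
proof -
  obtain \<mu> where \<mu>: "has_mellin \<mu> (\<lambda>u. exp (c\<^sub>0 * levy_exponent s \<tau> u))"
    using levy_exponent_has_mellin[OF \<tau> c0] by blast
  obtain \<mu>' where \<mu>': "has_mellin \<mu>' (\<lambda>u. exp (c\<^sub>0 * levy_exponent s \<tau>' u))"
    using levy_exponent_has_mellin[OF \<tau>' c0] by blast
  have "\<mu> = \<mu>'"
    by (rule S_determinate_unique[OF det levy_exponent_moments[OF pos s0 \<tau> \<mu>] levy_exponent_moments[OF pos s0 \<tau>' \<mu>']])
  then have g: "levy_exponent s \<tau> u = levy_exponent s \<tau>' u" if "u > 0" for u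
    using has_mellin_integral[OF \<mu> that] has_mellin_integral[OF \<mu>' that] c0 by simp
  have diff: "(\<integral>x. \<bar>x\<bar> powr u \<partial>T) = levy_exponent s T (u + 2) - 2 * levy_exponent s T (u + 1) + levy_exponent s T u"
    if T: "has_stieltjes_moments T (log_second_diff s)" and u: "u > 0" for T u
  proof -
    have [measurable_cong]: "sets T = sets borel" and nn: "AE x in T. 0 \<le> x"
      using T by (auto simp: has_stieltjes_moments_def borel_measure_on_def)
    have "(\<integral>x. \<bar>x\<bar> powr u \<partial>T) = (\<integral>x. levy_kernel (u + 2) x - 2 * levy_kernel (u + 1) x + levy_kernel u x \<partial>T)"
      by (rule integral_cong_AE) (use nn u in \<open>auto elim!: eventually_mono simp: levy_kernel_second_difference\<close>)
    then show ?thesis using integrable_levy_kernel[OF T] u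
      by (simp add: levy_exponent_def algebra_simps)
  qed
  show ?thesis
  proof (rule finite_measure_mellin_unique)
    show "finite_measure \<tau>" "finite_measure \<tau>'" using \<tau> \<tau>' by (auto intro: has_stieltjes_moments_finite_measure)
    show s: "sets \<tau> = sets borel" "sets \<tau>' = sets borel" and "AE x in \<tau>. 0 \<le> x" "AE x in \<tau>'. 0 \<le> x"
      using \<tau> \<tau>' by (auto simp: has_stieltjes_moments_def borel_measure_on_def)
    fix u :: real assume u: "u > 0"
    show "integrable \<tau> (\<lambda>x. \<bar>x\<bar> powr u)" "integrable \<tau>' (\<lambda>x. \<bar>x\<bar> powr u)"
      using \<tau> \<tau>' u by (auto intro: has_stieltjes_moments_integrable_powr)
    show "(\<integral>x. \<bar>x\<bar> powr u \<partial>\<tau>) = (\<integral>x. \<bar>x\<bar> powr u \<partial>\<tau>')"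
      using diff[OF \<tau> u] diff[OF \<tau>' u] g[of u] g[of "u + 1"] g[of "u + 2"] u by simp
  next
    have "measure T UNIV = log_second_diff s 0" if T: "has_stieltjes_moments T (log_second_diff s)" for T
    proof -
      have "sets T = sets borel" "log_second_diff s 0 = (\<integral>x. x ^ 0 \<partial>T)"
        using T unfolding has_stieltjes_moments_def borel_measure_on_def by blast+
      then show ?thesis by (auto dest: sets_eq_imp_space_eq)
    qed
    then show "measure \<tau> UNIV = measure \<tau>' UNIV" using \<tau> \<tau>' by simp
  qed
qed

text \<open>
  An atom of mass \<open>m\<close> at \<open>1\<close> contributes \<open>m * n * (n - 1) / 2\<close> to \<open>ln (s n)\<close>. Its quadratic part is a factor
  \<open>exp (\<beta> * n\<^sup>2)\<close> of \<open>s n powr c\<^sub>0\<close> with \<open>\<beta> = c\<^sub>0 * m / 2\<close>; the linear part goes into the drift of the cofactor. The first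
  factor has two representing measures, and cancellation of the cofactor contradicts determinacy.
\<close>

lemma levy_moment_measure_no_atom:
  assumes pos: "\<And>n. s n > 0" and s0: "s 0 = 1" and c0: "c\<^sub>0 > 0" and det: "S_determinate (\<lambda>n. s n powr c\<^sub>0)"
    and \<tau>: "has_stieltjes_moments \<tau> (log_second_diff s)"
  shows "measure \<tau> {1} = 0"
proof (rule ccontr)
  assume "measure \<tau> {1} \<noteq> 0"
  define m where "m = measure \<tau> {1}"
  define \<beta> where "\<beta> = c\<^sub>0 * m / 2"
  have m: "m > 0" using \<open>measure \<tau> {1} \<noteq> 0\<close> by (simp add: m_def zero_less_measure_iff)
  then have \<beta>: "\<beta> > 0" using c0 by (simp add: \<beta>_def)
  interpret finite_measure \<tau> using \<tau> by (rule has_stieltjes_moments_finite_measure)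
  have sets[measurable_cong]: "sets \<tau> = sets borel" and nn: "AE x in \<tau>. 0 \<le> x"
    and mom: "\<And>n. integrable \<tau> (\<lambda>x. x ^ n)"
    using \<tau> by (auto simp: has_stieltjes_moments_def borel_measure_on_def)
  have sp[simp]: "space \<tau> = UNIV" using sets by (auto dest: sets_eq_imp_space_eq)
  \<comment> \<open>the Levy data of the cofactor: the atom is removed, and the factor \<open>c\<^sub>0\<close> takes the power\<close>
  define \<tau>' where "\<tau>' = density \<tau> (\<lambda>x. ennreal (c\<^sub>0 * indicator (- {1}) x))"
  have int: "integrable \<tau>' f" "(\<integral>x. f x \<partial>\<tau>') = c\<^sub>0 * (\<integral>x. f x \<partial>\<tau>) - c\<^sub>0 * m * f 1"
    if f: "integrable \<tau> f" for f :: "real \<Rightarrow> real"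
  proof -
    have [measurable]: "f \<in> borel_measurable borel" using f sets by (auto cong: measurable_cong_sets)
    have eq: "c\<^sub>0 * indicator (- {1}) x * f x = c\<^sub>0 * f x - c\<^sub>0 * f 1 * indicator {1} x" for x
      by (auto split: split_indicator)
    have i: "integrable \<tau> (\<lambda>x. c\<^sub>0 * f x - c\<^sub>0 * f 1 * indicator {1} x)"
      using f by (simp add: emeasure_eq_measure)
    show "integrable \<tau>' f" unfolding \<tau>'_def using i c0 by (subst integrable_density) (auto simp: eq)
    have "(\<integral>x. f x \<partial>\<tau>') = (\<integral>x. c\<^sub>0 * f x - c\<^sub>0 * f 1 * indicator {1} x \<partial>\<tau>)"
      unfolding \<tau>'_def using c0 by (subst integral_density) (auto simp: eq)
    also have "\<dots> = c\<^sub>0 * (\<integral>x. f x \<partial>\<tau>) - c\<^sub>0 * m * f 1"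
      using f by (simp add: emeasure_eq_measure m_def)
    finally show "(\<integral>x. f x \<partial>\<tau>') = c\<^sub>0 * (\<integral>x. f x \<partial>\<tau>) - c\<^sub>0 * m * f 1" .
  qed
  have "AE x in \<tau>'. 0 \<le> x" unfolding \<tau>'_def using nn by (subst AE_density) (auto elim!: eventually_mono)
  then have "has_stieltjes_moments \<tau>' (\<lambda>n. \<integral>x. x ^ n \<partial>\<tau>')"
    unfolding has_stieltjes_moments_def borel_measure_on_def
    using int(1)[OF mom] by (auto simp: \<tau>'_def sets)
  from levy_khintchine_has_mellin[OF this, of "c\<^sub>0 * ln (s 1) - \<beta>"] obtain \<nu>
    where \<nu>: "has_mellin \<nu> (\<lambda>u. exp ((c\<^sub>0 * ln (s 1) - \<beta>) * u + (\<integral>x. levy_kernel u x \<partial>\<tau>')))" by blast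
  obtain \<theta> \<theta>' where \<theta>: "\<theta> \<noteq> \<theta>'" "has_stieltjes_moments \<theta> (\<lambda>n. exp (\<beta> * (real n)\<^sup>2))"
    "has_stieltjes_moments \<theta>' (\<lambda>n. exp (\<beta> * (real n)\<^sup>2))"
    using exp_square_indeterminate[OF \<beta>] by blast
  obtain F where F: "has_mellin \<theta> F" "\<And>n. n \<ge> 1 \<Longrightarrow> F (real n) = exp (\<beta> * (real n)\<^sup>2)"
    using stieltjes_moments_imp_has_mellin[OF \<theta>(2)] by auto
  obtain F' where F': "has_mellin \<theta>' F'" "\<And>n. n \<ge> 1 \<Longrightarrow> F' (real n) = exp (\<beta> * (real n)\<^sup>2)"
    using stieltjes_moments_imp_has_mellin[OF \<theta>(3)] by auto
  have val: "s n powr c\<^sub>0 = exp (\<beta> * (real n)\<^sup>2) * exp ((c\<^sub>0 * ln (s 1) - \<beta>) * real n + (\<integral>x. levy_kernel (real n) x \<partial>\<tau>'))"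
    if n: "n \<ge> 1" for n
  proof -
    have "(\<integral>x. levy_kernel (real n) x \<partial>\<tau>') = c\<^sub>0 * (\<integral>x. levy_kernel (real n) x \<partial>\<tau>) - c\<^sub>0 * m * levy_kernel (real n) 1"
      using n by (intro int integrable_levy_kernel[OF \<tau>]) auto
    also have "(\<integral>x. levy_kernel (real n) x \<partial>\<tau>) = ln (s n) - ln (s 1) * real n"
      using levy_exponent_nat[OF \<tau> s0 n] by (simp add: levy_exponent_def)
    finally have "\<beta> * (real n)\<^sup>2 + ((c\<^sub>0 * ln (s 1) - \<beta>) * real n + (\<integral>x. levy_kernel (real n) x \<partial>\<tau>')) = c\<^sub>0 * ln (s n)"
      by (simp add: \<beta>_def levy_kernel_def power2_eq_square field_simps)
    then show ?thesis using pos[of n] by (simp add: powr_def flip: exp_add)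
  qed
  have "\<theta> \<diamondop> \<nu> = \<theta>' \<diamondop> \<nu>"
    by (rule S_determinate_unique[OF det]; rule stieltjes_moments_product_convolution[OF _ \<nu>])
       (rule F F' | simp add: s0 | simp only: F F' val)+
  then have "\<theta> = \<theta>'" by (rule product_convolution_cancel[OF F(1) F'(1) \<nu>, rotated]) simp
  with \<theta>(1) show False by contradiction
qed

section \<open>The equivalences and uniqueness\<close>

lemma levy_moments_iff_inf_div_stieltjes:
  assumes pos: "\<And>n. s n > 0"
  shows "s \<in> inf_div_stieltjes \<longleftrightarrow> s 0 = 1 \<and> (\<exists>\<tau>. has_stieltjes_moments \<tau> (log_second_diff s))"
proof (intro iffI conjI; (elim conjE exE)?)
  assume s: "s \<in> inf_div_stieltjes"
  then show s0: "s 0 = 1" by (simp add: inf_div_stieltjes_def normalized_stieltjes_moment_seq_def)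
  show "\<exists>\<tau>. has_stieltjes_moments \<tau> (log_second_diff s)"
    by (rule log_second_diff_stieltjes_if_roots[of s, OF pos s0]) (use s in \<open>simp add: inf_div_stieltjes_def\<close>)
next
  fix \<tau> assume s0: "s 0 = 1" and \<tau>: "has_stieltjes_moments \<tau> (log_second_diff s)"
  have powers: "stieltjes_moment_seq (\<lambda>n. s n powr c)" if c: "c > 0" for c
  proof -
    obtain \<mu> where "has_mellin \<mu> (\<lambda>u. exp (c * levy_exponent s \<tau> u))"
      using levy_exponent_has_mellin[OF \<tau> c] by blast
    from levy_exponent_moments[OF pos s0 \<tau> this] show ?thesis unfolding stieltjes_moment_seq_def ..
  qed
  have "(\<lambda>n. s n powr 1) = s" using pos by (intro ext) (simp add: less_imp_le)
  then have "stieltjes_moment_seq s" using powers[of 1] by simp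
  then show "s \<in> inf_div_stieltjes" using powers s0
    by (simp add: inf_div_stieltjes_def normalized_stieltjes_moment_seq_def)
qed

lemma inf_div_stieltjes_iff_normalized_powers:
  assumes pos: "\<And>n. s n > 0"
  shows "s \<in> inf_div_stieltjes \<longleftrightarrow> (\<forall>c>0. normalized_stieltjes_moment_seq (\<lambda>n. s n powr c))"
proof
  assume R: "\<forall>c>0. normalized_stieltjes_moment_seq (\<lambda>n. s n powr c)"
  have "(\<lambda>n. s n powr 1) = s" using pos by (intro ext) (simp add: less_imp_le)
  then have "normalized_stieltjes_moment_seq s" using R[rule_format, of 1] by simp
  then show "s \<in> inf_div_stieltjes" using R by (simp add: inf_div_stieltjes_def normalized_stieltjes_moment_seq_def)
qed (simp add: inf_div_stieltjes_def normalized_stieltjes_moment_seq_def)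

lemma inf_div_stieltjes_iff_levy:
  assumes pos: "\<And>n. s n > 0"
  shows "s \<in> inf_div_stieltjes \<longleftrightarrow> (\<exists>a b \<sigma>. levy_representation s a b \<sigma>)"
proof
  assume "s \<in> inf_div_stieltjes"
  then obtain \<tau> where "s 0 = 1" "has_stieltjes_moments \<tau> (log_second_diff s)"
    using levy_moments_iff_inf_div_stieltjes[of s, OF pos] by blast
  then show "\<exists>a b \<sigma>. levy_representation s a b \<sigma>" using levy_representation_if_moments[of \<tau> s] by auto
next
  assume "\<exists>a b \<sigma>. levy_representation s a b \<sigma>"
  then obtain a b \<sigma> where rep: "levy_representation s a b \<sigma>" by blast
  have "s 0 = 1" using levy_representation_moment_measure(2)[OF rep] pos[of 0] by simp
  then show "s \<in> inf_div_stieltjes"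
    using levy_representation_moment_measure(1)[OF rep] levy_moments_iff_inf_div_stieltjes[of s, OF pos] by blast
qed

lemma inf_div_stieltjes_imp_semigroup:
  assumes pos: "\<And>n. s n > 0" and s: "s \<in> inf_div_stieltjes"
  shows "\<exists>\<epsilon> \<rho>. semigroup_representation s \<epsilon> \<rho>"
proof -
  obtain \<tau> where s0: "s 0 = 1" and \<tau>: "has_stieltjes_moments \<tau> (log_second_diff s)"
    using levy_moments_iff_inf_div_stieltjes[of s, OF pos] s by blast
  have "\<forall>c. \<exists>\<mu>. c > 0 \<longrightarrow> has_mellin \<mu> (\<lambda>u. exp (c * levy_exponent s \<tau> u))"
    using levy_exponent_has_mellin[OF \<tau>] by blast
  then obtain \<mu> where \<mu>: "\<And>c. c > 0 \<Longrightarrow> has_mellin (\<mu> c) (\<lambda>u. exp (c * levy_exponent s \<tau> u))" by metis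
  obtain \<epsilon> \<rho> where "0 < \<epsilon>" "\<epsilon> \<le> 1" "product_convolution_semigroup \<rho>"
    "\<And>c. c > 0 \<Longrightarrow> has_mellin (\<rho> c) (\<lambda>u. exp (c * levy_exponent s \<tau> u) / \<epsilon> powr c)"
    using mellin_power_family_semigroup[OF \<mu>] by blast
  then have "semigroup_representation s \<epsilon> \<rho>"
    by (rule semigroup_representation_if_mellin[of s, OF pos s0 _ _ _ _ levy_exponent_nat[OF \<tau> s0]])
  then show ?thesis by blast
qed

lemma laplace_representation_imp_inf_div_stieltjes:
  assumes pos: "\<And>n. s n > 0" and rep: "laplace_representation s \<epsilon> \<omega>"
  shows "s \<in> inf_div_stieltjes"
proof -
  interpret \<omega>: real_distribution \<omega> using rep by (simp add: laplace_representation_def infinitely_divisible_def)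
  have "s 0 = (1 - \<epsilon>) * of_bool ((0::nat) = 0) + \<epsilon> * (\<integral>y. exp (- real 0 * y) \<partial>\<omega>)"
    using rep unfolding laplace_representation_def by blast
  then have s0: "s 0 = 1" using \<omega>.prob_space by simp
  have "stieltjes_moment_seq (\<lambda>n. s n powr (1 / k))" if "k \<ge> 1" for k :: nat
    using laplace_representation_root[OF rep pos that] unfolding stieltjes_moment_seq_def by blast
  from log_second_diff_stieltjes_if_roots[of s, OF pos s0 this] show ?thesis
    using levy_moments_iff_inf_div_stieltjes[of s, OF pos] s0 by blast
qed

text \<open>
  For \<open>c \<le> c\<^sub>0\<close> the power \<open>c\<close> is determinate, so the mixture of \<open>\<rho> c\<close> with the atom at \<open>0\<close> is unique. The semigroup law
  extends this from small parameters to all \<open>c\<close>.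
\<close>

lemma semigroup_representation_unique:
  assumes pos: "\<And>n. s n > 0" and s: "s \<in> inf_div_stieltjes" and c0: "c\<^sub>0 > 0" and det: "S_determinate (\<lambda>n. s n powr c\<^sub>0)"
    and rep: "semigroup_representation s \<epsilon> \<rho>" and rep': "semigroup_representation s \<epsilon>' \<rho>'"
  shows "\<epsilon> = \<epsilon>'" and "c > 0 \<Longrightarrow> \<rho> c = \<rho>' c"
proof -
  have s0: "s 0 = 1" and powers: "\<And>c. c > 0 \<Longrightarrow> stieltjes_moment_seq (\<lambda>n. s n powr c)"
    using s by (auto simp: inf_div_stieltjes_def normalized_stieltjes_moment_seq_def)
  have \<epsilon>: "0 < \<epsilon>" "\<epsilon> \<le> 1" "0 < \<epsilon>'" "\<epsilon>' \<le> 1" using rep rep' by (auto simp: semigroup_representation_def)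
  have le1: "\<epsilon> powr c \<le> 1" "\<epsilon>' powr c \<le> 1" if "c > 0" for c
    using powr_mono2[of c \<epsilon> 1] powr_mono2[of c \<epsilon>' 1] \<epsilon> that by auto
  have small: "\<epsilon> powr c = \<epsilon>' powr c \<and> \<rho> c = \<rho>' c" if c: "0 < c" "c \<le> c\<^sub>0" for c
  proof -
    note R = semigroup_representation_moments[OF rep c(1)] and R' = semigroup_representation_moments[OF rep' c(1)]
    have "zero_mixture (\<epsilon> powr c) (\<rho> c) = zero_mixture (\<epsilon>' powr c) (\<rho>' c)"
      by (rule S_determinate_smaller_power[OF pos s0 powers det c R(1) R'(1)])
    from zero_mixture_eq_imp[OF R(3) R'(3) R(2) R'(2) R(4) R'(4) _ le1(1)[OF c(1)] _ le1(2)[OF c(1)] this] \<epsilon>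
    show ?thesis by simp
  qed
  have "(\<epsilon> powr c\<^sub>0) powr (1 / c\<^sub>0) = (\<epsilon>' powr c\<^sub>0) powr (1 / c\<^sub>0)" using small[of c\<^sub>0] c0 by simp
  then show "\<epsilon> = \<epsilon>'" using \<epsilon> c0 by (simp add: powr_powr)
  assume c: "c > 0"
  define n where "n = nat \<lceil>c / c\<^sub>0\<rceil>"
  have n: "real n \<ge> c / c\<^sub>0" "n \<ge> 1" using c c0 by (auto simp: n_def of_nat_ceiling)
      (metis One_nat_def Suc_leI divide_pos_pos zero_less_ceiling zero_less_nat_eq)
  define d where "d = c / n"
  have d: "0 < d" "d \<le> c\<^sub>0" using n c c0 by (auto simp: d_def field_simps)
  have mult: "\<rho> (real (Suc k) * d) = \<rho>' (real (Suc k) * d)" for k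
  proof (induction k)
    case 0
    then show ?case using small[OF d] by simp
  next
    case (Suc k)
    have step: "R (real (Suc (Suc k)) * d) = R d \<diamondop> R (real (Suc k) * d)" if "semigroup_representation s e R" for R e
    proof -
      have "R d \<diamondop> R (real (Suc k) * d) = R (d + real (Suc k) * d)"
        using that d by (auto simp: semigroup_representation_def product_convolution_semigroup_def)
      then show ?thesis by (simp add: algebra_simps)
    qed
    show ?case unfolding step[OF rep] step[OF rep'] using Suc small[OF d] by simp
  qed
  have "real (Suc (n - 1)) * d = c" using n by (simp add: d_def)
  then show "\<rho> c = \<rho>' c" using mult[of "n - 1"] by simp
qed

text \<open>
  For \<open>1 / k \<le> c\<^sub>0\<close> the \<open>k\<close>-th root of the sequence is determinate, which fixes the \<open>k\<close>-th convolution roots of \<open>\<omega>\<close> and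
  \<open>\<omega>'\<close> and the roots of \<open>\<epsilon>\<close> and \<open>\<epsilon>'\<close>.
\<close>

lemma laplace_representation_unique:
  assumes pos: "\<And>n. s n > 0" and s: "s \<in> inf_div_stieltjes" and c0: "c\<^sub>0 > 0" and det: "S_determinate (\<lambda>n. s n powr c\<^sub>0)"
    and rep: "laplace_representation s \<epsilon> \<omega>" and rep': "laplace_representation s \<epsilon>' \<omega>'"
  shows "\<epsilon> = \<epsilon>'" and "\<omega> = \<omega>'"
proof -
  have s0: "s 0 = 1" and powers: "\<And>c. c > 0 \<Longrightarrow> stieltjes_moment_seq (\<lambda>n. s n powr c)"
    using s by (auto simp: inf_div_stieltjes_def normalized_stieltjes_moment_seq_def)
  have \<epsilon>: "0 < \<epsilon>" "\<epsilon> \<le> 1" "0 < \<epsilon>'" "\<epsilon>' \<le> 1" using rep rep' by (auto simp: laplace_representation_def)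
  obtain k :: nat where k: "k \<ge> 1" "1 / k \<le> c\<^sub>0"
  proof -
    obtain m :: nat where m: "m > 0" "inverse (real m) < c\<^sub>0" using ex_inverse_of_nat_less[OF c0] by blast
    show ?thesis using that[of m] m by (simp add: inverse_eq_divide)
  qed
  then have k0: "0 < 1 / real k" by simp
  have le1: "\<epsilon> powr (1 / k) \<le> 1" "\<epsilon>' powr (1 / k) \<le> 1"
    using powr_mono2[of "1 / k" \<epsilon> 1] powr_mono2[of "1 / k" \<epsilon>' 1] \<epsilon> by auto
  obtain \<kappa> where \<kappa>: "prob_space \<kappa>" "sets \<kappa> = sets borel" "AE x in \<kappa>. 0 < x"
    "has_stieltjes_moments (zero_mixture (\<epsilon> powr (1 / k)) \<kappa>) (\<lambda>n. s n powr (1 / k))"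
    "\<omega> = ((\<lambda>\<eta>. distr \<kappa> borel (\<lambda>x. - ln x) \<star> \<eta>) ^^ k) (return borel 0)"
    by (rule laplace_representation_root[OF rep pos k(1)])
  obtain \<kappa>' where \<kappa>': "prob_space \<kappa>'" "sets \<kappa>' = sets borel" "AE x in \<kappa>'. 0 < x"
    "has_stieltjes_moments (zero_mixture (\<epsilon>' powr (1 / k)) \<kappa>') (\<lambda>n. s n powr (1 / k))"
    "\<omega>' = ((\<lambda>\<eta>. distr \<kappa>' borel (\<lambda>x. - ln x) \<star> \<eta>) ^^ k) (return borel 0)"
    by (rule laplace_representation_root[OF rep' pos k(1)])
  have eq: "zero_mixture (\<epsilon> powr (1 / k)) \<kappa> = zero_mixture (\<epsilon>' powr (1 / k)) \<kappa>'"
    by (rule S_determinate_smaller_power[OF pos s0 powers det k0 k(2) \<kappa>(4) \<kappa>'(4)])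
  have eps: "\<epsilon> powr (1 / k) = \<epsilon>' powr (1 / k)" and "\<kappa> = \<kappa>'"
    using zero_mixture_eq_imp[OF \<kappa>(2) \<kappa>'(2) \<kappa>(1) \<kappa>'(1) \<kappa>(3) \<kappa>'(3) _ le1(1) _ le1(2) eq] \<epsilon> by auto
  then show "\<omega> = \<omega>'" using \<kappa>(5) \<kappa>'(5) by simp
  have "(\<epsilon> powr (1 / k)) powr k = (\<epsilon>' powr (1 / k)) powr k" using eps by simp
  then show "\<epsilon> = \<epsilon>'" using \<epsilon> k by (simp add: powr_powr)
qed

text \<open>
  As \<open>b = 0\<close>, the moment measure is just \<open>(1 - x)\<^sup>2 \<sigma>\<close>, and its moments are determinate.
\<close>

lemma levy_representation_determinate:
  assumes pos: "\<And>n. s n > 0" and c0: "c\<^sub>0 > 0" and det: "S_determinate (\<lambda>n. s n powr c\<^sub>0)"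
    and rep: "levy_representation s a b \<sigma>"
  shows "a = ln (s 1)" and "b = 0" and "S_determinate_measure (density \<sigma> (\<lambda>x. ennreal ((1 - x)\<^sup>2)))"
proof -
  note R = levy_representation_moment_measure[OF rep]
  have s0: "s 0 = 1" using R(2) pos[of 0] by simp
  show b: "b = 0" using levy_moment_measure_no_atom[OF pos s0 c0 det R(1)] R(4) by simp
  show "a = ln (s 1)" using R(3) b by simp
  have sets: "sets \<sigma> = sets borel" using rep
    by (simp add: levy_representation_def radon_measure_on_def borel_measure_on_def)
  have "levy_moment_measure b \<sigma> = density \<sigma> (\<lambda>x. ennreal ((1 - x)\<^sup>2))"
  proof (rule measure_eqI)
    fix A assume "A \<in> sets (levy_moment_measure b \<sigma>)"
    then have "A \<in> sets borel" by (simp add: levy_moment_measure_def sets)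
    then show "emeasure (levy_moment_measure b \<sigma>) A = emeasure (density \<sigma> (\<lambda>x. ennreal ((1 - x)\<^sup>2))) A"
      unfolding levy_moment_measure_def by (subst emeasure_measure_plus) (auto simp: sets b emeasure_density)
  qed (simp add: levy_moment_measure_def)
  with R(1) have m: "has_stieltjes_moments (density \<sigma> (\<lambda>x. ennreal ((1 - x)\<^sup>2))) (log_second_diff s)" by simp
  then have "S_determinate (log_second_diff s)"
    unfolding S_determinate_def using levy_moment_measure_unique[OF pos s0 c0 det] by blast
  with m show "S_determinate_measure (density \<sigma> (\<lambda>x. ennreal ((1 - x)\<^sup>2)))"
    unfolding S_determinate_measure_def by blast
qed

lemma levy_representation_unique:
  assumes pos: "\<And>n. s n > 0" and c0: "c\<^sub>0 > 0" and det: "S_determinate (\<lambda>n. s n powr c\<^sub>0)"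
    and rep: "levy_representation s a b \<sigma>" and rep': "levy_representation s a' b' \<sigma>'"
  shows "a = a' \<and> b = b' \<and> \<sigma> = \<sigma>'"
proof -
  note R = levy_representation_moment_measure[OF rep] and R' = levy_representation_moment_measure[OF rep']
  have s0: "s 0 = 1" using R(2) pos[of 0] by simp
  have eq: "levy_moment_measure b \<sigma> = levy_moment_measure b' \<sigma>'"
    by (rule levy_moment_measure_unique[OF pos s0 c0 det R(1) R'(1)])
  then show ?thesis using R(3-5) R'(3-5) by simp
qed

theorem theorem1p4:
  fixes s :: "nat \<Rightarrow> real"
  assumes pos: "\<forall>n. s n > 0"
  shows
    "((\<forall>c>0. normalized_stieltjes_moment_seq (\<lambda>n. s n powr c)) \<longleftrightarrow> s \<in> inf_div_stieltjes) \<and>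
     (s \<in> inf_div_stieltjes \<longleftrightarrow> (\<exists>a b \<sigma>. levy_representation s a b \<sigma>)) \<and>
     (s \<in> inf_div_stieltjes \<longleftrightarrow> (\<exists>\<epsilon> \<omega>. laplace_representation s \<epsilon> \<omega>)) \<and>
     (s \<in> inf_div_stieltjes \<longleftrightarrow> (\<exists>\<epsilon> \<rho>. semigroup_representation s \<epsilon> \<rho>)) \<and>
     (s \<in> inf_div_stieltjes \<and> (\<exists>c\<^sub>0>0. S_determinate (\<lambda>n. s n powr c\<^sub>0)) \<longrightarrow>
        (\<forall>a b \<sigma> a' b' \<sigma>'. levy_representation s a b \<sigma> \<and> levy_representation s a' b' \<sigma>' \<longrightarrow>
           a = a' \<and> b = b' \<and> \<sigma> = \<sigma>') \<and>
        (\<forall>\<epsilon> \<omega> \<epsilon>' \<omega>'. laplace_representation s \<epsilon> \<omega> \<and> laplace_representation s \<epsilon>' \<omega>' \<longrightarrow>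
           \<epsilon> = \<epsilon>' \<and> \<omega> = \<omega>') \<and>
        (\<forall>\<epsilon> \<rho> \<epsilon>' \<rho>'. semigroup_representation s \<epsilon> \<rho> \<and> semigroup_representation s \<epsilon>' \<rho>' \<longrightarrow>
           \<epsilon> = \<epsilon>' \<and> (\<forall>c>0. \<rho> c = \<rho>' c)) \<and>
        (\<forall>\<epsilon> \<omega> \<epsilon>' \<rho>. laplace_representation s \<epsilon> \<omega> \<and> semigroup_representation s \<epsilon>' \<rho> \<longrightarrow>
           \<epsilon> = \<epsilon>') \<and>
        (\<forall>a b \<sigma>. levy_representation s a b \<sigma> \<longrightarrow>
           a = ln (s 1) \<and> b = 0 \<and>
           S_determinate_measure (density \<sigma> (\<lambda>x. ennreal ((1 - x)\<^sup>2)))))"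
proof -
  have pos': "\<And>n. s n > 0" using pos by blast
  note levy = inf_div_stieltjes_iff_levy[of s, OF pos']
  note to_laplace = laplace_representation_if_semigroup[of s, OF _ pos']
  note from_laplace = laplace_representation_imp_inf_div_stieltjes[of s, OF pos']
  have semigroup: "s \<in> inf_div_stieltjes \<longleftrightarrow> (\<exists>\<epsilon> \<rho>. semigroup_representation s \<epsilon> \<rho>)"
    using inf_div_stieltjes_imp_semigroup[of s, OF pos'] to_laplace from_laplace by blast
  have laplace: "s \<in> inf_div_stieltjes \<longleftrightarrow> (\<exists>\<epsilon> \<omega>. laplace_representation s \<epsilon> \<omega>)"
    using semigroup to_laplace from_laplace by blast
  show ?thesis
  proof (intro conjI impI)
    show "(\<forall>c>0. normalized_stieltjes_moment_seq (\<lambda>n. s n powr c)) \<longleftrightarrow> s \<in> inf_div_stieltjes"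
      using inf_div_stieltjes_iff_normalized_powers[of s, OF pos'] by blast
    assume "s \<in> inf_div_stieltjes \<and> (\<exists>c\<^sub>0>0. S_determinate (\<lambda>n. s n powr c\<^sub>0))"
    then obtain c\<^sub>0 where s: "s \<in> inf_div_stieltjes" and c0: "c\<^sub>0 > 0" and det: "S_determinate (\<lambda>n. s n powr c\<^sub>0)" by blast
    show "\<forall>a b \<sigma> a' b' \<sigma>'. levy_representation s a b \<sigma> \<and> levy_representation s a' b' \<sigma>' \<longrightarrow> a = a' \<and> b = b' \<and> \<sigma> = \<sigma>'"
      using levy_representation_unique[of s, OF pos' c0 det] by blast
    show "\<forall>\<epsilon> \<omega> \<epsilon>' \<omega>'. laplace_representation s \<epsilon> \<omega> \<and> laplace_representation s \<epsilon>' \<omega>' \<longrightarrow> \<epsilon> = \<epsilon>' \<and> \<omega> = \<omega>'"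
      using laplace_representation_unique[of s, OF pos' s c0 det] by blast
    show "\<forall>\<epsilon> \<rho> \<epsilon>' \<rho>'. semigroup_representation s \<epsilon> \<rho> \<and> semigroup_representation s \<epsilon>' \<rho>' \<longrightarrow> \<epsilon> = \<epsilon>' \<and> (\<forall>c>0. \<rho> c = \<rho>' c)"
      using semigroup_representation_unique[of s, OF pos' s c0 det] by blast
    show "\<forall>\<epsilon> \<omega> \<epsilon>' \<rho>. laplace_representation s \<epsilon> \<omega> \<and> semigroup_representation s \<epsilon>' \<rho> \<longrightarrow> \<epsilon> = \<epsilon>'"
      using laplace_representation_unique(1)[of s, OF pos' s c0 det] to_laplace by blast
    show "\<forall>a b \<sigma>. levy_representation s a b \<sigma> \<longrightarrow> a = ln (s 1) \<and> b = 0 \<and>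
        S_determinate_measure (density \<sigma> (\<lambda>x. ennreal ((1 - x)\<^sup>2)))"
      using levy_representation_determinate[of s, OF pos' c0 det] by blast
  qed (fact levy laplace semigroup)+
qed

end
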